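(* Consider $f:=\max\{f_1,\dots,f_m\}$ for functions $f_i$ of class $\mathcal{C}^2$ on $\mathbb{R}^n$ and a point $\bar x\in\mathbb{R}^n$ with $0\in\partial f(\bar x)$. Let $I(\bar x):=\{i\mid f_i(\bar x)=f(\bar x)\}$ and $\mathcal{V}(\bar x):=\{w\in\mathbb{R}^n\mid\langle\nabla f_i(\bar x),w\rangle\le0\ \forall i\in I(\bar x)\}$. For $(\kappa,\lambda,\beta,w,z)\in\mathbb{R}\times\mathbb{R}^m\times\mathbb{R}^m\times\mathbb{R}^n\times\mathbb{R}^n$ consider the system $$(\ast)\quad\begin{cases}\sum_{i\in I(\bar x)}\lambda_i=1,\quad\sum_{i\in I(\bar x)}\lambda_i\nabla f_i(\bar x)=0,\\ \text{and for all } i\in I(\bar x):\\ \beta_i\ge0,\ \langle\nabla f_i(\bar x),w\rangle\le0,\ \beta_i\langle\nabla f_i(\bar x),w\rangle=0,\\ \lambda_i\ge0,\ \kappa-\langle\nabla f_i(\bar x),z\rangle-\langle\nabla^2f_i(\bar x)w,w\rangle\ge0,\\ \lambda_i[\kappa-\langle\nabla f_i(\bar x),z\rangle-\langle\nabla^2f_i(\bar x)w,w\rangle]=0.\end{cases}$$ The following three conditions are equivalent; assume that one of them holds: (a) $D(\partial f)(\bar x\mid0)^{-1}(0)=\{0\}$. (b) For each $\bar w\neq0$ with $d^2f(\bar x\mid0)(\bar w)=0$, the following implication holds: if $$\sum_{i\in I(\bar x)}\lambda_i\begin{pmatrix}\nabla^2f_i(\bar x)\bar w\\ \nabla f_i(\bar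 x)\end{pmatrix}+\sum_{i\in I(\bar x)}\beta_i\begin{pmatrix}\nabla f_i(\bar x)\\0\end{pmatrix}=\begin{pmatrix}0\\0\end{pmatrix},\quad\lambda_i\ge0,\ \beta_i\ge0\ \ \forall i\in I(\bar x),$$ then $\lambda_i=0$ for all $i\in I(\bar x)$. (c) The optimal value of the following smooth optimization problem is positive: $$\min_{(\kappa,\lambda,\beta,w,z)}\ \frac12\Big\|\sum_{i\in I(\bar x)}[\lambda_i\nabla^2f_i(\bar x)w+\beta_i\nabla f_i(\bar x)]\Big\|^2\quad\text{subject to }(\ast),\ \|w\|^2=1.$$ Then $f$ satisfies the KL property at $\bar x$ with exponent $\frac12$, which is sharp if there is some $w\in\mathcal{V}(\bar x)$ with $d^2f(\bar x\mid0)(w)>0$, or equivalently if there is some $(\kappa,\lambda,\beta,w,z)$ satisfying $(\ast)$ with $\kappa>0$. Moreover, $\mathrm{KL}(f,\bar x,\frac12)$ is the square root of the optimal value of the smooth optimization problem $$\min_{(\kappa,\lambda,\beta,w,z)}\ \frac12\frac{\big\|\sum_{i\in I(\bar x)}[\lambda_i\nabla^2f_i(\bar x)w+\beta_i\nabla f_i(\bar x)]\big\|^2}{\kappa}\quad\text{subject to }(\ast),\ \|w\|^2=1,\ \kappa>0.$$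
   Context: The optimal value of an infeasible minimization problem is $+\infty$. $d(v,A)=\inf_{a\in A}\|a-v\|$, with $d(v,\emptyset)=+\infty$. Subgradients. Let $f(x)$ be finite. $v\in\widehat\partial f(x)$ if $f(y)\ge f(x)+\langle v,y-x\rangle+o(\|y-x\|)$. $v\in\partial f(x)$ (limiting) if there are $x_k\to x$, $v_k\to v$ with $f(x_k)\to f(x)$ and $v_k\in\widehat\partial f(x_k)$. Second subderivative: $d^2f(\bar x\mid0)(w):=\liminf_{t\downarrow0,\ w'\to w}\frac{f(\bar x+tw')-f(\bar x)}{\frac12t^2}$. Graphical derivative: $z\in D(\partial f)(\bar x\mid0)(w)$ iff $(w,z)\in T_{\operatorname{gph}\partial f}(\bar x,0)$, where $\operatorname{gph}\partial f=\{(x,v)\mid v\in\partial f(x)\}$ and $w\in T_A(x)$ iff there are $t_k\downarrow0$, $w_k\to w$ with $x+t_kw_k\in A$. KL property. $f$ satisfies the KL property at $\bar x$ with exponent $\theta\in[0,1)$ if there exist $\mu>0$ (modulus), $\epsilon>0$, $\nu\in(0,+\infty]$ such that $d(0,\partial f(x))\ge\frac{\mu}{1-\theta}(f(x)-f(\bar x))^{\theta}$ whenever $\|x-\bar x\|\le\epsilon$ and $f(\bar x)<f(x)<f(\bar x)+\nu$. $\mathrm{KL}(f,\bar x,\theta)$ is the supremum of all such $\mu$ ($\sup\emptyset:=0$); equivalently the liminf of $\frac{(1-\theta)d(0,\partial f(x))}{(f(x)-f(\bar x))^{\theta}}$ as $x\to\bar x$, $f(x)\to f(\bar x)$, $f(x)>f(\bar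 x)$ ($+\infty$ if there are no such sequences). An exponent $\theta\in(0,1)$ is sharp if $f$ satisfies the KL property at $\bar x$ with exponent $\theta$ but not with any exponent $\theta'\in[0,\theta)$. *)

theory Defs
  imports "HOL-Analysis.Analysis" "HOL-Library.Landau_Symbols"
begin

text \<open>All functions \<^term>\<open>f\<close> below are real-valued, i.e. finite everywhere, as a pointwise maximum
  of finitely many real-valued functions is.  Derived quantities that may be infinite are
  \<^typ>\<open>ereal\<close>-valued, where the infimum over the empty set is \<^term>\<open>\<infinity>\<close>.\<close>

subsection \<open>Functions of class C2\<close>

definition gradient :: "('a::real_inner \<Rightarrow> real) \<Rightarrow> 'a \<Rightarrow> 'a" where
  "gradient f x = (THE D. GDERIV f x :> D)"

definition hessian :: "(real^'n \<Rightarrow> real) \<Rightarrow> real^'n \<Rightarrow> real^'n^'n" where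
  "hessian f x = jacobian (gradient f) (at x)"

definition C2 :: "(real^'n \<Rightarrow> real) \<Rightarrow> bool" where
  "C2 f \<longleftrightarrow> (\<forall>x. f differentiable (at x)) \<and> (\<forall>x. gradient f differentiable (at x))
      \<and> continuous_on UNIV (hessian f)"

subsection \<open>Subgradients\<close>

definition regular_subdiff :: "('a::real_inner \<Rightarrow> real) \<Rightarrow> 'a \<Rightarrow> 'a set" where
  "regular_subdiff f x = {v. \<exists>r. r \<in> o[at x](\<lambda>y. norm (y - x))
      \<and> (\<forall>y. f y \<ge> f x + v \<bullet> (y - x) + r y)}"

definition subdiff :: "('a::real_inner \<Rightarrow> real) \<Rightarrow> 'a \<Rightarrow> 'a set" where
  "subdiff f x = {v. \<exists>X V. X \<longlonglongrightarrow> x \<and> V \<longlonglongrightarrow> v \<and> (\<lambda>k. f (X k)) \<longlonglongrightarrow> f x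
      \<and> (\<forall>k::nat. V k \<in> regular_subdiff f (X k))}"

subsection \<open>Second-order objects\<close>

text \<open>The second subderivative of \<^term>\<open>f\<close> at \<^term>\<open>x\<close> for the subgradient 0, in direction \<^term>\<open>w\<close>.
  The limes inferior is over all \<^term>\<open>w'\<close> near \<^term>\<open>w\<close>, including \<^term>\<open>w\<close> itself.\<close>
definition second_subderiv0 :: "('a::real_normed_vector \<Rightarrow> real) \<Rightarrow> 'a \<Rightarrow> 'a \<Rightarrow> ereal" where
  "second_subderiv0 f x w = Liminf (at_right 0 \<times>\<^sub>F nhds w)
      (\<lambda>(t, w'). ereal ((f (x + t *\<^sub>R w') - f x) / (1/2 * t\<^sup>2)))"

definition tangent_cone :: "'a::real_normed_vector set \<Rightarrow> 'a \<Rightarrow> 'a set" where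
  "tangent_cone A x = {w. \<exists>t W. (\<forall>k::nat. t k > (0::real)) \<and> t \<longlonglongrightarrow> 0 \<and> W \<longlonglongrightarrow> w
      \<and> (\<forall>k. x + t k *\<^sub>R W k \<in> A)}"

definition graph_of :: "('a \<Rightarrow> 'b set) \<Rightarrow> ('a \<times> 'b) set" where
  "graph_of S = {(x, v). v \<in> S x}"

definition graphical_deriv ::
  "('a::real_normed_vector \<Rightarrow> 'b::real_normed_vector set) \<Rightarrow> 'a \<Rightarrow> 'b \<Rightarrow> 'a \<Rightarrow> 'b set" where
  "graphical_deriv S x v w = {z. (w, z) \<in> tangent_cone (graph_of S) (x, v)}"

definition set_valued_inverse :: "('a \<Rightarrow> 'b set) \<Rightarrow> 'b \<Rightarrow> 'a set" where
  "set_valued_inverse S z = {w. z \<in> S w}"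

subsection \<open>The Kurdyka-Lojasiewicz property\<close>

text \<open>Not \<^const>\<open>infdist\<close>, which takes the value 0 on the empty set.\<close>
definition dist_to_set :: "'a::real_normed_vector \<Rightarrow> 'a set \<Rightarrow> ereal" where
  "dist_to_set v A = (INF a\<in>A. ereal (norm (a - v)))"

definition KL_with_modulus ::
  "('a::real_inner \<Rightarrow> real) \<Rightarrow> 'a \<Rightarrow> real \<Rightarrow> real \<Rightarrow> bool" where
  "KL_with_modulus f xbar \<theta> \<mu> \<longleftrightarrow> \<mu> > 0 \<and>
     (\<exists>\<epsilon>>0. \<exists>\<nu>::ereal. \<nu> > 0 \<and>
        (\<forall>x. norm (x - xbar) \<le> \<epsilon> \<and> f xbar < f x \<and> ereal (f x) < ereal (f xbar) + \<nu> \<longrightarrow>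
           dist_to_set 0 (subdiff f x) \<ge> ereal (\<mu> / (1 - \<theta>) * (f x - f xbar) powr \<theta>)))"

definition KL_property :: "('a::real_inner \<Rightarrow> real) \<Rightarrow> 'a \<Rightarrow> real \<Rightarrow> bool" where
  "KL_property f xbar \<theta> \<longleftrightarrow> \<theta> \<in> {0..<1} \<and> (\<exists>\<mu>. KL_with_modulus f xbar \<theta> \<mu>)"

text \<open>Inserting 0 implements the convention that the supremum over the empty set is 0 (instead of
  \<^term>\<open>-\<infinity>\<close>); otherwise it has no effect since all moduli are positive.\<close>
definition KL_modulus :: "('a::real_inner \<Rightarrow> real) \<Rightarrow> 'a \<Rightarrow> real \<Rightarrow> ereal" where
  "KL_modulus f xbar \<theta> = Sup (insert 0 {ereal \<mu> |\<mu>. KL_with_modulus f xbar \<theta> \<mu>})"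

definition sharp_KL_exponent :: "('a::real_inner \<Rightarrow> real) \<Rightarrow> 'a \<Rightarrow> real \<Rightarrow> bool" where
  "sharp_KL_exponent f xbar \<theta> \<longleftrightarrow> \<theta> \<in> {0<..<1} \<and> KL_property f xbar \<theta>
      \<and> (\<forall>\<theta>'\<in>{0..<\<theta>}. \<not> KL_property f xbar \<theta>')"

text \<open>The square root on \<^term>\<open>{0..\<infinity>} :: ereal set\<close>; only used for nonnegative arguments.\<close>
definition ereal_sqrt :: "ereal \<Rightarrow> ereal" where
  "ereal_sqrt x = (if x = \<infinity> then \<infinity> else ereal (sqrt (real_of_ereal x)))"

subsection \<open>Pointwise maxima\<close>

text \<open>The functions are indexed by a finite (nonempty) type \<^typ>\<open>'m\<close> in place of {1..m}.\<close>

definition pmax :: "('m::finite \<Rightarrow> 'a \<Rightarrow> real) \<Rightarrow> 'a \<Rightarrow> real" where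
  "pmax F x = (MAX i. F i x)"

definition active :: "('m::finite \<Rightarrow> 'a \<Rightarrow> real) \<Rightarrow> 'a \<Rightarrow> 'm set" where
  "active F x = {i. F i x = pmax F x}"

definition crit_cone :: "('m::finite \<Rightarrow> 'a::real_inner \<Rightarrow> real) \<Rightarrow> 'a \<Rightarrow> 'a set" where
  "crit_cone F x = {w. \<forall>i\<in>active F x. gradient (F i) x \<bullet> w \<le> 0}"

text \<open>The system (*) at \<^term>\<open>x\<close>; multipliers with inactive indices are unconstrained.\<close>
definition star_system ::
  "('m::finite \<Rightarrow> real^'n \<Rightarrow> real) \<Rightarrow> real^'n
    \<Rightarrow> real \<Rightarrow> real^'m \<Rightarrow> real^'m \<Rightarrow> real^'n \<Rightarrow> real^'n \<Rightarrow> bool" where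
  "star_system F x \<kappa> l b w z \<longleftrightarrow>
     (\<Sum>i\<in>active F x. l $ i) = 1 \<and>
     (\<Sum>i\<in>active F x. l $ i *\<^sub>R gradient (F i) x) = 0 \<and>
     (\<forall>i\<in>active F x.
        b $ i \<ge> 0 \<and> gradient (F i) x \<bullet> w \<le> 0 \<and> b $ i * (gradient (F i) x \<bullet> w) = 0 \<and>
        l $ i \<ge> 0 \<and>
        \<kappa> - gradient (F i) x \<bullet> z - (hessian (F i) x *v w) \<bullet> w \<ge> 0 \<and>
        l $ i * (\<kappa> - gradient (F i) x \<bullet> z - (hessian (F i) x *v w) \<bullet> w) = 0)"

definition combined_grad ::
  "('m::finite \<Rightarrow> real^'n \<Rightarrow> real) \<Rightarrow> real^'n \<Rightarrow> real^'m \<Rightarrow> real^'m \<Rightarrow> real^'n \<Rightarrow> real^'n" where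
  "combined_grad F x l b w =
     (\<Sum>i\<in>active F x. l $ i *\<^sub>R (hessian (F i) x *v w) + b $ i *\<^sub>R gradient (F i) x)"

definition optval_c :: "('m::finite \<Rightarrow> real^'n \<Rightarrow> real) \<Rightarrow> real^'n \<Rightarrow> ereal" where
  "optval_c F x =
     (INF (\<kappa>, l, b, w, z) \<in> {(\<kappa>, l, b, w, z). star_system F x \<kappa> l b w z \<and> (norm w)\<^sup>2 = 1}.
        ereal (1/2 * (norm (combined_grad F x l b w))\<^sup>2))"

definition optval_KL :: "('m::finite \<Rightarrow> real^'n \<Rightarrow> real) \<Rightarrow> real^'n \<Rightarrow> ereal" where
  "optval_KL F x =
     (INF (\<kappa>, l, b, w, z) \<in>
          {(\<kappa>, l, b, w, z). star_system F x \<kappa> l b w z \<and> (norm w)\<^sup>2 = 1 \<and> \<kappa> > 0}.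
        ereal (1/2 * ((norm (combined_grad F x l b w))\<^sup>2 / \<kappa>)))"

definition cond_a :: "('m::finite \<Rightarrow> real^'n \<Rightarrow> real) \<Rightarrow> real^'n \<Rightarrow> bool" where
  "cond_a F x \<longleftrightarrow> set_valued_inverse (graphical_deriv (subdiff (pmax F)) x 0) 0 = {0}"

definition cond_b :: "('m::finite \<Rightarrow> real^'n \<Rightarrow> real) \<Rightarrow> real^'n \<Rightarrow> bool" where
  "cond_b F x \<longleftrightarrow>
     (\<forall>w. w \<noteq> 0 \<and> second_subderiv0 (pmax F) x w = 0 \<longrightarrow>
        (\<forall>(l::real^'m) (b::real^'m).
           (\<Sum>i\<in>active F x. l $ i *\<^sub>R (hessian (F i) x *v w, gradient (F i) x))
             + (\<Sum>i\<in>active F x. b $ i *\<^sub>R (gradient (F i) x, 0)) = (0, 0)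
           \<and> (\<forall>i\<in>active F x. l $ i \<ge> 0 \<and> b $ i \<ge> 0)
           \<longrightarrow> (\<forall>i\<in>active F x. l $ i = 0)))"

definition cond_c :: "('m::finite \<Rightarrow> real^'n \<Rightarrow> real) \<Rightarrow> real^'n \<Rightarrow> bool" where
  "cond_c F x \<longleftrightarrow> optval_c F x > 0"

end

theory Submission
  imports Defs
begin

text \<open>Let \<^term>\<open>f\<close> be the maximum, \<open>g\<^sub>i\<close> and \<open>H\<^sub>i\<close> the gradients and Hessians at \<open>xbar\<close> of the functions that
  are active there. The proof rests on the observation that the solutions of the system describe the
  blow-up limits of the subgradients of \<^term>\<open>f\<close> near \<open>xbar\<close>: points \<open>x = xbar + t w\<close> with \<open>norm w = 1\<close>
  and subgradients \<open>v\<close> of size \<open>O(t)\<close> have limits \<^term>\<open>w\<close>, \<open>u = lim v / t\<close> and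
  \<open>\<kappa> = lim 2 (f x - f xbar) / t\<^sup>2\<close> along subsequences, and the triples \<open>(w, u, \<kappa>)\<close> that occur are those
  belonging to solutions, with \<open>u\<close> as combined gradient.

  From subgradients to solutions (\<open>blow_up\<close>): a subgradient at \<open>x\<close> is a convex combination of the
  gradients of the functions active at \<open>x\<close>. Expanding these gradients and dividing by \<open>t\<close> leaves
  \<open>\<Sum> l\<^sub>i H\<^sub>i w\<close> plus a nonnegative combination of the \<open>g\<^sub>i\<close> whose coefficients may blow up; since
  finitely generated cones are closed, its limit still is such a combination, which gives the
  multipliers \<open>b\<close>. The inequalities between function values show that the limit of the \<open>l\<close> maximizes
  the curvature \<open>\<Sum> l\<^sub>i \<langle>H\<^sub>i w, w\<rangle>\<close> among all multipliers, and linear programming duality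
  (\<open>Gale_alternative\<close>) turns this into the existence of \<open>z\<close>.

  From solutions to subgradients (\<open>recovery\<close>): solving the equations \<open>F\<^sub>i x = f x\<close> is in general
  impossible, since the active gradients may be dependent. Instead one minimizes over \<open>w'\<close> the
  second-order difference quotient of \<^term>\<open>f\<close>, tilted by \<open>u\<close> and regularized by a quadratic term. The
  multipliers bound this function below, the curve \<open>w + t z / 2\<close> bounds its minimum above, and the two
  bounds meet in the limit; so the minimizers converge to \<^term>\<open>w\<close>, and they carry subgradients close
  to \<open>t u\<close>.

  Each of the three conditions says that no solution with \<open>norm w = 1\<close> has \<open>u = 0\<close>. The quotient
  whose lower limit is the modulus, \<open>norm v / (2 sqrt (f x - f xbar))\<close>, tends to
  \<open>norm u / sqrt (2 \<kappa>)\<close> along the sequences above, which is the square root of the objective function.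
  Sequences along which this quotient stays bounded satisfy \<open>v = O(t)\<close> by an approximate convexity
  inequality, and \<open>\<kappa> = 0\<close> would force \<open>u = 0\<close>; so nothing else contributes to the modulus. For
  \<open>\<kappa> > 0\<close> the recovered points have \<open>v = O(t)\<close> while \<open>f x - f xbar\<close> has exact order \<open>t\<^sup>2\<close>, which rules
  out exponents below 1/2.\<close>

section \<open>Finitely generated cones and systems of linear inequalities\<close>

lemma convex_cone_hull_finite_image:
  fixes a :: "'i \<Rightarrow> 'a::real_vector"
  assumes "finite J"
  shows "convex_cone hull (a ` J) = {(\<Sum>i\<in>J. b i *\<^sub>R a i) |b. \<forall>i\<in>J. 0 \<le> b i}" (is "_ = ?C")
proof -
  have "?C = convex_cone hull (a ` J)"
  proof
    show "?C \<subseteq> convex_cone hull (a ` J)"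
    proof clarify
      fix b :: "'i \<Rightarrow> real" assume b: "\<forall>i\<in>J. 0 \<le> b i"
      have "(\<Sum>i\<in>K. b i *\<^sub>R a i) \<in> convex_cone hull (a ` J)" if "K \<subseteq> J" for K
        using finite_subset[OF that assms] that
      proof (induction K rule: finite_induct)
        case empty
        then show ?case by (simp add: convex_cone_hull_contains_0)
      next
        case (insert i K)
        then show ?case
          using b by (auto intro!: convex_cone_hull_add convex_cone_hull_mul intro: hull_inc)
      qed
      then show "(\<Sum>i\<in>J. b i *\<^sub>R a i) \<in> convex_cone hull (a ` J)" by blast
    qed
  next
    have "a ` J \<subseteq> ?C"
    proof clarify
      fix j assume "j \<in> J"
      then have "a j = (\<Sum>i\<in>J. (if i = j then 1 else 0) *\<^sub>R a i)"
        using assms by (simp add: if_distrib[of "\<lambda>c. c *\<^sub>R _"] cong: if_cong)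
      then show "\<exists>b. a j = (\<Sum>i\<in>J. b i *\<^sub>R a i) \<and> (\<forall>i\<in>J. 0 \<le> b i)"
        by (intro exI[of _ "\<lambda>i. if i = j then 1 else 0"]) auto
    qed
    moreover have "convex_cone ?C"
      unfolding convex_cone_iff
    proof (intro conjI ballI allI impI)
      show "0 \<in> ?C" by (auto intro!: exI[of _ "\<lambda>i. 0"])
    next
      fix x y assume "x \<in> ?C" "y \<in> ?C"
      then obtain b c where bc: "x = (\<Sum>i\<in>J. b i *\<^sub>R a i)" "\<forall>i\<in>J. 0 \<le> b i"
        "y = (\<Sum>i\<in>J. c i *\<^sub>R a i)" "\<forall>i\<in>J. 0 \<le> c i" by auto
      then have "x + y = (\<Sum>i\<in>J. (b i + c i) *\<^sub>R a i) \<and> (\<forall>i\<in>J. 0 \<le> b i + c i)"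
        by (simp add: scaleR_left_distrib sum.distrib)
      then show "x + y \<in> ?C" unfolding mem_Collect_eq by (intro exI[of _ "\<lambda>i. b i + c i"])
    next
      fix x c assume "x \<in> ?C" "(0::real) \<le> c"
      then obtain b where b: "x = (\<Sum>i\<in>J. b i *\<^sub>R a i)" "\<forall>i\<in>J. 0 \<le> b i" by auto
      then have "c *\<^sub>R x = (\<Sum>i\<in>J. (c * b i) *\<^sub>R a i) \<and> (\<forall>i\<in>J. 0 \<le> c * b i)"
        using \<open>0 \<le> c\<close> by (simp add: scaleR_sum_right)
      then show "c *\<^sub>R x \<in> ?C" unfolding mem_Collect_eq by (intro exI[of _ "\<lambda>i. c * b i"])
    qed
    ultimately show "convex_cone hull (a ` J) \<subseteq> ?C" by (rule hull_minimal)
  qed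
  then show ?thesis ..
qed

text \<open>Generators may be linearly dependent, so convergence of the combinations does not bound the
  coefficients. Closedness comes from the fact that such a cone is polyhedral.\<close>

lemma closed_nonneg_combinations:
  fixes a :: "'i \<Rightarrow> 'a::euclidean_space"
  assumes "finite J"
  shows "closed {(\<Sum>i\<in>J. b i *\<^sub>R a i) |b. \<forall>i\<in>J. 0 \<le> b i}"
  using assms closed_convex_cone_hull[of "a ` J"] by (simp add: convex_cone_hull_finite_image)

text \<open>The point \<open>(0, -1)\<close> is not in the closed cone generated by the vectors \<open>(a i, d i)\<close>, since the
  coefficients would violate the hypothesis. A functional that separates it from the cone yields a solution
  when normalized by its last component.\<close>

lemma Gale_alternative:
  fixes a :: "'i \<Rightarrow> 'a::euclidean_space" and d :: "'i \<Rightarrow> real"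
  assumes J: "finite J"
    and nonneg: "\<And>y. \<forall>i\<in>J. 0 \<le> y i \<Longrightarrow> (\<Sum>i\<in>J. y i *\<^sub>R a i) = 0 \<Longrightarrow> 0 \<le> (\<Sum>i\<in>J. y i * d i)"
  obtains z where "\<And>i. i \<in> J \<Longrightarrow> a i \<bullet> z \<le> d i"
proof -
  define C where "C = convex_cone hull ((\<lambda>i. (a i, d i)) ` J)"
  have closed: "closed C" unfolding C_def using J by (simp add: closed_convex_cone_hull)
  have "convex C" unfolding C_def by (rule convex_convex_cone_hull)
  have scale: "c *\<^sub>R x \<in> C" if "x \<in> C" "0 \<le> c" for x c
    using that unfolding C_def by (rule convex_cone_hull_mul)
  have gen: "(a j, d j) \<in> C" if "j \<in> J" for j
    using that unfolding C_def by (intro hull_inc) auto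
  have zero: "0 \<in> C" unfolding C_def by (rule convex_cone_hull_contains_0)
  have "(0, -1) \<notin> C"
  proof
    assume "(0, -1) \<in> C"
    then obtain y where y: "(0, -1) = (\<Sum>i\<in>J. y i *\<^sub>R (a i, d i))" "\<forall>i\<in>J. 0 \<le> y i"
      unfolding C_def convex_cone_hull_finite_image[OF J] by blast
    then have "(\<Sum>i\<in>J. y i *\<^sub>R a i) = 0" "(\<Sum>i\<in>J. y i * d i) = -1"
      by (simp_all add: sum_prod)
    then show False using nonneg[OF y(2)] by simp
  qed
  then obtain p q where pq: "p \<bullet> (0, -1::real) < q" "\<forall>x\<in>C. p \<bullet> x > q"
    using separating_hyperplane_closed_point[OF \<open>convex C\<close> closed] by blast
  obtain z0 s where p: "p = (z0::'a, s::real)" by fastforce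
  have "q < 0" using pq(2) zero by fastforce
  then have s: "s > 0" using pq(1) by (simp add: p)
  \<comment> \<open>A linear functional that is bounded below on a cone is nonnegative there.\<close>
  have pos: "0 \<le> p \<bullet> x" if "x \<in> C" for x
  proof (rule ccontr)
    assume neg: "\<not> 0 \<le> p \<bullet> x"
    have "q < p \<bullet> ((q / (p \<bullet> x)) *\<^sub>R x)"
      by (rule pq(2)[rule_format], rule scale) (use that neg \<open>q < 0\<close> in \<open>auto simp: divide_nonpos_neg\<close>)
    then show False using neg by simp
  qed
  have "a i \<bullet> (- (1 / s) *\<^sub>R z0) \<le> d i" if "i \<in> J" for i
  proof -
    have "0 \<le> z0 \<bullet> a i + s * d i" using pos[OF gen[OF that]] by (simp add: p)
    then have "- (z0 \<bullet> a i) \<le> s * d i" by simp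
    then have "- (1 / s) * (z0 \<bullet> a i) \<le> d i" using s by (simp add: field_simps)
    then show ?thesis by (simp add: inner_commute)
  qed
  then show thesis by (rule that)
qed

section \<open>Second-order calculus for functions of class C2\<close>

lemma gradient_eqI:
  assumes "GDERIV f x :> D"
  shows "gradient f x = D"
  unfolding gradient_def
proof (rule the_equality[where P = "\<lambda>D. GDERIV f x :> D", OF assms])
  fix D' assume "GDERIV f x :> D'"
  then have eq: "(\<lambda>h. h \<bullet> D') = (\<lambda>h. h \<bullet> D)"
    using assms unfolding gderiv_def by (rule has_derivative_unique)
  have "h \<bullet> D' = h \<bullet> D" for h
    using fun_cong[OF eq, of h] .
  then show "D' = D" using vector_eq_ldot[of D' D] by blast
qed

lemma has_derivative_gradient:
  fixes f :: "'a::euclidean_space \<Rightarrow> real"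
  assumes "f differentiable (at x)"
  shows "(f has_derivative (\<lambda>h. gradient f x \<bullet> h)) (at x)"
proof -
  obtain D where D: "(f has_derivative D) (at x)"
    using assms by (auto simp: differentiable_def)
  define v where "v = adjoint D 1"
  have "D = (\<lambda>h. h \<bullet> v)"
    unfolding v_def by (rule ext) (simp add: adjoint_works[OF has_derivative_linear[OF D]])
  then have v: "GDERIV f x :> v"
    unfolding gderiv_def using D by simp
  have "gradient f x = v" by (rule gradient_eqI[OF v])
  moreover have "(\<lambda>h. h \<bullet> v) = (\<lambda>h. v \<bullet> h)" by (rule ext) (rule inner_commute)
  ultimately show ?thesis using v unfolding gderiv_def by simp
qed

lemma C2_has_derivative:
  assumes "C2 f"
  shows "(f has_derivative (\<lambda>h. gradient f x \<bullet> h)) (at x within S)"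
  using assms has_derivative_gradient[of f x] unfolding C2_def by (blast intro: has_derivative_at_withinI)

lemma C2_continuous_on: "C2 f \<Longrightarrow> continuous_on S f"
  by (rule has_derivative_continuous_on[of S f "\<lambda>x h. gradient f x \<bullet> h"]) (rule C2_has_derivative)

lemma C2_isCont_gradient: "C2 f \<Longrightarrow> isCont (gradient f) x"
  by (simp add: C2_def differentiable_imp_continuous_within)

lemma gradient_expansion:
  assumes "C2 f" "e > 0"
  obtains d where "d > 0" "\<And>h. norm h < d \<Longrightarrow>
    norm (gradient f (x + h) - gradient f x - hessian f x *v h) \<le> e * norm h"
proof -
  have "(gradient f has_derivative (\<lambda>h. hessian f x *v h)) (at x)"
    using assms(1) jacobian_works[of "gradient f" "at x"] unfolding C2_def hessian_def by simp
  then have "\<exists>d>0. \<forall>y. norm (y - x) < d \<longrightarrow>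
    norm (gradient f y - gradient f x - hessian f x *v (y - x)) \<le> e * norm (y - x)"
    using assms(2) unfolding has_derivative_at_alt by simp
  then obtain d where "d > 0" and d: "\<And>y. norm (y - x) < d \<Longrightarrow>
    norm (gradient f y - gradient f x - hessian f x *v (y - x)) \<le> e * norm (y - x)"
    by auto
  show thesis
    by (rule that[OF \<open>d > 0\<close>]) (use d[of "x + _"] in simp)
qed

lemma has_derivative_along_line:
  assumes "C2 f"
  shows "((\<lambda>s. f (p + s *\<^sub>R h)) has_derivative (\<lambda>t. t * (gradient f (p + s *\<^sub>R h) \<bullet> h))) (at s within S)"
proof -
  have "((\<lambda>s. p + s *\<^sub>R h) has_derivative (\<lambda>t. t *\<^sub>R h)) (at s within S)"
    by (auto intro!: derivative_eq_intros)
  from has_derivative_compose[OF this C2_has_derivative[OF assms]]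
  show ?thesis by simp
qed

text \<open>Subtracting the quadratic model along the segment from \<open>x\<close> leaves a function whose derivative is the
  error in the expansion of the gradient, applied to the direction; the mean value theorem bounds it.\<close>

lemma taylor_second_order:
  assumes "C2 f" "e > 0"
  obtains d where "d > 0" "\<And>h. norm h < d \<Longrightarrow>
    \<bar>f (x + h) - f x - gradient f x \<bullet> h - 1/2 * ((hessian f x *v h) \<bullet> h)\<bar> \<le> e * (norm h)\<^sup>2"
proof -
  obtain d where "d > 0" and d: "\<And>h. norm h < d \<Longrightarrow>
    norm (gradient f (x + h) - gradient f x - hessian f x *v h) \<le> e * norm h"
    using gradient_expansion[OF assms] by blast
  show thesis
  proof (rule that[OF \<open>d > 0\<close>])
    fix h :: "real^'a" assume h: "norm h < d"
    define g where "g = gradient f x \<bullet> h"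
    define q where "q = (hessian f x *v h) \<bullet> h"
    define \<phi> where "\<phi> s = f (x + s *\<^sub>R h) - s * g - s\<^sup>2 / 2 * q" for s
    have der: "(\<phi> has_derivative (\<lambda>t. t * (gradient f (x + s *\<^sub>R h) \<bullet> h) - t * g - t * s * q))
        (at s within {0..1})" for s
      unfolding \<phi>_def
      by (auto intro!: derivative_eq_intros has_derivative_along_line[OF assms(1)]
          simp: power2_eq_square algebra_simps)
    obtain s where s: "0 \<le> s" "s \<le> 1"
      and eq: "\<phi> 1 - \<phi> 0 = gradient f (x + s *\<^sub>R h) \<bullet> h - g - s * q"
      using mvt_very_simple[of 0 1 \<phi>, OF _ der] by force
    have "gradient f (x + s *\<^sub>R h) \<bullet> h - g - s * q
        = (gradient f (x + s *\<^sub>R h) - gradient f x - hessian f x *v (s *\<^sub>R h)) \<bullet> h"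
      by (simp add: g_def q_def inner_diff_left matrix_vector_mult_scaleR)
    also have "\<bar>\<dots>\<bar> \<le> norm (gradient f (x + s *\<^sub>R h) - gradient f x - hessian f x *v (s *\<^sub>R h)) * norm h"
      by (rule Cauchy_Schwarz_ineq2)
    also have "\<dots> \<le> (e * norm (s *\<^sub>R h)) * norm h"
    proof (intro mult_right_mono d)
      have "norm (s *\<^sub>R h) \<le> norm h" using s by (simp add: mult_left_le_one_le)
      then show "norm (s *\<^sub>R h) < d" using h by linarith
    qed simp
    also have "\<dots> \<le> e * (norm h)\<^sup>2"
    proof -
      have "s * (e * (norm h)\<^sup>2) \<le> 1 * (e * (norm h)\<^sup>2)"
        using s assms(2) by (intro mult_right_mono) auto
      then show ?thesis using s by (simp add: power2_eq_square algebra_simps)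
    qed
    finally have "\<bar>\<phi> 1 - \<phi> 0\<bar> \<le> e * (norm h)\<^sup>2" using eq by simp
    then show "\<bar>f (x + h) - f x - gradient f x \<bullet> h - 1/2 * ((hessian f x *v h) \<bullet> h)\<bar> \<le> e * (norm h)\<^sup>2"
      by (simp add: \<phi>_def g_def q_def algebra_simps)
  qed
qed

text \<open>Both sides are the limit of the second difference quotient of \<^term>\<open>f\<close> along \<^term>\<open>h\<close> and
  \<^term>\<open>k\<close>, an expression that is symmetric in \<^term>\<open>h\<close> and \<^term>\<open>k\<close>. The recovery of solutions
  depends on this: there the Hessian acts as the gradient of half the quadratic form.\<close>

lemma hessian_symmetric:
  assumes "C2 f"
  shows "(hessian f x *v h) \<bullet> k = (hessian f x *v k) \<bullet> h"
proof -
  define M where "M = norm h + norm k"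
  have bound: "\<bar>(hessian f x *v h) \<bullet> k - (hessian f x *v k) \<bullet> h\<bar> \<le> e * (4 * M\<^sup>2)" if "e > 0" for e
  proof -
    obtain d where "d > 0" and d: "\<And>h. norm h < d \<Longrightarrow>
      norm (gradient f (x + h) - gradient f x - hessian f x *v h) \<le> e * norm h"
      using gradient_expansion[OF assms \<open>e > 0\<close>] by blast
    define s where "s = d / (M + 1)"
    have "M \<ge> 0" by (simp add: M_def)
    then have s: "s > 0" "s * M < d"
      using \<open>d > 0\<close> by (auto simp: s_def field_simps)
    define \<Delta> where "\<Delta> h k = f (x + s *\<^sub>R h + s *\<^sub>R k) - f (x + s *\<^sub>R h) - f (x + s *\<^sub>R k) + f x" for h k
    \<comment> \<open>The mean value theorem is applied in the direction of \<^term>\<open>h\<close> to the difference in the direction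
      of \<^term>\<open>k\<close>; the roles of the two can then be exchanged.\<close>
    have key: "\<bar>\<Delta> h k - s\<^sup>2 * ((hessian f x *v k) \<bullet> h)\<bar> \<le> 2 * e * s\<^sup>2 * M\<^sup>2"
      if M: "norm h + norm k = M" for h k
    proof -
      define \<phi> where "\<phi> \<tau> = f (x + s *\<^sub>R k + \<tau> *\<^sub>R (s *\<^sub>R h)) - f (x + \<tau> *\<^sub>R (s *\<^sub>R h))" for \<tau>
      have der: "(\<phi> has_derivative (\<lambda>t. t * (gradient f (x + s *\<^sub>R k + \<tau> *\<^sub>R (s *\<^sub>R h)) \<bullet> (s *\<^sub>R h))
          - t * (gradient f (x + \<tau> *\<^sub>R (s *\<^sub>R h)) \<bullet> (s *\<^sub>R h)))) (at \<tau> within {0..1})" for \<tau>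
        unfolding \<phi>_def
        by (intro has_derivative_diff has_derivative_along_line assms)
      obtain \<tau> where \<tau>: "0 \<le> \<tau>" "\<tau> \<le> 1"
        and eq: "\<phi> 1 - \<phi> 0 = gradient f (x + s *\<^sub>R k + \<tau> *\<^sub>R (s *\<^sub>R h)) \<bullet> (s *\<^sub>R h)
          - gradient f (x + \<tau> *\<^sub>R (s *\<^sub>R h)) \<bullet> (s *\<^sub>R h)"
        using mvt_very_simple[of 0 1 \<phi>, OF _ der] by force
      define p where "p = s *\<^sub>R k + \<tau> *\<^sub>R (s *\<^sub>R h)"
      define r where "r = \<tau> *\<^sub>R (s *\<^sub>R h)"
      have \<tau>h: "\<tau> * norm h \<le> norm h" using \<tau> by (simp add: mult_left_le_one_le)
      have r: "norm r \<le> s * M"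
      proof -
        have "norm r = s * (\<tau> * norm h)" using \<tau> s by (simp add: r_def)
        also have "\<dots> \<le> s * M" using s \<tau>h M by (intro mult_left_mono) (auto intro: order_trans)
        finally show ?thesis .
      qed
      have p: "norm p \<le> s * M"
      proof -
        have "norm p \<le> norm (s *\<^sub>R k) + norm (\<tau> *\<^sub>R (s *\<^sub>R h))"
          unfolding p_def by (rule norm_triangle_ineq)
        also have "\<dots> = s * (norm k + \<tau> * norm h)" using \<tau> s by (simp add: algebra_simps)
        also have "\<dots> \<le> s * M" using s \<tau>h M by (intro mult_left_mono) auto
        finally show ?thesis .
      qed
      define P where "P = gradient f (x + p) - gradient f x - hessian f x *v p"
      define R where "R = gradient f (x + r) - gradient f x - hessian f x *v r"
      have P: "norm P \<le> e * (s * M)"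
        using d[of p] p s \<open>e > 0\<close> unfolding P_def
        by (meson less_eq_real_def mult_left_mono order_le_less_trans order_trans)
      have R: "norm R \<le> e * (s * M)"
        using d[of r] r s \<open>e > 0\<close> unfolding R_def
        by (meson less_eq_real_def mult_left_mono order_le_less_trans order_trans)
      have "hessian f x *v p - hessian f x *v r = s *\<^sub>R (hessian f x *v k)"
        by (simp add: p_def r_def matrix_vector_right_distrib matrix_vector_mult_scaleR)
      then have grad: "gradient f (x + p) - gradient f (x + r) = P - R + s *\<^sub>R (hessian f x *v k)"
        by (simp add: P_def R_def algebra_simps)
      have "\<phi> 1 - \<phi> 0 = (gradient f (x + p) - gradient f (x + r)) \<bullet> (s *\<^sub>R h)"
        unfolding eq p_def r_def by (simp add: inner_diff_left add.assoc right_diff_distrib)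
      then have "\<phi> 1 - \<phi> 0 - s\<^sup>2 * ((hessian f x *v k) \<bullet> h) = (P - R) \<bullet> (s *\<^sub>R h)"
        unfolding grad by (simp add: inner_add_left power2_eq_square algebra_simps)
      moreover have "\<phi> 1 - \<phi> 0 = \<Delta> h k"
        by (simp add: \<phi>_def \<Delta>_def add.commute add.left_commute)
      moreover have "\<bar>(P - R) \<bullet> (s *\<^sub>R h)\<bar> \<le> (e * (s * M) + e * (s * M)) * (s * M)"
      proof -
        have "\<bar>(P - R) \<bullet> (s *\<^sub>R h)\<bar> \<le> norm (P - R) * norm (s *\<^sub>R h)" by (rule Cauchy_Schwarz_ineq2)
        also have "\<dots> \<le> (e * (s * M) + e * (s * M)) * (s * M)"
        proof (rule mult_mono)
          show "norm (P - R) \<le> e * (s * M) + e * (s * M)"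
            using norm_triangle_ineq4[of P R] P R by linarith
          have "norm h \<le> M" using M norm_ge_zero[of k] by linarith
          then show "norm (s *\<^sub>R h) \<le> s * M" using s by simp
        qed (use \<open>e > 0\<close> s \<open>M \<ge> 0\<close> in auto)
        finally show ?thesis .
      qed
      ultimately show ?thesis by (simp add: power2_eq_square algebra_simps)
    qed
    have "\<Delta> h k = \<Delta> k h" by (simp add: \<Delta>_def algebra_simps)
    then have "\<bar>s\<^sup>2 * ((hessian f x *v h) \<bullet> k) - s\<^sup>2 * ((hessian f x *v k) \<bullet> h)\<bar> \<le> 4 * e * s\<^sup>2 * M\<^sup>2"
      using key[of h k] key[of k h] by (simp add: M_def add.commute)
    then have "s\<^sup>2 * \<bar>(hessian f x *v h) \<bullet> k - (hessian f x *v k) \<bullet> h\<bar> \<le> s\<^sup>2 * (e * (4 * M\<^sup>2))"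
      by (simp add: abs_mult flip: right_diff_distrib) (simp add: algebra_simps)
    then show ?thesis using s by (simp add: mult_le_cancel_left_pos)
  qed
  have "\<bar>(hessian f x *v h) \<bullet> k - (hessian f x *v k) \<bullet> h\<bar> \<le> 0 + e" if "e > 0" for e
  proof -
    have "e / (4 * M\<^sup>2 + 1) > 0" using that by (simp add: add_nonneg_pos)
    from bound[OF this] have "\<bar>(hessian f x *v h) \<bullet> k - (hessian f x *v k) \<bullet> h\<bar> \<le> e * (4 * M\<^sup>2 / (4 * M\<^sup>2 + 1))"
      by simp
    also have "\<dots> \<le> e * 1"
      using that by (intro mult_left_mono) (auto simp: divide_le_eq add_nonneg_pos)
    finally show ?thesis by simp
  qed
  then have "\<bar>(hessian f x *v h) \<bullet> k - (hessian f x *v k) \<bullet> h\<bar> \<le> 0" by (rule field_le_epsilon)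
  then show ?thesis by simp
qed

section \<open>Scaled steps and difference quotients\<close>

lemma filterlim_direction:
  "((\<lambda>p. snd p) \<longlongrightarrow> w) (at_right 0 \<times>\<^sub>F nhds w)"
  by (rule filterlim_snd)

lemma filterlim_step:
  fixes w :: "'a::real_normed_vector"
  shows "((\<lambda>p. fst p *\<^sub>R snd p) \<longlongrightarrow> 0) (at_right (0::real) \<times>\<^sub>F nhds w)"
proof -
  have "((\<lambda>p. fst p) \<longlongrightarrow> (0::real)) (at_right 0 \<times>\<^sub>F nhds w)"
    by (rule filterlim_compose[OF _ filterlim_fst]) (rule tendsto_ident_at)
  from tendsto_scaleR[OF this filterlim_direction] show ?thesis by simp
qed

lemma eventually_step_pos: "\<forall>\<^sub>F p in at_right (0::real) \<times>\<^sub>F nhds w. 0 < fst p"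
  using filterlim_fst[of "at_right (0::real)" "nhds w"] eventually_at_right_less[of "0::real"]
  unfolding filterlim_iff by blast

lemma eventually_at_right_ball:
  assumes "\<forall>\<^sub>F h in nhds (0::'a::real_normed_vector). P h" and "r > 0"
  shows "\<forall>\<^sub>F t in at_right (0::real). \<forall>v. norm v \<le> r \<longrightarrow> P (t *\<^sub>R v)"
proof -
  obtain d where "d > 0" and d: "\<And>h. norm h < d \<Longrightarrow> P h"
    using assms(1) unfolding eventually_nhds_metric by (auto simp: dist_norm)
  have "\<forall>\<^sub>F t in at_right (0::real). t \<in> {0<..<d / r}"
    using \<open>d > 0\<close> \<open>r > 0\<close> by (intro eventually_at_right_real) simp
  then show ?thesis
  proof eventually_elim
    case (elim t)
    show ?case
    proof (intro allI impI d)
      fix v :: 'a assume "norm v \<le> r"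
      then have "t * norm v \<le> t * r" using elim by (intro mult_left_mono) auto
      also have "\<dots> < d" using elim \<open>r > 0\<close> by (simp add: field_simps)
      finally show "norm (t *\<^sub>R v) < d" using elim by simp
    qed
  qed
qed

text \<open>The estimates of first and second order are both used in the form "remainder over a power of the
  step length"; the directions only have to converge, not to be fixed.\<close>

lemma remainder_quotient_tendsto_0:
  fixes R :: "'a::real_normed_vector \<Rightarrow> 'b::real_normed_vector"
  assumes R: "\<And>e. e > 0 \<Longrightarrow> \<forall>\<^sub>F h in nhds 0. norm (R h) \<le> e * norm h ^ p"
    and T: "T \<longlonglongrightarrow> (0::real)" "\<And>k. T k > 0" and W: "W \<longlonglongrightarrow> w"
  shows "(\<lambda>k. R (T k *\<^sub>R W k) /\<^sub>R T k ^ p) \<longlonglongrightarrow> 0"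
proof (rule tendstoI)
  fix e :: real assume "e > 0"
  define e' where "e' = e / (norm w + 1) ^ p"
  have pos: "(norm w + 1) ^ p > 0" by (simp add: add_nonneg_pos)
  have e': "e' / 2 > 0" using \<open>e > 0\<close> pos by (simp add: e'_def)
  have "(\<lambda>k. T k *\<^sub>R W k) \<longlonglongrightarrow> 0" using tendsto_scaleR[OF T(1) W] by simp
  then have "\<forall>\<^sub>F k in sequentially. norm (R (T k *\<^sub>R W k)) \<le> e' / 2 * norm (T k *\<^sub>R W k) ^ p"
    using R[OF e'] unfolding filterlim_iff by blast
  moreover have "\<forall>\<^sub>F k in sequentially. norm (W k) < norm w + 1"
    using tendsto_norm[OF W] by (intro order_tendstoD) auto
  ultimately show "\<forall>\<^sub>F k in sequentially. dist (R (T k *\<^sub>R W k) /\<^sub>R T k ^ p) 0 < e"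
  proof eventually_elim
    case (elim k)
    have "norm (R (T k *\<^sub>R W k)) \<le> e' / 2 * norm (W k) ^ p * T k ^ p"
      using elim(1) T(2)[of k] by (simp add: power_mult_distrib mult_ac)
    then have "norm (R (T k *\<^sub>R W k)) / T k ^ p \<le> e' / 2 * norm (W k) ^ p"
      using T(2)[of k] by (simp add: divide_le_eq)
    also have "\<dots> \<le> e' / 2 * (norm w + 1) ^ p"
      using e' elim(2) by (intro mult_left_mono power_mono) auto
    also have "\<dots> = e / 2"
    proof -
      have "norm w + 1 \<noteq> 0" using norm_ge_zero[of w] by linarith
      then show ?thesis by (simp add: e'_def)
    qed
    also have "\<dots> < e" using \<open>e > 0\<close> by simp
    finally show ?case using T(2)[of k] by (simp add: divide_inverse mult.commute)
  qed
qed

section \<open>Subgradients of pointwise maxima\<close>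

lemma pmax_ge: "F i x \<le> pmax F x"
  by (simp add: pmax_def)

lemma pmax_le_iff: "pmax F x \<le> c \<longleftrightarrow> (\<forall>i. F i x \<le> c)"
  by (simp add: pmax_def)

lemma pmax_attained: obtains i where "F i x = pmax F x"
proof -
  have "(MAX i. F i x) \<in> range (\<lambda>i. F i x)" by (rule Max_in) auto
  then show thesis using that by (metis imageE pmax_def)
qed

lemma inactive_less: "i \<notin> active F x \<Longrightarrow> F i x < pmax F x"
  using pmax_ge[of F i x] by (simp add: active_def)

lemma continuous_on_pmax:
  fixes F :: "'m::finite \<Rightarrow> 'a::topological_space \<Rightarrow> real"
  assumes "\<And>i. continuous_on S (F i)"
  shows "continuous_on S (pmax F)"
proof -
  have "continuous_on S (\<lambda>x. MAX i\<in>A. F i x)" if "finite A" "A \<noteq> {}" for A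
    using that by (induction A rule: finite_ne_induct) (auto intro!: continuous_on_max assms)
  then show ?thesis by (simp add: pmax_def[abs_def])
qed

text \<open>This turns local minimizers of \<^term>\<open>f\<close> plus a quadratic function into regular subgradients without any
  calculus rule. Regular subgradients ask for an error term at all points, not only at nearby ones; the negative part of
  the difference between the function and its affine model serves as such.\<close>

lemma proximal_imp_regular_subgradient:
  fixes f :: "'a::real_inner \<Rightarrow> real"
  assumes "\<forall>\<^sub>F y in nhds x. f y \<ge> f x + v \<bullet> (y - x) - c * (norm (y - x))\<^sup>2"
  shows "v \<in> regular_subdiff f x"
proof -
  define r where "r y = min 0 (f y - f x - v \<bullet> (y - x))" for y
  have "r \<in> o[at x](\<lambda>y. norm (y - x))"
  proof (rule landau_o.smallI)
    fix e :: real assume "e > 0"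
    have near: "\<forall>\<^sub>F y in at x. norm (y - x) < e / (\<bar>c\<bar> + 1)"
      using \<open>e > 0\<close> by (auto simp: eventually_at dist_norm intro!: exI[of _ "e / (\<bar>c\<bar> + 1)"])
    have "\<forall>\<^sub>F y in at x. f y \<ge> f x + v \<bullet> (y - x) - c * (norm (y - x))\<^sup>2"
      using assms by (simp add: eventually_nhds_conv_at)
    then show "\<forall>\<^sub>F y in at x. norm (r y) \<le> e * norm (norm (y - x))"
      using near
    proof eventually_elim
      case (elim y)
      have "\<bar>r y\<bar> \<le> \<bar>c\<bar> * (norm (y - x))\<^sup>2"
      proof -
        have "c * (norm (y - x))\<^sup>2 \<le> \<bar>c\<bar> * (norm (y - x))\<^sup>2" by (simp add: mult_right_mono)
        then show ?thesis using elim(1) by (auto simp: r_def min_def)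
      qed
      also have "\<dots> \<le> e * norm (y - x)"
      proof -
        have "(\<bar>c\<bar> + 1) * norm (y - x) \<le> e" using elim(2) by (simp add: field_simps)
        then have "\<bar>c\<bar> * norm (y - x) \<le> e" by (simp add: algebra_simps) (smt (verit) norm_ge_zero)
        then have "\<bar>c\<bar> * norm (y - x) * norm (y - x) \<le> e * norm (y - x)"
          by (rule mult_right_mono) simp
        then show ?thesis by (simp add: power2_eq_square mult.assoc)
      qed
      finally show ?case by simp
    qed
  qed
  moreover have "f y \<ge> f x + v \<bullet> (y - x) + r y" for y
    by (simp add: r_def)
  ultimately show ?thesis unfolding regular_subdiff_def by blast
qed

lemma regular_subdiff_subset_subdiff: "regular_subdiff f x \<subseteq> subdiff f x"
proof
  fix v assume "v \<in> regular_subdiff f x"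
  then show "v \<in> subdiff f x"
    unfolding subdiff_def mem_Collect_eq
    by (intro exI[of _ "\<lambda>_. x"] exI[of _ "\<lambda>_. v"]) simp
qed

text \<open>Weights are vectors indexed by the whole finite type with support in \<^term>\<open>J\<close>, so that weights for
  varying active sets live in one compact set.\<close>

definition face_of_simplex :: "'m::finite set \<Rightarrow> (real^'m) set" where
  "face_of_simplex J = {l. (\<forall>i. 0 \<le> l $ i) \<and> (\<forall>i. i \<notin> J \<longrightarrow> l $ i = 0) \<and> (\<Sum>i\<in>UNIV. l $ i) = 1}"

lemma compact_face_of_simplex: "compact (face_of_simplex J)"
proof -
  have "norm l \<le> 1" if "l \<in> face_of_simplex J" for l
    using that norm_le_l1_cart[of l] by (simp add: face_of_simplex_def)
  then have "bounded (face_of_simplex J)" by (auto simp: bounded_iff)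
  moreover have "closed (face_of_simplex J)"
    unfolding face_of_simplex_def
    by (intro closed_Collect_conj closed_Collect_all closed_Collect_imp closed_Collect_le
        closed_Collect_eq continuous_intros open_Collect_const)
  ultimately show ?thesis by (simp add: compact_eq_bounded_closed)
qed

lemma convex_face_of_simplex: "convex (face_of_simplex J)"
  unfolding convex_def face_of_simplex_def
  by (auto simp: sum.distrib simp flip: sum_distrib_left)

lemma axis_in_face_of_simplex: "i \<in> J \<Longrightarrow> axis i 1 \<in> face_of_simplex J"
  by (auto simp: face_of_simplex_def axis_def)

lemma sum_face_of_simplex:
  fixes a :: "'m::finite \<Rightarrow> 'b::real_vector"
  assumes "l \<in> face_of_simplex J"
  shows "(\<Sum>i\<in>UNIV. l $ i *\<^sub>R a i) = (\<Sum>i\<in>J. l $ i *\<^sub>R a i)"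
  using assms by (intro sum.mono_neutral_right) (auto simp: face_of_simplex_def)

lemma pmax_along_ray:
  fixes F :: "'m::finite \<Rightarrow> real^'n \<Rightarrow> real"
  assumes C2: "\<And>i. C2 (F i)" and c: "\<And>i. i \<in> active F x \<Longrightarrow> gradient (F i) x \<bullet> w < c"
  shows "\<forall>\<^sub>F t in at_right 0. pmax F (x + t *\<^sub>R w) \<le> pmax F x + c * t"
proof -
  have "\<forall>\<^sub>F t in at_right 0. F i (x + t *\<^sub>R w) \<le> pmax F x + c * t" for i
  proof (cases "i \<in> active F x")
    case True
    have "((\<lambda>t. F i (x + t *\<^sub>R w)) has_real_derivative gradient (F i) x \<bullet> w) (at 0 within {0<..})"
      using has_derivative_along_line[OF C2[of i], of x w 0 "{0<..}"]
      by (simp add: has_field_derivative_def mult.commute[of _ "gradient (F i) x \<bullet> w"])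
    then have "((\<lambda>t. (F i (x + t *\<^sub>R w) - F i x) / t) \<longlongrightarrow> gradient (F i) x \<bullet> w) (at_right 0)"
      by (simp add: has_field_derivative_iff)
    then have "\<forall>\<^sub>F t in at_right 0. (F i (x + t *\<^sub>R w) - F i x) / t < c"
      using c[OF True] by (rule order_tendstoD)
    moreover have "\<forall>\<^sub>F t in at_right 0. (0::real) < t" by (rule eventually_at_right_less)
    ultimately show ?thesis
      by eventually_elim (use True in \<open>auto simp: active_def field_simps\<close>)
  next
    case False
    have "isCont (F i) x" using C2_continuous_on[OF C2, of UNIV i] by (simp add: continuous_on_eq_continuous_at)
    then have "((\<lambda>t. F i (x + t *\<^sub>R w) - c * t) \<longlongrightarrow> F i (x + 0 *\<^sub>R w) - c * 0) (at_right 0)"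
      by (intro tendsto_intros isCont_tendsto_compose[where g = "F i"]) auto
    then have "\<forall>\<^sub>F t in at_right 0. F i (x + t *\<^sub>R w) - c * t < pmax F x"
      using inactive_less[OF False] by (intro order_tendstoD) auto
    then show ?thesis by eventually_elim simp
  qed
  then have "\<forall>\<^sub>F t in at_right 0. \<forall>i. F i (x + t *\<^sub>R w) \<le> pmax F x + c * t"
    by (rule eventually_all_finite)
  then show ?thesis by (simp add: pmax_le_iff)
qed

text \<open>Otherwise a hyperplane separates \<^term>\<open>v\<close> from the gradients of the active functions, and along its
  normal the maximum grows more slowly than \<^term>\<open>v\<close> allows.\<close>

lemma regular_subdiff_pmax:
  fixes F :: "'m::finite \<Rightarrow> real^'n \<Rightarrow> real"
  assumes C2: "\<And>i. C2 (F i)" and v: "v \<in> regular_subdiff (pmax F) x"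
  obtains l where "l \<in> face_of_simplex (active F x)" "v = (\<Sum>i\<in>UNIV. l $ i *\<^sub>R gradient (F i) x)"
proof -
  define L where "L l = (\<Sum>i\<in>UNIV. l $ i *\<^sub>R gradient (F i) x)" for l :: "real^'m"
  define C where "C = L ` face_of_simplex (active F x)"
  have "linear L"
    unfolding L_def by (rule linearI) (auto simp: scaleR_left_distrib sum.distrib scaleR_sum_right)
  have "convex C" unfolding C_def by (rule convex_linear_image[OF \<open>linear L\<close> convex_face_of_simplex])
  have "compact C" unfolding C_def
    by (intro compact_continuous_image linear_continuous_on compact_face_of_simplex
        linear_conv_bounded_linear[THEN iffD1] \<open>linear L\<close>)
  have "v \<in> C"
  proof (rule ccontr)
    assume "v \<notin> C"
    then obtain p q where p: "p \<bullet> v < q" "\<forall>u\<in>C. p \<bullet> u > q"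
      using separating_hyperplane_closed_point[OF \<open>convex C\<close> compact_imp_closed[OF \<open>compact C\<close>]] by blast
    define w where "w = - p"
    have w: "v \<bullet> w > - q" using p(1) by (simp add: w_def inner_commute)
    have "gradient (F i) x \<bullet> w < - q" if "i \<in> active F x" for i
    proof -
      have "L (axis i 1) = (\<Sum>j\<in>UNIV. (if j = i then gradient (F i) x else 0))"
        unfolding L_def by (rule sum.cong) (auto simp: axis_def)
      then have "gradient (F i) x \<in> C"
        unfolding C_def using axis_in_face_of_simplex[OF that] by (intro image_eqI[of _ _ "axis i 1"]) auto
      then have "q < p \<bullet> gradient (F i) x" using p(2) by blast
      then show ?thesis by (simp add: w_def inner_commute)
    qed
    then have up: "\<forall>\<^sub>F t in at_right 0. pmax F (x + t *\<^sub>R w) \<le> pmax F x + (- q) * t"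
      by (rule pmax_along_ray[OF C2])
    obtain r where r: "r \<in> o[at x](\<lambda>y. norm (y - x))"
      and lo: "\<And>y. pmax F y \<ge> pmax F x + v \<bullet> (y - x) + r y"
      using v unfolding regular_subdiff_def by blast
    have "active F x \<noteq> {}" using pmax_attained[of F x] by (auto simp: active_def)
    then have "w \<noteq> 0" using w \<open>\<And>i. i \<in> active F x \<Longrightarrow> gradient (F i) x \<bullet> w < - q\<close> by fastforce
    define e where "e = (v \<bullet> w + q) / (2 * norm w)"
    have "e > 0" using w \<open>w \<noteq> 0\<close> by (simp add: e_def)
    have "filterlim (\<lambda>t. x + t *\<^sub>R w) (at x) (at_right 0)"
      unfolding filterlim_at
    proof
      show "((\<lambda>t. x + t *\<^sub>R w) \<longlongrightarrow> x) (at_right 0)" by (auto intro!: tendsto_eq_intros)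
      show "\<forall>\<^sub>F t in at_right 0. x + t *\<^sub>R w \<in> UNIV \<and> x + t *\<^sub>R w \<noteq> x"
        using eventually_at_right_less[of "0::real"] by eventually_elim (use \<open>w \<noteq> 0\<close> in auto)
    qed
    then have "\<forall>\<^sub>F t in at_right 0. norm (r (x + t *\<^sub>R w)) \<le> e * norm (norm (x + t *\<^sub>R w - x))"
      using landau_o.smallD[OF r \<open>e > 0\<close>] unfolding filterlim_iff by blast
    with up eventually_at_right_less[of "0::real"]
    have "\<forall>\<^sub>F t::real in at_right 0. False"
    proof eventually_elim
      case (elim t)
      have "r (x + t *\<^sub>R w) \<ge> - (e * norm w) * t" using elim(2,3) by (simp add: abs_le_iff algebra_simps)
      moreover have "e * norm w = (v \<bullet> w + q) / 2" using \<open>w \<noteq> 0\<close> by (simp add: e_def)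
      ultimately have "t * (v \<bullet> w) - (v \<bullet> w + q) / 2 * t \<le> - q * t"
        using elim(1) lo[of "x + t *\<^sub>R w"] by simp
      then have "t * (v \<bullet> w + q) \<le> 0" by (simp add: field_simps)
      then show False using w elim(2) by (simp add: mult_le_0_iff)
    qed
    then show False by simp
  qed
  then show thesis using that by (auto simp: C_def L_def)
qed

text \<open>The weights of regular subgradients at nearby points have a cluster point by compactness, and an index
  that is inactive at \<^term>\<open>x\<close> is inactive nearby, so that its weight vanishes in the limit.\<close>

lemma subdiff_pmax:
  fixes F :: "'m::finite \<Rightarrow> real^'n \<Rightarrow> real"
  assumes C2: "\<And>i. C2 (F i)" and v: "v \<in> subdiff (pmax F) x"
  obtains l where "l \<in> face_of_simplex (active F x)" "v = (\<Sum>i\<in>UNIV. l $ i *\<^sub>R gradient (F i) x)"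
proof -
  obtain X V where X: "X \<longlonglongrightarrow> x" and V: "V \<longlonglongrightarrow> v" and fX: "(\<lambda>k. pmax F (X k)) \<longlonglongrightarrow> pmax F x"
    and reg: "\<And>k. V k \<in> regular_subdiff (pmax F) (X k)"
    using v unfolding subdiff_def by blast
  have "\<exists>l. l \<in> face_of_simplex (active F (X k)) \<and> V k = (\<Sum>i\<in>UNIV. l $ i *\<^sub>R gradient (F i) (X k))" for k
    using regular_subdiff_pmax[OF C2 reg] by metis
  then obtain l where l: "\<And>k. l k \<in> face_of_simplex (active F (X k))"
    and Vl: "\<And>k. V k = (\<Sum>i\<in>UNIV. l k $ i *\<^sub>R gradient (F i) (X k))" by metis
  have "\<forall>k. l k \<in> face_of_simplex UNIV" using l by (auto simp: face_of_simplex_def)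
  then obtain l0 s where l0: "l0 \<in> face_of_simplex UNIV" and s: "strict_mono s"
    and lim: "(l \<circ> s) \<longlonglongrightarrow> l0"
    using compact_face_of_simplex[of UNIV] unfolding compact_def by metis
  have Xs: "(\<lambda>k. X (s k)) \<longlonglongrightarrow> x" using LIMSEQ_subseq_LIMSEQ[OF X s] by (simp add: o_def)
  have ls: "(\<lambda>k. l (s k) $ i) \<longlonglongrightarrow> l0 $ i" for i using tendsto_vec_nth[OF lim] by (simp add: o_def)
  have "(\<lambda>k. V (s k)) \<longlonglongrightarrow> (\<Sum>i\<in>UNIV. l0 $ i *\<^sub>R gradient (F i) x)"
    unfolding Vl
    by (intro tendsto_sum tendsto_scaleR ls isCont_tendsto_compose[OF C2_isCont_gradient[OF C2] Xs])
  moreover have "(\<lambda>k. V (s k)) \<longlonglongrightarrow> v" using LIMSEQ_subseq_LIMSEQ[OF V s] by (simp add: o_def)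
  ultimately have "v = (\<Sum>i\<in>UNIV. l0 $ i *\<^sub>R gradient (F i) x)" by (rule LIMSEQ_unique[rotated])
  moreover have "l0 $ i = 0" if "i \<notin> active F x" for i
  proof -
    have "isCont (F i) x" using C2_continuous_on[OF C2, of UNIV i] by (simp add: continuous_on_eq_continuous_at)
    from isCont_tendsto_compose[OF this Xs]
    have "(\<lambda>k. pmax F (X (s k)) - F i (X (s k))) \<longlonglongrightarrow> pmax F x - F i x"
      using LIMSEQ_subseq_LIMSEQ[OF fX s] by (intro tendsto_diff) (simp_all add: o_def)
    then have "\<forall>\<^sub>F k in sequentially. 0 < pmax F (X (s k)) - F i (X (s k))"
      using inactive_less[OF that] by (intro order_tendstoD) auto
    then have "\<forall>\<^sub>F k in sequentially. l (s k) $ i = 0"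
      by eventually_elim (use l in \<open>auto simp: face_of_simplex_def active_def\<close>)
    then have "(\<lambda>k. l (s k) $ i) \<longlonglongrightarrow> 0" by (simp add: tendsto_eventually)
    then show ?thesis using ls LIMSEQ_unique by blast
  qed
  then have "l0 \<in> face_of_simplex (active F x)" using l0 by (auto simp: face_of_simplex_def)
  ultimately show thesis using that by blast
qed

section \<open>Multipliers and the second subderivative\<close>

lemma le_ereal_sqrt_iff:
  assumes "0 \<le> m" "0 \<le> x"
  shows "ereal m \<le> ereal_sqrt x \<longleftrightarrow> ereal (m\<^sup>2) \<le> x"
proof (cases x)
  case (real r)
  then show ?thesis using assms real_sqrt_le_iff[of "m\<^sup>2" r] by (simp add: ereal_sqrt_def)
qed (use assms in \<open>auto simp: ereal_sqrt_def\<close>)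

locale C2_max =
  fixes F :: "'m::finite \<Rightarrow> real^'n \<Rightarrow> real" and xbar :: "real^'n"
  assumes C2: "C2 (F i)"
begin

abbreviation "f \<equiv> pmax F"
abbreviation "I \<equiv> active F xbar"
abbreviation "g i \<equiv> gradient (F i) xbar"
abbreviation "H i \<equiv> hessian (F i) xbar"

definition multiplier :: "real^'m \<Rightarrow> bool" where
  "multiplier l \<longleftrightarrow> (\<forall>i\<in>I. 0 \<le> l $ i) \<and> (\<Sum>i\<in>I. l $ i) = 1 \<and> (\<Sum>i\<in>I. l $ i *\<^sub>R g i) = 0"

text \<open>The quadratic form of the Hessian of the Lagrangian.\<close>

definition curvature :: "real^'m \<Rightarrow> real^'n \<Rightarrow> real" where
  "curvature l w = (\<Sum>i\<in>I. l $ i * ((H i *v w) \<bullet> w))"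

lemma active_value: "i \<in> I \<Longrightarrow> F i xbar = f xbar"
  by (simp add: active_def)

lemma multiplier_inner: "multiplier l \<Longrightarrow> (\<Sum>i\<in>I. l $ i * (g i \<bullet> w)) = 0"
proof -
  assume "multiplier l"
  then have "(\<Sum>i\<in>I. l $ i *\<^sub>R g i) \<bullet> w = 0" by (simp add: multiplier_def)
  then show ?thesis by (simp add: inner_sum_left)
qed

lemma taylor_eventually:
  assumes "e > 0"
  shows "\<forall>\<^sub>F h in nhds 0. \<forall>i.
    \<bar>F i (xbar + h) - F i xbar - g i \<bullet> h - 1/2 * ((H i *v h) \<bullet> h)\<bar> \<le> e * (norm h)\<^sup>2"
proof (rule eventually_all_finite)
  fix i
  obtain d where "d > 0" "\<And>h. norm h < d \<Longrightarrow>
    \<bar>F i (xbar + h) - F i xbar - g i \<bullet> h - 1/2 * ((H i *v h) \<bullet> h)\<bar> \<le> e * (norm h)\<^sup>2"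
    using taylor_second_order[OF C2 assms] by blast
  then show "\<forall>\<^sub>F h in nhds 0.
    \<bar>F i (xbar + h) - F i xbar - g i \<bullet> h - 1/2 * ((H i *v h) \<bullet> h)\<bar> \<le> e * (norm h)\<^sup>2"
    unfolding eventually_nhds_metric by (intro exI[of _ d]) (auto simp: dist_norm)
qed

lemma gradient_expansion_eventually:
  assumes "e > 0"
  shows "\<forall>\<^sub>F h in nhds 0. \<forall>i. norm (gradient (F i) (xbar + h) - g i - H i *v h) \<le> e * norm h"
proof (rule eventually_all_finite)
  fix i
  obtain d where "d > 0" "\<And>h. norm h < d \<Longrightarrow>
    norm (gradient (F i) (xbar + h) - g i - H i *v h) \<le> e * norm h"
    using gradient_expansion[OF C2 assms] by blast
  then show "\<forall>\<^sub>F h in nhds 0. norm (gradient (F i) (xbar + h) - g i - H i *v h) \<le> e * norm h"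
    unfolding eventually_nhds_metric by (intro exI[of _ d]) (auto simp: dist_norm)
qed

lemma hessian_bound:
  obtains K where "K > 0" "\<And>i h k. \<bar>(H i *v h) \<bullet> k\<bar> \<le> K * norm h * norm k"
proof -
  have "\<exists>K. \<forall>h. norm (H i *v h) \<le> norm h * K" for i
    using bounded_linear.bounded[OF matrix_vector_mul_bounded_linear[of "H i"]] .
  then obtain K where K: "\<And>i h. norm (H i *v h) \<le> norm h * K i" by metis
  define M where "M = (\<Sum>i\<in>UNIV. \<bar>K i\<bar>) + 1"
  have M: "K i \<le> M" for i
  proof -
    have "\<bar>K i\<bar> \<le> (\<Sum>i\<in>UNIV. \<bar>K i\<bar>)" by (rule member_le_sum) auto
    then show ?thesis by (simp add: M_def)
  qed
  have "\<bar>(H i *v h) \<bullet> k\<bar> \<le> M * norm h * norm k" for i h k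
  proof -
    have "\<bar>(H i *v h) \<bullet> k\<bar> \<le> norm (H i *v h) * norm k" by (rule Cauchy_Schwarz_ineq2)
    also have "norm (H i *v h) \<le> M * norm h"
      using K[of i h] mult_left_mono[OF M[of i] norm_ge_zero[of h]] by (simp add: mult.commute)
    finally show ?thesis by (simp add: mult_right_mono)
  qed
  moreover have "M > 0" unfolding M_def by (rule add_nonneg_pos) (auto intro: sum_nonneg)
  ultimately show thesis using that by blast
qed

text \<open>The weighted average of the active functions lies below the maximum, and its first-order part cancels.\<close>

lemma lower_estimate:
  assumes l: "multiplier l" and "e > 0"
  shows "\<forall>\<^sub>F h in nhds 0. f (xbar + h) \<ge> f xbar + curvature l h / 2 - e * (norm h)\<^sup>2"
  using taylor_eventually[OF \<open>e > 0\<close>]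
proof eventually_elim
  case (elim h)
  have "l $ i * (f xbar + g i \<bullet> h + (H i *v h) \<bullet> h / 2 - e * (norm h)\<^sup>2) \<le> l $ i * f (xbar + h)"
    if "i \<in> I" for i
  proof (rule mult_left_mono)
    show "f xbar + g i \<bullet> h + (H i *v h) \<bullet> h / 2 - e * (norm h)\<^sup>2 \<le> f (xbar + h)"
      using spec[OF elim, of i] pmax_ge[of F i "xbar + h"] active_value[OF that] by (simp add: abs_le_iff)
    show "0 \<le> l $ i" using l that by (simp add: multiplier_def)
  qed
  then have "(\<Sum>i\<in>I. l $ i * (f xbar + g i \<bullet> h + (H i *v h) \<bullet> h / 2 - e * (norm h)\<^sup>2))
      \<le> (\<Sum>i\<in>I. l $ i * f (xbar + h))" by (rule sum_mono)
  also have "\<dots> = f (xbar + h)" using l by (simp add: multiplier_def flip: sum_distrib_right)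
  also have "(\<Sum>i\<in>I. l $ i * (f xbar + g i \<bullet> h + (H i *v h) \<bullet> h / 2 - e * (norm h)\<^sup>2))
      = (\<Sum>i\<in>I. l $ i) * (f xbar - e * (norm h)\<^sup>2) + (\<Sum>i\<in>I. l $ i * (g i \<bullet> h)) + curvature l h / 2"
  proof -
    have "l $ i * (f xbar + g i \<bullet> h + (H i *v h) \<bullet> h / 2 - e * (norm h)\<^sup>2)
        = l $ i * (f xbar - e * (norm h)\<^sup>2) + l $ i * (g i \<bullet> h) + l $ i * ((H i *v h) \<bullet> h) / 2" for i
      by (simp add: algebra_simps)
    then show ?thesis
      by (simp only: curvature_def sum.distrib sum_distrib_right sum_divide_distrib)
  qed
  finally show ?case using l multiplier_inner[OF l, of h] by (simp add: multiplier_def)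
qed

lemma first_order_estimate:
  obtains C where "C > 0" "\<forall>\<^sub>F h in nhds 0. \<forall>i. \<bar>F i (xbar + h) - F i xbar - g i \<bullet> h\<bar> \<le> C * (norm h)\<^sup>2"
proof -
  obtain K where K: "K > 0" "\<And>i h k. \<bar>(H i *v h) \<bullet> k\<bar> \<le> K * norm h * norm k"
    using hessian_bound by blast
  have "\<forall>\<^sub>F h in nhds 0. \<forall>i. \<bar>F i (xbar + h) - F i xbar - g i \<bullet> h\<bar> \<le> (K + 1) * (norm h)\<^sup>2"
    using taylor_eventually[OF zero_less_one]
  proof eventually_elim
    case (elim h)
    show ?case
    proof
      fix i
      have "\<bar>(H i *v h) \<bullet> h\<bar> \<le> K * (norm h)\<^sup>2" using K(2)[of i h h] by (simp add: power2_eq_square mult.assoc)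
      moreover have "0 \<le> K * (norm h)\<^sup>2" using K by simp
      ultimately show "\<bar>F i (xbar + h) - F i xbar - g i \<bullet> h\<bar> \<le> (K + 1) * (norm h)\<^sup>2"
        using spec[OF elim, of i] by (simp add: algebra_simps)
    qed
  qed
  then show thesis using that[of "K + 1"] K by simp
qed

lemma tendsto_hessian_form:
  assumes "(u \<longlongrightarrow> a) net" "(v \<longlongrightarrow> b) net"
  shows "((\<lambda>t. (H i *v u t) \<bullet> v t) \<longlongrightarrow> (H i *v a) \<bullet> b) net"
  by (intro tendsto_inner assms bounded_linear.tendsto[OF matrix_vector_mul_bounded_linear])

lemma tendsto_curvature:
  assumes "(u \<longlongrightarrow> a) net"
  shows "((\<lambda>t. curvature l (u t)) \<longlongrightarrow> curvature l a) net"
  unfolding curvature_def by (intro tendsto_sum tendsto_mult tendsto_const tendsto_hessian_form assms)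

lemma curvature_scaleR: "curvature l (c *\<^sub>R w) = c\<^sup>2 * curvature l w"
  by (simp add: curvature_def matrix_vector_mult_scaleR sum_distrib_left power2_eq_square mult_ac)

text \<open>Along the parabola with velocity \<^term>\<open>w\<close> and acceleration \<^term>\<open>z\<close>, every active function grows at second
  order by at most \<^term>\<open>\<kappa>\<close>; this is where the primal part of the system bounds \<^term>\<open>f\<close> above.\<close>

lemma upper_estimate:
  assumes w: "\<And>i. i \<in> I \<Longrightarrow> g i \<bullet> w \<le> 0"
    and z: "\<And>i. i \<in> I \<Longrightarrow> g i \<bullet> z + (H i *v w) \<bullet> w \<le> \<kappa>" and "e > 0"
  shows "\<forall>\<^sub>F t in at_right 0. f (xbar + t *\<^sub>R (w + (t / 2) *\<^sub>R z)) \<le> f xbar + t\<^sup>2 / 2 * (\<kappa> + e)"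
proof -
  define u where "u t = w + (t / 2) *\<^sub>R z" for t
  have u: "(u \<longlongrightarrow> w) (at_right 0)" unfolding u_def by (auto intro!: tendsto_eq_intros)
  have h: "((\<lambda>t. t *\<^sub>R u t) \<longlongrightarrow> 0) (at_right 0)" using tendsto_scaleR[OF _ u, of "\<lambda>t. t" 0] by simp
  \<comment> \<open>The accuracy of the Taylor expansion is chosen so that its error, relative to \<^term>\<open>t\<^sup>2 / 2\<close>, stays below \<^term>\<open>e\<close>
    in the limit.\<close>
  define e' where "e' = e / (2 * ((norm w)\<^sup>2 + 1))"
  have pos: "(norm w)\<^sup>2 + 1 > 0" by (simp add: add_nonneg_pos)
  have e': "e' > 0" using \<open>e > 0\<close> pos by (simp add: e'_def)
  have "e * (norm w)\<^sup>2 < e * ((norm w)\<^sup>2 + 1)" using \<open>e > 0\<close> by simp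
  then have e'w: "2 * e' * (norm w)\<^sup>2 < e" using pos by (simp add: e'_def field_simps)
  have taylor: "\<forall>\<^sub>F t in at_right 0. \<forall>i. \<bar>F i (xbar + t *\<^sub>R u t) - F i xbar - g i \<bullet> (t *\<^sub>R u t)
      - 1/2 * ((H i *v (t *\<^sub>R u t)) \<bullet> (t *\<^sub>R u t))\<bar> \<le> e' * (norm (t *\<^sub>R u t))\<^sup>2"
    using h taylor_eventually[OF e'] unfolding filterlim_iff by blast
  have "\<forall>\<^sub>F t in at_right 0. F i (xbar + t *\<^sub>R u t) \<le> f xbar + t\<^sup>2 / 2 * (\<kappa> + e)" for i
  proof (cases "i \<in> I")
    case True
    have "((\<lambda>t. (H i *v u t) \<bullet> u t + 2 * e' * (norm (u t))\<^sup>2) \<longlongrightarrow> (H i *v w) \<bullet> w + 2 * e' * (norm w)\<^sup>2) (at_right 0)"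
      by (intro tendsto_intros tendsto_hessian_form u)
    then have "\<forall>\<^sub>F t in at_right 0. (H i *v u t) \<bullet> u t + 2 * e' * (norm (u t))\<^sup>2 < (H i *v w) \<bullet> w + e"
      using e'w by (intro order_tendstoD) auto
    with taylor eventually_at_right_less[of "0::real"] show ?thesis
    proof eventually_elim
      case (elim t)
      have "F i (xbar + t *\<^sub>R u t) \<le> f xbar + g i \<bullet> (t *\<^sub>R u t)
          + 1/2 * ((H i *v (t *\<^sub>R u t)) \<bullet> (t *\<^sub>R u t)) + e' * (norm (t *\<^sub>R u t))\<^sup>2"
        using abs_le_D1[OF spec[OF elim(1), of i]] active_value[OF True] by linarith
      also have "\<dots> = f xbar + t * (g i \<bullet> w) + t\<^sup>2 / 2 * (g i \<bullet> z + ((H i *v u t) \<bullet> u t + 2 * e' * (norm (u t))\<^sup>2))"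
      proof -
        have eq1: "g i \<bullet> (t *\<^sub>R u t) = t * (g i \<bullet> w) + t\<^sup>2 / 2 * (g i \<bullet> z)"
          by (simp add: u_def inner_add_right power2_eq_square algebra_simps)
        have eq2: "(H i *v (t *\<^sub>R u t)) \<bullet> (t *\<^sub>R u t) = t\<^sup>2 * ((H i *v u t) \<bullet> u t)"
          by (simp add: matrix_vector_mult_scaleR power2_eq_square)
        have eq3: "(norm (t *\<^sub>R u t))\<^sup>2 = t\<^sup>2 * (norm (u t))\<^sup>2"
          by (simp add: power_mult_distrib)
        show ?thesis unfolding eq1 eq2 eq3 by (simp add: algebra_simps)
      qed
      also have "\<dots> \<le> f xbar + 0 + t\<^sup>2 / 2 * (\<kappa> + e)"
      proof -
        have "t * (g i \<bullet> w) \<le> 0" using w[OF True] elim(2) by (simp add: mult_nonneg_nonpos)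
        moreover have "g i \<bullet> z + ((H i *v u t) \<bullet> u t + 2 * e' * (norm (u t))\<^sup>2) \<le> \<kappa> + e"
          using elim(3) z[OF True] by linarith
        then have "t\<^sup>2 / 2 * (g i \<bullet> z + ((H i *v u t) \<bullet> u t + 2 * e' * (norm (u t))\<^sup>2)) \<le> t\<^sup>2 / 2 * (\<kappa> + e)"
          by (rule mult_left_mono) simp
        ultimately show ?thesis by linarith
      qed
      finally show ?case by simp
    qed
  next
    case False
    have "isCont (F i) xbar" using C2_continuous_on[OF C2, of UNIV i] by (simp add: continuous_on_eq_continuous_at)
    moreover have "((\<lambda>t. xbar + t *\<^sub>R u t) \<longlongrightarrow> xbar) (at_right 0)" using tendsto_add[OF tendsto_const h] by simp
    ultimately have "((\<lambda>t. F i (xbar + t *\<^sub>R u t)) \<longlongrightarrow> F i xbar) (at_right 0)"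
      by (rule isCont_tendsto_compose)
    then have "((\<lambda>t. F i (xbar + t *\<^sub>R u t) - t\<^sup>2 / 2 * (\<kappa> + e)) \<longlongrightarrow> F i xbar - 0\<^sup>2 / 2 * (\<kappa> + e)) (at_right 0)"
      by (intro tendsto_intros) simp_all
    then have "\<forall>\<^sub>F t in at_right 0. F i (xbar + t *\<^sub>R u t) - t\<^sup>2 / 2 * (\<kappa> + e) < f xbar"
      using inactive_less[OF False] by (intro order_tendstoD) auto
    then show ?thesis by eventually_elim simp
  qed
  then have "\<forall>\<^sub>F t in at_right 0. \<forall>i. F i (xbar + t *\<^sub>R u t) \<le> f xbar + t\<^sup>2 / 2 * (\<kappa> + e)"
    by (rule eventually_all_finite)
  then show ?thesis by (simp add: pmax_le_iff u_def)
qed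

lemma second_subderiv_ge_curvature:
  assumes l: "multiplier l"
  shows "ereal (curvature l w) \<le> second_subderiv0 f xbar w"
  unfolding second_subderiv0_def le_Liminf_iff
proof (intro allI impI)
  fix y assume y: "y < ereal (curvature l w)"
  then obtain c where c: "y \<le> ereal c" "c < curvature l w"
    by (metis ereal_dense2 ereal_less_le less_ereal.simps(1) order_less_imp_le)
  define P where "P = (norm w)\<^sup>2 + 1"
  define e where "e = (curvature l w - c) / (2 * P)"
  have pos: "P > 0" by (simp add: P_def add_nonneg_pos)
  have e: "e > 0" using c(2) pos by (simp add: e_def)
  have "2 * e * (norm w)\<^sup>2 < 2 * e * P" using e by (simp add: P_def)
  also have "\<dots> = curvature l w - c" using pos by (simp add: e_def)
  finally have "c < curvature l w - 2 * e * (norm w)\<^sup>2" by simp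
  moreover have "((\<lambda>p. curvature l (snd p) - 2 * e * (norm (snd p))\<^sup>2)
      \<longlongrightarrow> curvature l w - 2 * e * (norm w)\<^sup>2) (at_right (0::real) \<times>\<^sub>F nhds w)"
    by (intro tendsto_intros tendsto_curvature filterlim_direction)
  ultimately have 1: "\<forall>\<^sub>F p in at_right (0::real) \<times>\<^sub>F nhds w. c < curvature l (snd p) - 2 * e * (norm (snd p))\<^sup>2"
    by (rule order_tendstoD(1)[rotated])
  have 2: "\<forall>\<^sub>F p in at_right (0::real) \<times>\<^sub>F nhds w. f (xbar + fst p *\<^sub>R snd p)
      \<ge> f xbar + curvature l (fst p *\<^sub>R snd p) / 2 - e * (norm (fst p *\<^sub>R snd p))\<^sup>2"
    using filterlim_step lower_estimate[OF l e] unfolding filterlim_iff by blast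
  show "\<forall>\<^sub>F p in at_right 0 \<times>\<^sub>F nhds w.
      y < (case p of (t, w') \<Rightarrow> ereal ((f (xbar + t *\<^sub>R w') - f xbar) / (1 / 2 * t\<^sup>2)))"
    using 1 2 eventually_step_pos
  proof eventually_elim
    case (elim p)
    obtain t w' where p: "p = (t, w')" by fastforce
    have t: "t > 0" using elim(3) p by simp
    have "t\<^sup>2 / 2 * (curvature l w' - 2 * e * (norm w')\<^sup>2) \<le> f (xbar + t *\<^sub>R w') - f xbar"
      using elim(2) t by (simp add: p curvature_scaleR power_mult_distrib algebra_simps)
    then have "curvature l w' - 2 * e * (norm w')\<^sup>2 \<le> (f (xbar + t *\<^sub>R w') - f xbar) / (1 / 2 * t\<^sup>2)"
      using t by (simp add: field_simps)
    then have "c < (f (xbar + t *\<^sub>R w') - f xbar) / (1 / 2 * t\<^sup>2)"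
      using elim(1) p by simp
    then show ?case using c(1) p by (simp add: le_less_trans)
  qed
qed

text \<open>The parabola of the upper estimate is admissible in the lower limit that defines the second
  subderivative.\<close>

lemma second_subderiv_le:
  assumes w: "\<And>i. i \<in> I \<Longrightarrow> g i \<bullet> w \<le> 0"
    and z: "\<And>i. i \<in> I \<Longrightarrow> g i \<bullet> z + (H i *v w) \<bullet> w \<le> \<kappa>"
  shows "second_subderiv0 f xbar w \<le> ereal \<kappa>"
proof (rule ccontr)
  assume "\<not> second_subderiv0 f xbar w \<le> ereal \<kappa>"
  then have "ereal \<kappa> < second_subderiv0 f xbar w" by simp
  from ereal_dense2[OF this] obtain y where y: "\<kappa> < y" "ereal y < second_subderiv0 f xbar w"
    by auto
  have *: "\<forall>\<^sub>F p in at_right 0 \<times>\<^sub>F nhds w.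
      ereal y < (case p of (t, w') \<Rightarrow> ereal ((f (xbar + t *\<^sub>R w') - f xbar) / (1 / 2 * t\<^sup>2)))"
    using y(2) le_Liminf_iff[of "second_subderiv0 f xbar w"] unfolding second_subderiv0_def by blast
  have "((\<lambda>t. w + (t / 2) *\<^sub>R z) \<longlongrightarrow> w) (at_right 0)" by (auto intro!: tendsto_eq_intros)
  then have "filterlim (\<lambda>t. (t, w + (t / 2) *\<^sub>R z)) (at_right 0 \<times>\<^sub>F nhds w) (at_right 0)"
    by (intro filterlim_Pair filterlim_ident)
  with * have "\<forall>\<^sub>F t in at_right 0. y < (f (xbar + t *\<^sub>R (w + (t / 2) *\<^sub>R z)) - f xbar) / (1 / 2 * t\<^sup>2)"
    unfolding filterlim_iff by fastforce
  moreover have "\<forall>\<^sub>F t in at_right 0. f (xbar + t *\<^sub>R (w + (t / 2) *\<^sub>R z)) \<le> f xbar + t\<^sup>2 / 2 * (\<kappa> + (y - \<kappa>))"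
    by (rule upper_estimate[OF w z]) (use y in auto)
  ultimately have "\<forall>\<^sub>F t::real in at_right 0. False"
    using eventually_at_right_less[of "0::real"]
    by eventually_elim (auto simp: field_simps)
  then show False by simp
qed

text \<open>Outside the critical cone some active function has positive slope, and the first-order growth dominates
  any multiple of \<open>t\<^sup>2\<close>.\<close>

lemma second_subderiv_outside_crit_cone:
  assumes "w \<notin> crit_cone F xbar"
  shows "second_subderiv0 f xbar w = \<infinity>"
proof -
  obtain i where i: "i \<in> I" "g i \<bullet> w > 0" using assms by (auto simp: crit_cone_def not_le)
  obtain C where C: "C > 0" "\<forall>\<^sub>F h in nhds 0. \<forall>i. \<bar>F i (xbar + h) - F i xbar - g i \<bullet> h\<bar> \<le> C * (norm h)\<^sup>2"
    using first_order_estimate by blast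
  have 1: "\<forall>\<^sub>F p in at_right (0::real) \<times>\<^sub>F nhds w. \<forall>i. \<bar>F i (xbar + fst p *\<^sub>R snd p) - F i xbar - g i \<bullet> (fst p *\<^sub>R snd p)\<bar>
      \<le> C * (norm (fst p *\<^sub>R snd p))\<^sup>2"
    using filterlim_step C(2) unfolding filterlim_iff by blast
  have "ereal c \<le> second_subderiv0 f xbar w" for c
    unfolding second_subderiv0_def
  proof (rule Liminf_bounded)
    have "((\<lambda>p. 2 * (g i \<bullet> snd p) - (\<bar>c\<bar> + 2 * C * (norm (snd p))\<^sup>2) * fst p)
        \<longlongrightarrow> 2 * (g i \<bullet> w) - (\<bar>c\<bar> + 2 * C * (norm w)\<^sup>2) * 0) (at_right (0::real) \<times>\<^sub>F nhds w)"
      by (intro tendsto_intros filterlim_direction filterlim_compose[OF tendsto_ident_at filterlim_fst])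
    then have 2: "\<forall>\<^sub>F p in at_right (0::real) \<times>\<^sub>F nhds w. 0 < 2 * (g i \<bullet> snd p) - (\<bar>c\<bar> + 2 * C * (norm (snd p))\<^sup>2) * fst p"
      by (rule order_tendstoD(1)) (use i(2) in simp)
    show "\<forall>\<^sub>F p in at_right 0 \<times>\<^sub>F nhds w.
      ereal c \<le> (case p of (t, w') \<Rightarrow> ereal ((f (xbar + t *\<^sub>R w') - f xbar) / (1 / 2 * t\<^sup>2)))"
      using 1 2 eventually_step_pos
    proof eventually_elim
      case (elim p)
      obtain t w' where p: "p = (t, w')" by fastforce
      have t: "t > 0" using elim(3) p by simp
      have "f (xbar + t *\<^sub>R w') - f xbar \<ge> t * (g i \<bullet> w') - C * (t\<^sup>2 * (norm w')\<^sup>2)"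
        using spec[OF elim(1), of i] pmax_ge[of F i "xbar + t *\<^sub>R w'"] active_value[OF i(1)] t
        by (simp add: p power_mult_distrib abs_le_iff)
      moreover have "t * (2 * (g i \<bullet> w') - (\<bar>c\<bar> + 2 * C * (norm w')\<^sup>2) * t) > 0"
        using elim(2) t p by simp
      moreover have "c * t\<^sup>2 \<le> \<bar>c\<bar> * t\<^sup>2" by (intro mult_right_mono) auto
      ultimately have "c * t\<^sup>2 \<le> 2 * (f (xbar + t *\<^sub>R w') - f xbar)"
        by (simp add: algebra_simps power2_eq_square)
      then have "c \<le> (f (xbar + t *\<^sub>R w') - f xbar) / (1 / 2 * t\<^sup>2)" using t by (simp add: field_simps)
      then show ?case using p by simp
    qed
  qed
  then show ?thesis by (simp add: ereal_top)
qed

text \<open>Summing the complementarity conditions with weights \<^term>\<open>l\<close> eliminates \<^term>\<open>z\<close>, because the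
  weighted gradients cancel: \<^term>\<open>\<kappa>\<close> is forced to be the curvature of \<^term>\<open>l\<close>, and conversely
  that value makes a sum of nonnegative terms vanish.\<close>

lemma star_system_iff:
  "star_system F xbar \<kappa> l b w z \<longleftrightarrow> multiplier l \<and> w \<in> crit_cone F xbar \<and>
     (\<forall>i\<in>I. b $ i \<ge> 0 \<and> b $ i * (g i \<bullet> w) = 0) \<and>
     \<kappa> = curvature l w \<and> (\<forall>i\<in>I. g i \<bullet> z + (H i *v w) \<bullet> w \<le> \<kappa>)"
proof -
  define s where "s i = \<kappa> - g i \<bullet> z - (H i *v w) \<bullet> w" for i
  have "(\<forall>i\<in>I. l $ i * s i = 0) \<longleftrightarrow> \<kappa> = curvature l w" if l: "multiplier l" and "\<forall>i\<in>I. 0 \<le> s i"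
  proof -
    have "(\<forall>i\<in>I. l $ i * s i = 0) \<longleftrightarrow> (\<Sum>i\<in>I. l $ i * s i) = 0"
      using that by (subst sum_nonneg_eq_0_iff) (auto simp: multiplier_def)
    also have "(\<Sum>i\<in>I. l $ i * s i) = (\<Sum>i\<in>I. l $ i) * \<kappa> - (\<Sum>i\<in>I. l $ i * (g i \<bullet> z)) - curvature l w"
      by (simp add: s_def curvature_def right_diff_distrib sum_subtractf sum_distrib_right)
    also have "\<dots> = \<kappa> - curvature l w" using l multiplier_inner[OF l, of z] by (simp add: multiplier_def)
    finally show ?thesis by auto
  qed
  moreover have "0 \<le> s i \<longleftrightarrow> g i \<bullet> z + (H i *v w) \<bullet> w \<le> \<kappa>" for i
    by (auto simp: s_def)
  ultimately show ?thesis
    unfolding star_system_def crit_cone_def s_def[symmetric] multiplier_def by blast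
qed

text \<open>A multiplier of maximal curvature is an optimal solution of a linear program, and \<^term>\<open>z\<close> is the solution of
  its dual: if there were none, Gale's alternative would provide nonnegative weights that, after
  normalization, form a multiplier of larger curvature.\<close>

lemma ex_dual_solution:
  assumes l: "multiplier l" and max: "\<And>l'. multiplier l' \<Longrightarrow> curvature l' w \<le> curvature l w"
  obtains z where "\<And>i. i \<in> I \<Longrightarrow> g i \<bullet> z + (H i *v w) \<bullet> w \<le> curvature l w"
proof -
  have nonneg: "0 \<le> (\<Sum>i\<in>I. y i * (curvature l w - (H i *v w) \<bullet> w))"
    if y: "\<forall>i\<in>I. 0 \<le> y i" "(\<Sum>i\<in>I. y i *\<^sub>R g i) = 0" for y
  proof (cases "(\<Sum>i\<in>I. y i) = 0")
    case True
    then have "\<forall>i\<in>I. y i = 0" using y(1) by (subst (asm) sum_nonneg_eq_0_iff) auto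
    then show ?thesis by simp
  next
    case False
    define s where "s = (\<Sum>i\<in>I. y i)"
    have s: "s > 0" using False y(1) sum_nonneg[of I y] by (simp add: s_def)
    define l' where "l' = (\<chi> i. y i / s)"
    have "multiplier l'"
      unfolding multiplier_def
    proof (intro conjI)
      show "\<forall>i\<in>I. 0 \<le> l' $ i" using y(1) s by (simp add: l'_def)
      show "(\<Sum>i\<in>I. l' $ i) = 1" using s by (simp add: l'_def s_def flip: sum_divide_distrib)
      have "(\<Sum>i\<in>I. l' $ i *\<^sub>R g i) = (1 / s) *\<^sub>R (\<Sum>i\<in>I. y i *\<^sub>R g i)"
        by (simp add: l'_def scaleR_sum_right)
      then show "(\<Sum>i\<in>I. l' $ i *\<^sub>R g i) = 0" using y(2) by simp
    qed
    then have "s * curvature l' w \<le> s * curvature l w" using max s by simp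
    moreover have "s * curvature l' w = (\<Sum>i\<in>I. y i * ((H i *v w) \<bullet> w))"
      using s by (simp add: curvature_def l'_def sum_distrib_left)
    ultimately show ?thesis
      by (simp add: right_diff_distrib sum_subtractf s_def sum_distrib_right)
  qed
  obtain z where "\<And>i. i \<in> I \<Longrightarrow> g i \<bullet> z \<le> curvature l w - (H i *v w) \<bullet> w"
    using Gale_alternative[of I g "\<lambda>i. curvature l w - (H i *v w) \<bullet> w", OF finite nonneg] by blast
  then show thesis using that[of z] by (simp add: le_diff_eq)
qed

lemma ex_maximal_multiplier:
  assumes "multiplier l0"
  obtains l where "multiplier l" "\<And>l'. multiplier l' \<Longrightarrow> curvature l' w \<le> curvature l w"
proof -
  define \<Lambda> where "\<Lambda> = face_of_simplex I \<inter> {l. (\<Sum>i\<in>UNIV. l $ i *\<^sub>R g i) = 0}"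
  have "compact \<Lambda>"
    unfolding \<Lambda>_def
    by (intro compact_Int_closed compact_face_of_simplex closed_Collect_eq continuous_intros)
  have \<Lambda>: "multiplier l" if "l \<in> \<Lambda>" for l
    using that sum_face_of_simplex[of l I g] sum_face_of_simplex[of l I "\<lambda>_. 1::real"]
    by (auto simp: \<Lambda>_def multiplier_def face_of_simplex_def)
  define trunc where "trunc l = (\<chi> i. if i \<in> I then l $ i else 0)" for l :: "real^'m"
  have sum_trunc: "(\<Sum>i\<in>UNIV. trunc l $ i *\<^sub>R a i) = (\<Sum>i\<in>I. l $ i *\<^sub>R a i)" for l and a :: "'m \<Rightarrow> 'b::real_vector"
    by (intro sum.mono_neutral_cong_right) (auto simp: trunc_def)
  have trunc: "trunc l \<in> \<Lambda> \<and> curvature (trunc l) w = curvature l w" if "multiplier l" for l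
  proof
    show "trunc l \<in> \<Lambda>"
      using that sum_trunc[of l g] sum_trunc[of l "\<lambda>_. 1::real"]
      by (auto simp: \<Lambda>_def multiplier_def face_of_simplex_def trunc_def)
    show "curvature (trunc l) w = curvature l w" by (simp add: curvature_def trunc_def)
  qed
  have "continuous_on \<Lambda> (\<lambda>l. curvature l w)" unfolding curvature_def by (intro continuous_intros)
  moreover have "\<Lambda> \<noteq> {}" using trunc[OF assms] by blast
  ultimately obtain l where "l \<in> \<Lambda>" "\<And>l'. l' \<in> \<Lambda> \<Longrightarrow> curvature l' w \<le> curvature l w"
    using continuous_attains_sup[OF \<open>compact \<Lambda>\<close>] by metis
  then show thesis using that[of l] \<Lambda> trunc by metis
qed

section \<open>Blow-up of subgradient sequences\<close>

lemma gradient_quotient: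
  assumes T: "T \<longlonglongrightarrow> (0::real)" "\<And>k. T k > 0" and W: "W \<longlonglongrightarrow> w"
  shows "(\<lambda>k. (gradient (F i) (xbar + T k *\<^sub>R W k) - g i) /\<^sub>R T k) \<longlonglongrightarrow> H i *v w"
proof -
  define R where "R h = gradient (F i) (xbar + h) - g i - H i *v h" for h
  have "\<forall>\<^sub>F h in nhds 0. norm (R h) \<le> e * norm h ^ 1" if "e > 0" for e
    using gradient_expansion_eventually[OF that] by eventually_elim (simp add: R_def)
  from remainder_quotient_tendsto_0[OF this T W]
  have "(\<lambda>k. R (T k *\<^sub>R W k) /\<^sub>R T k ^ 1 + H i *v W k) \<longlonglongrightarrow> 0 + H i *v w"
    by (intro tendsto_add bounded_linear.tendsto[OF matrix_vector_mul_bounded_linear] W)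
  moreover have "R (T k *\<^sub>R W k) /\<^sub>R T k ^ 1 + H i *v W k = (gradient (F i) (xbar + T k *\<^sub>R W k) - g i) /\<^sub>R T k" for k
    using T(2)[of k] by (simp add: R_def matrix_vector_mult_scaleR scaleR_diff_right)
  ultimately show ?thesis by simp
qed

lemma second_order_quotient:
  assumes T: "T \<longlonglongrightarrow> (0::real)" "\<And>k. T k > 0" and W: "W \<longlonglongrightarrow> w"
  shows "(\<lambda>k. 2 * (F i (xbar + T k *\<^sub>R W k) - F i xbar - T k * (g i \<bullet> W k)) / (T k)\<^sup>2) \<longlonglongrightarrow> (H i *v w) \<bullet> w"
proof -
  define R where "R h = F i (xbar + h) - F i xbar - g i \<bullet> h - 1/2 * ((H i *v h) \<bullet> h)" for h
  have "\<forall>\<^sub>F h in nhds 0. norm (R h) \<le> e * norm h ^ 2" if "e > 0" for e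
    using taylor_eventually[OF that] by eventually_elim (simp add: R_def)
  from remainder_quotient_tendsto_0[OF this T W]
  have "(\<lambda>k. 2 * (R (T k *\<^sub>R W k) /\<^sub>R (T k)\<^sup>2) + (H i *v W k) \<bullet> W k) \<longlonglongrightarrow> 2 * 0 + (H i *v w) \<bullet> w"
    by (intro tendsto_add tendsto_mult tendsto_const tendsto_hessian_form W)
  moreover have "2 * (R (T k *\<^sub>R W k) /\<^sub>R (T k)\<^sup>2) + (H i *v W k) \<bullet> W k
      = 2 * (F i (xbar + T k *\<^sub>R W k) - F i xbar - T k * (g i \<bullet> W k)) / (T k)\<^sup>2" for k
    using T(2)[of k] by (simp add: R_def matrix_vector_mult_scaleR field_simps power2_eq_square)
  ultimately show ?thesis by simp
qed

lemma first_order_quotient: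
  assumes T: "T \<longlonglongrightarrow> (0::real)" "\<And>k. T k > 0" and W: "W \<longlonglongrightarrow> w"
  shows "(\<lambda>k. (F i (xbar + T k *\<^sub>R W k) - F i xbar) / T k) \<longlonglongrightarrow> g i \<bullet> w"
proof -
  have "(\<lambda>k. T k / 2 * (2 * (F i (xbar + T k *\<^sub>R W k) - F i xbar - T k * (g i \<bullet> W k)) / (T k)\<^sup>2) + g i \<bullet> W k)
      \<longlonglongrightarrow> 0 / 2 * ((H i *v w) \<bullet> w) + g i \<bullet> w"
    by (intro tendsto_add tendsto_mult tendsto_divide tendsto_inner tendsto_const
        second_order_quotient T W) simp
  moreover have "T k / 2 * (2 * (F i (xbar + T k *\<^sub>R W k) - F i xbar - T k * (g i \<bullet> W k)) / (T k)\<^sup>2) + g i \<bullet> W k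
      = (F i (xbar + T k *\<^sub>R W k) - F i xbar) / T k" for k
    using T(2)[of k] by (simp add: field_simps power2_eq_square)
  ultimately show ?thesis by simp
qed

lemma face_is_multiplier:
  assumes "l \<in> face_of_simplex I" "(\<Sum>i\<in>UNIV. l $ i *\<^sub>R g i) = 0"
  shows "multiplier l"
  using assms sum_face_of_simplex[of l I g] sum_face_of_simplex[of l I "\<lambda>_. 1::real"]
  by (simp add: multiplier_def face_of_simplex_def)

text \<open>Compactness provides limits of the directions, the weights and the scaled subgradients, and one
  active set \<open>J\<close> occurs infinitely often. The system then holds for the limits: complementarity of \<open>b\<close>
  and \<^term>\<open>w\<close> because \<open>b\<close> is supported in \<open>J\<close>, where all slopes vanish; optimality of \<^term>\<open>l\<close> because the
  weights with support in \<open>J\<close> reproduce the values of \<^term>\<open>f\<close> exactly, whereas an arbitrary multiplier only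
  gives a lower bound.\<close>

lemma blow_up:
  assumes X: "X \<longlonglongrightarrow> xbar" "\<And>k. X k \<noteq> xbar"
    and V: "\<And>k. V k \<in> subdiff f (X k)"
    and bound: "\<And>k. norm (V k) \<le> B * norm (X k - xbar)"
  obtains s \<kappa> l b w z where "strict_mono s" "star_system F xbar \<kappa> l b w z" "norm w = 1"
    "(\<lambda>k. V (s k) /\<^sub>R norm (X (s k) - xbar)) \<longlonglongrightarrow> combined_grad F xbar l b w"
    "(\<lambda>k. 2 * (f (X (s k)) - f xbar) / (norm (X (s k) - xbar))\<^sup>2) \<longlonglongrightarrow> \<kappa>"
proof -
  define t where "t k = norm (X k - xbar)" for k
  define W0 where "W0 k = (X k - xbar) /\<^sub>R t k" for k
  define U0 where "U0 k = V k /\<^sub>R t k" for k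
  have t: "t k > 0" for k using X(2)[of k] by (simp add: t_def)
  have XW: "X k = xbar + t k *\<^sub>R W0 k" for k using t[of k] by (simp add: W0_def)
  have VU: "V k = t k *\<^sub>R U0 k" for k using t[of k] by (simp add: U0_def)
  have "\<exists>l. l \<in> face_of_simplex (active F (X k)) \<and> V k = (\<Sum>i\<in>UNIV. l $ i *\<^sub>R gradient (F i) (X k))" for k
    using subdiff_pmax[OF C2 V] by metis
  then obtain L0 where L0: "\<And>k. L0 k \<in> face_of_simplex (active F (X k))"
    and VL: "\<And>k. V k = (\<Sum>i\<in>UNIV. L0 k $ i *\<^sub>R gradient (F i) (X k))" by metis
  have comp: "compact (sphere (0::real^'n) 1 \<times> (face_of_simplex (UNIV::'m set) \<times> cball (0::real^'n) B))"
    by (intro compact_Times compact_sphere compact_face_of_simplex compact_cball)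
  have inC: "(W0 k, L0 k, U0 k) \<in> sphere 0 1 \<times> face_of_simplex UNIV \<times> cball 0 B" for k
  proof -
    have "norm (W0 k) = 1" using t[of k] by (simp add: W0_def t_def)
    moreover have "L0 k \<in> face_of_simplex UNIV" using L0[of k] by (auto simp: face_of_simplex_def)
    moreover have "norm (U0 k) \<le> B" using bound[of k] t[of k] by (simp add: U0_def t_def field_simps)
    ultimately show ?thesis by simp
  qed
  obtain p s1 where p: "p \<in> sphere (0::real^'n) 1 \<times> (face_of_simplex (UNIV::'m set) \<times> cball (0::real^'n) B)"
    and s1: "strict_mono s1" and lim1: "((\<lambda>k. (W0 k, L0 k, U0 k)) \<circ> s1) \<longlonglongrightarrow> p"
    using comp inC unfolding compact_def by (metis (no_types, lifting))
  obtain w l u where pwlu: "p = (w, l, u)" by (cases p) auto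
  have w: "norm w = 1" and lU: "l \<in> face_of_simplex UNIV" using p by (auto simp: pwlu)
  have "\<exists>J. infinite {k \<in> UNIV. active F (X (s1 k)) = J}"
    using pigeonhole_infinite[of "UNIV :: nat set" "\<lambda>k. active F (X (s1 k))"] by fastforce
  then obtain J where J: "infinite {k. active F (X (s1 k)) = J}" by auto
  define s where "s = s1 \<circ> enumerate {k. active F (X (s1 k)) = J}"
  have s2: "strict_mono (enumerate {k. active F (X (s1 k)) = J})"
    using J by (rule strict_mono_enumerate)
  have s: "strict_mono s" unfolding s_def using s1 s2 by (rule strict_mono_o)
  have act: "active F (X (s k)) = J" for k
    using enumerate_in_set[OF J, of k] by (simp add: s_def)
  define T where "T = t \<circ> s"
  define W where "W = W0 \<circ> s"
  define L where "L = L0 \<circ> s"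
  define U where "U = U0 \<circ> s"
  have lim2: "(\<lambda>k. (W k, L k, U k)) \<longlonglongrightarrow> (w, l, u)"
    using LIMSEQ_subseq_LIMSEQ[OF lim1 s2] by (simp add: W_def L_def U_def s_def o_def pwlu)
  have Wlim: "W \<longlonglongrightarrow> w" using tendsto_fst[OF lim2] by simp
  have Llim: "L \<longlonglongrightarrow> l" using tendsto_fst[OF tendsto_snd[OF lim2]] by simp
  have Ulim: "U \<longlonglongrightarrow> u" using tendsto_snd[OF tendsto_snd[OF lim2]] by simp
  have Xs: "(\<lambda>k. X (s k)) \<longlonglongrightarrow> xbar" using LIMSEQ_subseq_LIMSEQ[OF X(1) s] by (simp add: o_def)
  have Tlim: "T \<longlonglongrightarrow> 0"
    using tendsto_norm[OF tendsto_diff[OF Xs tendsto_const[of xbar]]] by (simp add: T_def t_def o_def)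
  have T: "T k > 0" for k using t by (simp add: T_def)
  have XTW: "X (s k) = xbar + T k *\<^sub>R W k" for k using XW by (simp add: T_def W_def)
  have Llim_i: "(\<lambda>k. L k $ i) \<longlonglongrightarrow> l $ i" for i by (rule tendsto_vec_nth[OF Llim])
  have LJ: "L k \<in> face_of_simplex J" for k using L0[of "s k"] act[of k] by (simp add: L_def)
  have cont: "(\<lambda>k. F i (X (s k))) \<longlonglongrightarrow> F i xbar" for i
    using C2_continuous_on[OF C2, of UNIV i] by (intro isCont_tendsto_compose[OF _ Xs]) (simp add: continuous_on_eq_continuous_at)
  have contf: "(\<lambda>k. f (X (s k))) \<longlonglongrightarrow> f xbar"
    using continuous_on_pmax[of UNIV F, OF C2_continuous_on[OF C2]]
    by (intro isCont_tendsto_compose[OF _ Xs]) (simp add: continuous_on_eq_continuous_at)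
  have FJ: "F i (X (s k)) = f (X (s k))" if "i \<in> J" for i k
    using that act[of k] by (auto simp: active_def)
  have JI: "J \<subseteq> I"
  proof
    fix i assume "i \<in> J"
    then have "F i xbar = f xbar" using cont[of i] contf by (simp add: FJ LIMSEQ_unique)
    then show "i \<in> I" by (simp add: active_def)
  qed
  have l0: "l $ i = 0" if "i \<notin> J" for i
  proof -
    have "(\<lambda>k. L k $ i) = (\<lambda>k. 0)" using LJ that by (auto simp: face_of_simplex_def)
    then show ?thesis using Llim_i[of i] by (simp add: LIMSEQ_const_iff)
  qed
  have lJ: "l \<in> face_of_simplex J" using lU l0 by (auto simp: face_of_simplex_def)
  then have lI: "l \<in> face_of_simplex I" using JI by (auto simp: face_of_simplex_def)
  have mult: "multiplier l"
  proof (rule face_is_multiplier[OF lI])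
    have "(\<lambda>k. V (s k)) \<longlonglongrightarrow> (\<Sum>i\<in>UNIV. l $ i *\<^sub>R g i)"
      unfolding VL using Llim_i
      by (intro tendsto_sum tendsto_scaleR isCont_tendsto_compose[OF C2_isCont_gradient[OF C2] Xs])
        (simp add: L_def)
    moreover have "(\<lambda>k. V (s k)) \<longlonglongrightarrow> 0"
      using tendsto_scaleR[OF Tlim Ulim] by (simp add: VU T_def U_def)
    ultimately show "(\<Sum>i\<in>UNIV. l $ i *\<^sub>R g i) = 0" by (rule LIMSEQ_unique)
  qed
  have sumJ: "(\<Sum>i\<in>J. l $ i) = 1" using lJ sum_face_of_simplex[OF lJ, of "\<lambda>_. 1::real"]
    by (simp add: face_of_simplex_def)
  have sumI: "(\<Sum>i\<in>I. l $ i *\<^sub>R a i) = (\<Sum>i\<in>J. l $ i *\<^sub>R a i)" for a :: "'m \<Rightarrow> real^'n"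
    using sum_face_of_simplex[OF lJ, of a] sum_face_of_simplex[OF lI, of a] by simp
  have sumIr: "(\<Sum>i\<in>I. l $ i * a i) = (\<Sum>i\<in>J. l $ i * a i)" for a :: "'m \<Rightarrow> real"
    using sum_face_of_simplex[OF lJ, of a] sum_face_of_simplex[OF lI, of a] by simp
  \<comment> \<open>What remains of the scaled subgradients after removing the second-order part is a combination of
    gradients at \<^term>\<open>xbar\<close> with the nonnegative, possibly unbounded, coefficients \<open>L k $ i / T k\<close>.\<close>
  define C where "C = {(\<Sum>i\<in>J. c i *\<^sub>R g i) |c. \<forall>i\<in>J. 0 \<le> c i}"
  have "closed C" unfolding C_def by (rule closed_nonneg_combinations) simp
  moreover have "U k - (\<Sum>i\<in>J. L k $ i *\<^sub>R ((gradient (F i) (xbar + T k *\<^sub>R W k) - g i) /\<^sub>R T k)) \<in> C" for k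
  proof -
    have "U k = (\<Sum>i\<in>J. L k $ i *\<^sub>R gradient (F i) (X (s k))) /\<^sub>R T k"
      using VL[of "s k"] sum_face_of_simplex[OF LJ[of k], of "\<lambda>i. gradient (F i) (X (s k))"]
      by (simp add: U_def U0_def T_def L_def)
    then have "U k - (\<Sum>i\<in>J. L k $ i *\<^sub>R ((gradient (F i) (xbar + T k *\<^sub>R W k) - g i) /\<^sub>R T k))
        = (\<Sum>i\<in>J. (L k $ i / T k) *\<^sub>R g i)"
      by (simp add: XTW scaleR_sum_right scaleR_diff_right sum_subtractf divide_inverse mult.commute)
    moreover have "\<forall>i\<in>J. 0 \<le> L k $ i / T k" using LJ[of k] T[of k] by (simp add: face_of_simplex_def)
    ultimately show ?thesis unfolding C_def by (intro CollectI exI[of _ "\<lambda>i. L k $ i / T k"]) simp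
  qed
  moreover have "(\<lambda>k. U k - (\<Sum>i\<in>J. L k $ i *\<^sub>R ((gradient (F i) (xbar + T k *\<^sub>R W k) - g i) /\<^sub>R T k)))
      \<longlonglongrightarrow> u - (\<Sum>i\<in>J. l $ i *\<^sub>R (H i *v w))"
    by (intro tendsto_diff Ulim tendsto_sum tendsto_scaleR Llim_i gradient_quotient Tlim T Wlim)
  ultimately have "u - (\<Sum>i\<in>J. l $ i *\<^sub>R (H i *v w)) \<in> C" by (rule closed_sequentially)
  then obtain c where c: "u - (\<Sum>i\<in>J. l $ i *\<^sub>R (H i *v w)) = (\<Sum>i\<in>J. c i *\<^sub>R g i)" "\<forall>i\<in>J. 0 \<le> c i"
    by (auto simp: C_def)
  define b where "b = (\<chi> i. if i \<in> J then c i else 0)"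
  have "(\<Sum>i\<in>I. b $ i *\<^sub>R g i) = (\<Sum>i\<in>J. c i *\<^sub>R g i)"
    using JI by (intro sum.mono_neutral_cong_right) (auto simp: b_def)
  then have u: "combined_grad F xbar l b w = u"
    using c(1) sumI[of "\<lambda>i. H i *v w"] by (simp add: combined_grad_def sum.distrib algebra_simps)
  \<comment> \<open>The indices in \<^term>\<open>J\<close> attain the maximum along the sequence, so their slopes are maximal and hence equal;
    the common value is their average with weights \<^term>\<open>l\<close>, which is 0.\<close>
  have slope: "g i \<bullet> w \<le> g j \<bullet> w" if "i \<in> I" "j \<in> J" for i j
  proof (rule LIMSEQ_le[OF first_order_quotient[OF Tlim T Wlim] first_order_quotient[OF Tlim T Wlim]])
    have "j \<in> I" using that JI by blast
    have "(F i (xbar + T k *\<^sub>R W k) - F i xbar) / T k \<le> (F j (xbar + T k *\<^sub>R W k) - F j xbar) / T k" for k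
      using FJ[OF that(2), of k] pmax_ge[of F i "X (s k)"] active_value[OF that(1)] active_value[OF \<open>j \<in> I\<close>] T[of k]
      by (simp add: XTW divide_right_mono)
    then show "\<exists>N. \<forall>k\<ge>N. (F i (xbar + T k *\<^sub>R W k) - F i xbar) / T k \<le> (F j (xbar + T k *\<^sub>R W k) - F j xbar) / T k"
      by blast
  qed
  have "J \<noteq> {}" using sumJ by auto
  then obtain j0 where j0: "j0 \<in> J" by blast
  have same: "g j \<bullet> w = g j0 \<bullet> w" if "j \<in> J" for j
    using slope[of j j0] slope[of j0 j] that j0 JI by (meson antisym subsetD)
  have "0 = (\<Sum>i\<in>J. l $ i * (g i \<bullet> w))" using multiplier_inner[OF mult, of w] sumIr by simp
  also have "\<dots> = (\<Sum>i\<in>J. l $ i) * (g j0 \<bullet> w)" by (simp add: same sum_distrib_right)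
  finally have "g j0 \<bullet> w = 0" using sumJ by simp
  then have gJ: "g j \<bullet> w = 0" if "j \<in> J" for j using same that by simp
  have crit: "w \<in> crit_cone F xbar" unfolding crit_cone_def using slope[OF _ j0] gJ[OF j0] by simp
  \<comment> \<open>Averaging with a multiplier removes the terms of first order, which are unbounded relative to
    \<^term>\<open>(T k)\<^sup>2\<close>.\<close>
  define R where "R i k = 2 * (F i (xbar + T k *\<^sub>R W k) - F i xbar - T k * (g i \<bullet> W k)) / (T k)\<^sup>2" for i k
  define K where "K k = 2 * (f (X (s k)) - f xbar) / (T k)\<^sup>2" for k
  have Rlim: "(\<lambda>k. R i k) \<longlonglongrightarrow> (H i *v w) \<bullet> w" for i
    unfolding R_def by (rule second_order_quotient[OF Tlim T Wlim])
  have Rsum: "(\<Sum>i\<in>I. l' $ i * R i k) = 2 * ((\<Sum>i\<in>I. l' $ i * F i (X (s k))) - f xbar) / (T k)\<^sup>2"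
    if l': "multiplier l'" for l' k
  proof -
    have "(\<Sum>i\<in>I. l' $ i * R i k) = (\<Sum>i\<in>I. 2 / (T k)\<^sup>2 * (l' $ i * F i (X (s k)) - l' $ i * f xbar - T k * (l' $ i * (g i \<bullet> W k))))"
      by (rule sum.cong) (auto simp: R_def XTW active_value algebra_simps diff_divide_distrib add_divide_distrib)
    also have "\<dots> = 2 / (T k)\<^sup>2 * ((\<Sum>i\<in>I. l' $ i * F i (X (s k))) - (\<Sum>i\<in>I. l' $ i) * f xbar - T k * (\<Sum>i\<in>I. l' $ i * (g i \<bullet> W k)))"
      by (simp only: sum_distrib_left[symmetric] sum_subtractf sum_distrib_right)
    finally show ?thesis using l' multiplier_inner[OF l', of "W k"] by (simp add: multiplier_def)
  qed
  have KR: "K k = (\<Sum>i\<in>I. l $ i * R i k)" for k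
  proof -
    have "(\<Sum>i\<in>I. l $ i * F i (X (s k))) = (\<Sum>i\<in>J. l $ i) * f (X (s k))"
      by (simp add: sumIr FJ sum_distrib_right)
    then show ?thesis using Rsum[OF mult, of k] sumJ by (simp add: K_def)
  qed
  have Klim: "K \<longlonglongrightarrow> curvature l w"
    unfolding curvature_def KR by (intro tendsto_sum tendsto_mult tendsto_const Rlim)
  have "curvature l' w \<le> curvature l w" if l': "multiplier l'" for l'
  proof (rule LIMSEQ_le[OF _ Klim])
    show "(\<lambda>k. \<Sum>i\<in>I. l' $ i * R i k) \<longlonglongrightarrow> curvature l' w"
      unfolding curvature_def by (intro tendsto_sum tendsto_mult tendsto_const Rlim)
    have "(\<Sum>i\<in>I. l' $ i * R i k) \<le> K k" for k
    proof -
      have "(\<Sum>i\<in>I. l' $ i * F i (X (s k))) \<le> (\<Sum>i\<in>I. l' $ i * f (X (s k)))"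
        using l' by (intro sum_mono mult_left_mono pmax_ge) (auto simp: multiplier_def)
      also have "\<dots> = f (X (s k))" using l' by (simp add: multiplier_def flip: sum_distrib_right)
      finally show ?thesis unfolding Rsum[OF l'] K_def by (intro divide_right_mono) auto
    qed
    then show "\<exists>N. \<forall>k\<ge>N. (\<Sum>i\<in>I. l' $ i * R i k) \<le> K k" by blast
  qed
  from ex_dual_solution[OF mult this] obtain z
    where z: "\<And>i. i \<in> I \<Longrightarrow> g i \<bullet> z + (H i *v w) \<bullet> w \<le> curvature l w" by blast
  have "star_system F xbar (curvature l w) l b w z"
    unfolding star_system_iff using mult crit z c(2) gJ by (auto simp: b_def)
  moreover have "(\<lambda>k. V (s k) /\<^sub>R norm (X (s k) - xbar)) \<longlonglongrightarrow> combined_grad F xbar l b w"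
    using Ulim by (simp add: u U_def U0_def t_def o_def)
  moreover have "(\<lambda>k. 2 * (f (X (s k)) - f xbar) / (norm (X (s k) - xbar))\<^sup>2) \<longlonglongrightarrow> curvature l w"
    using Klim by (simp add: K_def[abs_def] T_def t_def)
  ultimately show thesis using that[OF s _ w] by blast
qed

section \<open>Recovery of solutions of the system by nearby subgradients\<close>

lemma curvature_add:
  "curvature l (w + d) = curvature l w + 2 * ((\<Sum>i\<in>I. l $ i *\<^sub>R (H i *v w)) \<bullet> d) + curvature l d"
proof -
  have "(H i *v (w + d)) \<bullet> (w + d) = (H i *v w) \<bullet> w + 2 * ((H i *v w) \<bullet> d) + (H i *v d) \<bullet> d" for i
    using hessian_symmetric[OF C2[of i], of xbar w d]
    by (simp add: matrix_vector_right_distrib inner_add_left inner_add_right)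
  then show ?thesis
    by (simp add: curvature_def inner_sum_left distrib_left sum.distrib sum_distrib_left mult_ac)
qed

lemma curvature_bound:
  obtains K where "K > 0" "\<And>l w. multiplier l \<Longrightarrow> \<bar>curvature l w\<bar> \<le> K * (norm w)\<^sup>2"
proof -
  obtain K where K: "K > 0" "\<And>i h k. \<bar>(H i *v h) \<bullet> k\<bar> \<le> K * norm h * norm k"
    using hessian_bound by blast
  have "\<bar>curvature l w\<bar> \<le> K * (norm w)\<^sup>2" if l: "multiplier l" for l w
  proof -
    have "\<bar>curvature l w\<bar> \<le> (\<Sum>i\<in>I. \<bar>l $ i * ((H i *v w) \<bullet> w)\<bar>)"
      unfolding curvature_def by (rule sum_abs)
    also have "\<dots> \<le> (\<Sum>i\<in>I. l $ i * (K * (norm w)\<^sup>2))"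
    proof (rule sum_mono)
      fix i assume "i \<in> I"
      then have "0 \<le> l $ i" using l by (simp add: multiplier_def)
      then show "\<bar>l $ i * ((H i *v w) \<bullet> w)\<bar> \<le> l $ i * (K * (norm w)\<^sup>2)"
        using K(2)[of i w w] by (simp add: abs_mult mult_left_mono power2_eq_square mult.assoc)
    qed
    also have "\<dots> = K * (norm w)\<^sup>2" using l by (simp add: multiplier_def flip: sum_distrib_right)
    finally show ?thesis .
  qed
  then show thesis using that K(1) by blast
qed

text \<open>The point is sought as a minimizer of a tilted and regularized difference quotient. With
  \<open>d = w' - w\<close>, the tilt by the combined gradient \<open>u = a + c\<close> cancels the linear part \<open>a \<bullet> d\<close> of the curvature,
  while \<open>c \<bullet> d\<close> is almost nonpositive, because the boundedness of the difference quotient forces the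
  minimizer to be almost critical. What is left of the lower bound is the value at \<^term>\<open>w\<close> plus
  \<open>(norm d)\<^sup>2\<close>, and comparison with the upper bound makes \<open>d\<close> small.\<close>

lemma recovery:
  assumes star: "star_system F xbar \<kappa> l b w z" and "\<epsilon> > 0"
  shows "\<forall>\<^sub>F t in at_right 0. \<exists>w' u'. norm (w' - w) < \<epsilon> \<and>
    norm (u' - combined_grad F xbar l b w) < \<epsilon> \<and>
    \<bar>2 * (f (xbar + t *\<^sub>R w') - f xbar) / t\<^sup>2 - \<kappa>\<bar> < \<epsilon> \<and>
    t *\<^sub>R u' \<in> subdiff f (xbar + t *\<^sub>R w')"
proof -
  from star have mult: "multiplier l" and crit: "\<And>i. i \<in> I \<Longrightarrow> g i \<bullet> w \<le> 0"
    and b: "\<And>i. i \<in> I \<Longrightarrow> 0 \<le> b $ i" "\<And>i. i \<in> I \<Longrightarrow> b $ i * (g i \<bullet> w) = 0"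
    and \<kappa>: "\<kappa> = curvature l w" and z: "\<And>i. i \<in> I \<Longrightarrow> g i \<bullet> z + (H i *v w) \<bullet> w \<le> \<kappa>"
    unfolding star_system_iff crit_cone_def by auto
  define a where "a = (\<Sum>i\<in>I. l $ i *\<^sub>R (H i *v w))"
  define c where "c = (\<Sum>i\<in>I. b $ i *\<^sub>R g i)"
  define u where "u = combined_grad F xbar l b w"
  have u: "u = a + c" by (simp add: u_def a_def c_def combined_grad_def sum.distrib)
  have cw: "c \<bullet> w = 0"
    unfolding c_def inner_sum_left by (intro sum.neutral) (use b(2) in simp)
  obtain K where K: "K > 0" "\<And>l w. multiplier l \<Longrightarrow> \<bar>curvature l w\<bar> \<le> K * (norm w)\<^sup>2"
    using curvature_bound by blast
  obtain C where C: "C > 0" "\<forall>\<^sub>F h in nhds 0. \<forall>i. \<bar>F i (xbar + h) - F i xbar - g i \<bullet> h\<bar> \<le> C * (norm h)\<^sup>2"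
    using first_order_estimate by blast
  \<comment> \<open>The minimizer will be shown to lie within \<^term>\<open>2 * s\<close> of \<^term>\<open>w\<close>, with errors of size \<open>s\<^sup>2\<close> in the
    values; \<open>N\<close> collects the factors by which this distance enters the three claims.\<close>
  define N where "N = 10 + 8 * K + 4 * norm u + 4 * norm a"
  define s where "s = min (1/4) (\<epsilon> / (2 * N))"
  have N: "N > 0" using K(1) by (simp add: N_def add_pos_nonneg)
  have s: "0 < s" "s \<le> 1/4" using \<open>\<epsilon> > 0\<close> N by (auto simp: s_def)
  have "s * N \<le> \<epsilon> / (2 * N) * N" using N by (intro mult_right_mono) (auto simp: s_def)
  then have sN: "s * N < \<epsilon>" using N \<open>\<epsilon> > 0\<close> by simp
  then have sN: "10 * s + 8 * (s * K) + 4 * (s * norm u) + 4 * (s * norm a) < \<epsilon>"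
    by (simp add: N_def algebra_simps)
  have sK: "0 \<le> s * K" "0 \<le> s * norm u" "0 \<le> s * norm a" using s K(1) by auto
  have ss: "s\<^sup>2 \<le> s / 4" "0 < s\<^sup>2" using s by (simp_all add: power2_eq_square)
  define r where "r = norm w + 1"
  have r: "r > 0" by (simp add: r_def add_nonneg_pos)
  define M where "M = (\<bar>\<kappa>\<bar> / 2 + 2 * s\<^sup>2 + norm u + C * r\<^sup>2) * (\<Sum>i\<in>I. b $ i)"
  have E1: "\<forall>\<^sub>F t in at_right 0. f (xbar + t *\<^sub>R (w + (t / 2) *\<^sub>R z)) \<le> f xbar + t\<^sup>2 / 2 * (\<kappa> + 2 * s\<^sup>2)"
    by (rule upper_estimate[OF crit z]) (use s in auto)
  have "s\<^sup>2 / r\<^sup>2 > 0" using s r by simp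
  from eventually_at_right_ball[OF lower_estimate[OF mult this] r]
  have E2: "\<forall>\<^sub>F t in at_right 0. \<forall>v. norm v \<le> r \<longrightarrow>
      f (xbar + t *\<^sub>R v) \<ge> f xbar + curvature l (t *\<^sub>R v) / 2 - s\<^sup>2 / r\<^sup>2 * (norm (t *\<^sub>R v))\<^sup>2" .
  from eventually_at_right_ball[OF C(2) r]
  have E3: "\<forall>\<^sub>F t in at_right 0. \<forall>v. norm v \<le> r \<longrightarrow>
      (\<forall>i. \<bar>F i (xbar + t *\<^sub>R v) - F i xbar - g i \<bullet> (t *\<^sub>R v)\<bar> \<le> C * (norm (t *\<^sub>R v))\<^sup>2)" .
  have "((\<lambda>t. t / 2 * norm z) \<longlongrightarrow> 0 / 2 * norm z) (at_right 0)" by (intro tendsto_intros) simp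
  then have E4: "\<forall>\<^sub>F t in at_right 0. t / 2 * norm z < 1" by (rule order_tendstoD(2)) simp
  have "((\<lambda>t. norm u * (t / 2 * norm z) + (K + 1) * (t / 2 * norm z)\<^sup>2)
      \<longlongrightarrow> norm u * (0 / 2 * norm z) + (K + 1) * (0 / 2 * norm z)\<^sup>2) (at_right 0)"
    by (intro tendsto_intros) simp_all
  then have E5: "\<forall>\<^sub>F t in at_right 0. norm u * (t / 2 * norm z) + (K + 1) * (t / 2 * norm z)\<^sup>2 < s\<^sup>2"
    by (rule order_tendstoD(2)) (use s in simp)
  have "((\<lambda>t. t * M) \<longlongrightarrow> 0 * M) (at_right 0)" by (intro tendsto_intros)
  then have E6: "\<forall>\<^sub>F t in at_right 0. t * M < s\<^sup>2" by (rule order_tendstoD(2)) (use s in simp)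
  have contf: "continuous_on UNIV f" by (rule continuous_on_pmax[OF C2_continuous_on[OF C2]])
  show ?thesis
    using E1 E2 E3 E4 E5 E6 eventually_at_right_less[of "0::real"]
  proof eventually_elim
    case (elim t)
    have t: "t > 0" by (rule elim(7))
    define D where "D v = (f (xbar + t *\<^sub>R v) - f xbar) / t\<^sup>2" for v
    have fD: "f (xbar + t *\<^sub>R v) = f xbar + t\<^sup>2 * D v" for v using t by (simp add: D_def)
    \<comment> \<open>The coefficient \<^term>\<open>K + 1\<close> exceeds what is needed to absorb the curvature, which \<^term>\<open>K\<close> bounds, by one
      quadratic term that forces the minimizer towards \<^term>\<open>w\<close>.\<close>
    define \<phi> where "\<phi> v = D v - u \<bullet> (v - w) + (K + 1) * (norm (v - w))\<^sup>2" for v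
    have "continuous_on (cball w 1) \<phi>"
      unfolding \<phi>_def D_def using t
      by (intro continuous_intros continuous_on_compose2[OF contf]) auto
    then obtain v where v: "v \<in> cball w 1" and min: "\<And>v'. v' \<in> cball w 1 \<Longrightarrow> \<phi> v \<le> \<phi> v'"
      using continuous_attains_inf[OF compact_cball[of w 1], of \<phi>] by auto
    define d where "d = v - w"
    have d1: "norm d \<le> 1" using v by (simp add: d_def dist_norm norm_minus_commute)
    have vr: "norm v \<le> r" using d1 norm_triangle_ineq[of w d] by (simp add: d_def r_def)
    have v_eq: "v = w + d" by (simp add: d_def)
    \<comment> \<open>Comparison with the point of the parabola bounds the minimal value above.\<close>
    define z' where "z' = (t / 2) *\<^sub>R z"
    have nz: "norm z' = t / 2 * norm z" using t by (simp add: z'_def)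
    have "\<phi> v \<le> \<phi> (w + z')" by (rule min) (use elim(4) nz in \<open>simp add: dist_norm\<close>)
    also have "\<phi> (w + z') = D (w + z') - u \<bullet> z' + (K + 1) * (norm z')\<^sup>2" by (simp add: \<phi>_def)
    also have "\<dots> \<le> (\<kappa> / 2 + s\<^sup>2) + s\<^sup>2"
    proof -
      have "t\<^sup>2 * D (w + z') \<le> t\<^sup>2 * (\<kappa> / 2 + s\<^sup>2)"
        using elim(1) fD[of "w + z'"] by (simp add: z'_def algebra_simps)
      then have "D (w + z') \<le> \<kappa> / 2 + s\<^sup>2" using t by simp
      moreover have "- (u \<bullet> z') \<le> norm u * norm z'" using Cauchy_Schwarz_ineq2[of u z'] by linarith
      ultimately show ?thesis using elim(5) by (simp add: nz)
    qed
    finally have up: "D v - u \<bullet> d + (K + 1) * (norm d)\<^sup>2 \<le> \<kappa> / 2 + 2 * s\<^sup>2" by (simp add: \<phi>_def d_def)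
    have low: "\<kappa> / 2 + a \<bullet> d + curvature l d / 2 - s\<^sup>2 \<le> D v"
    proof -
      have "(norm v)\<^sup>2 \<le> r\<^sup>2" using vr by (intro power_mono) auto
      then have "s\<^sup>2 / r\<^sup>2 * (norm v)\<^sup>2 \<le> s\<^sup>2 / r\<^sup>2 * r\<^sup>2" by (intro mult_left_mono) auto
      then have "s\<^sup>2 / r\<^sup>2 * (norm v)\<^sup>2 \<le> s\<^sup>2" using r by simp
      moreover have "t\<^sup>2 * (curvature l v / 2 - s\<^sup>2 / r\<^sup>2 * (norm v)\<^sup>2) \<le> t\<^sup>2 * D v"
      proof -
        have "f xbar + curvature l (t *\<^sub>R v) / 2 - s\<^sup>2 / r\<^sup>2 * (norm (t *\<^sub>R v))\<^sup>2 \<le> f xbar + t\<^sup>2 * D v"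
          using elim(2) vr by (simp only: fD)
        then show ?thesis by (simp add: curvature_scaleR power_mult_distrib right_diff_distrib mult_ac)
      qed
      then have "curvature l v / 2 - s\<^sup>2 / r\<^sup>2 * (norm v)\<^sup>2 \<le> D v" using t by simp
      moreover have "curvature l v = \<kappa> + 2 * (a \<bullet> d) + curvature l d"
        unfolding v_eq curvature_add \<kappa> a_def by simp
      ultimately show ?thesis by (simp add: field_simps)
    qed
    have Kd: "\<bar>curvature l d\<bar> \<le> K * (norm d)\<^sup>2" by (rule K(2)[OF mult])
    have ud: "u \<bullet> d \<le> norm u" 
    proof -
      have "u \<bullet> d \<le> norm u * norm d" by (rule norm_cauchy_schwarz)
      also have "\<dots> \<le> norm u" using d1 by (simp add: mult_left_le)
      finally show ?thesis .
    qed
    \<comment> \<open>A slope that is not small would make the difference quotient, in which it is divided by \<^term>\<open>t\<close>,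
      exceed its upper bound.\<close>
    have cv: "c \<bullet> v \<le> s\<^sup>2"
    proof -
      define M' where "M' = \<bar>\<kappa>\<bar> / 2 + 2 * s\<^sup>2 + norm u + C * r\<^sup>2"
      have "g i \<bullet> v \<le> t * M'" if "i \<in> I" for i
      proof -
        have "0 \<le> (K + 1) * (norm d)\<^sup>2" using K(1) by simp
        then have Dv: "D v \<le> \<bar>\<kappa>\<bar> / 2 + 2 * s\<^sup>2 + norm u" using up ud by linarith
        have "t * (g i \<bullet> v) \<le> F i (xbar + t *\<^sub>R v) - F i xbar + C * (norm (t *\<^sub>R v))\<^sup>2"
          using elim(3) vr by (auto simp: abs_le_iff dest!: spec[of _ v] spec[of _ i])
        also have "\<dots> \<le> t\<^sup>2 * D v + C * (t\<^sup>2 * (norm v)\<^sup>2)"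
          using pmax_ge[of F i "xbar + t *\<^sub>R v"] active_value[OF that] by (simp add: fD power_mult_distrib)
        also have "\<dots> \<le> t\<^sup>2 * (\<bar>\<kappa>\<bar> / 2 + 2 * s\<^sup>2 + norm u) + C * (t\<^sup>2 * r\<^sup>2)"
          using Dv vr C(1) by (intro add_mono mult_left_mono power_mono) auto
        also have "\<dots> = t * (t * M')" by (simp add: M'_def power2_eq_square algebra_simps)
        finally show ?thesis using t by simp
      qed
      then have "(\<Sum>i\<in>I. b $ i * (g i \<bullet> v)) \<le> (\<Sum>i\<in>I. b $ i * (t * M'))"
        using b(1) by (intro sum_mono mult_left_mono) auto
      also have "\<dots> = t * M" by (simp add: M_def M'_def sum_distrib_left sum_distrib_right mult_ac)
      finally show ?thesis using elim(6) by (simp add: c_def inner_sum_left)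
    qed
    have cd: "c \<bullet> d \<le> s\<^sup>2" using cv cw by (simp add: d_def inner_diff_right)
    have "(norm d)\<^sup>2 \<le> (2 * s)\<^sup>2"
    proof -
      have "u \<bullet> d = a \<bullet> d + c \<bullet> d" by (simp add: u inner_add_left)
      then have "- (curvature l d) / 2 + 3 * s\<^sup>2 + s\<^sup>2 \<ge> (K + 1) * (norm d)\<^sup>2" using up low cd by linarith
      moreover have "0 \<le> K * (norm d)\<^sup>2" using K(1) by simp
      ultimately show ?thesis using Kd by (simp add: algebra_simps power2_eq_square)
    qed
    then have ds: "norm d \<le> 2 * s" by (rule power2_le_imp_le) (use s in simp)
    define u' where "u' = u - (2 * (K + 1)) *\<^sub>R d"
    have "t *\<^sub>R u' \<in> regular_subdiff f (xbar + t *\<^sub>R v)"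
    proof (rule proximal_imp_regular_subgradient[where c = "K + 1"])
      have "\<forall>\<^sub>F y in nhds (xbar + t *\<^sub>R v). dist y (xbar + t *\<^sub>R v) < t / 2"
        using t by (auto simp: eventually_nhds_metric intro!: exI[of _ "t / 2"])
      then show "\<forall>\<^sub>F y in nhds (xbar + t *\<^sub>R v). f y \<ge> f (xbar + t *\<^sub>R v)
          + (t *\<^sub>R u') \<bullet> (y - (xbar + t *\<^sub>R v)) - (K + 1) * (norm (y - (xbar + t *\<^sub>R v)))\<^sup>2"
      proof eventually_elim
        case (elim y)
        define e where "e = (y - (xbar + t *\<^sub>R v)) /\<^sub>R t"
        have y: "y = xbar + t *\<^sub>R (v + e)" using t by (simp add: e_def scaleR_add_right)
        have ye: "y - (xbar + t *\<^sub>R v) = t *\<^sub>R e" using t by (simp add: e_def)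
        have "norm e < 1 / 2" using elim t by (simp add: dist_norm ye)
        then have "norm (d + e) \<le> 1" using norm_triangle_ineq[of d e] ds s by linarith
        moreover have "v + e - w = d + e" by (simp add: d_def)
        ultimately have "v + e \<in> cball w 1" by (simp only: mem_cball dist_norm norm_minus_commute[of w])
        from min[OF this]
        have "D v - u \<bullet> d + (K + 1) * (norm d)\<^sup>2 \<le> D (v + e) - u \<bullet> (d + e) + (K + 1) * (norm (d + e))\<^sup>2"
          by (simp add: \<phi>_def d_def add.commute add_diff_eq)
        then have "D v + u' \<bullet> e - (K + 1) * (norm e)\<^sup>2 \<le> D (v + e)"
          by (simp add: u'_def power2_norm_eq_inner inner_add_left inner_add_right inner_diff_left
              inner_commute[of e d] algebra_simps)
        then have "t\<^sup>2 * (D v + u' \<bullet> e - (K + 1) * (norm e)\<^sup>2) \<le> t\<^sup>2 * D (v + e)"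
          by (intro mult_left_mono) auto
        then show ?case unfolding ye unfolding y fD
          by (simp add: power_mult_distrib power2_eq_square algebra_simps)
      qed
    qed
    then have sub: "t *\<^sub>R u' \<in> subdiff f (xbar + t *\<^sub>R v)" using regular_subdiff_subset_subdiff by blast
    have "norm (v - w) < \<epsilon>" using ds sN sK s(1) unfolding d_def by linarith
    moreover have "norm (u' - u) < \<epsilon>"
    proof -
      have "norm (u' - u) = 2 * (K + 1) * norm d" using K(1) by (simp add: u'_def)
      also have "\<dots> \<le> 2 * (K + 1) * (2 * s)" using K(1) ds by (intro mult_left_mono) auto
      also have "\<dots> = 4 * (s * K) + 4 * s" by (simp add: algebra_simps)
      also have "\<dots> < \<epsilon>" using sN sK s by linarith
      finally show ?thesis .
    qed
    moreover have "\<bar>2 * D v - \<kappa>\<bar> < \<epsilon>"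
    proof -
      have "u \<bullet> d \<le> norm u * (2 * s)" using norm_cauchy_schwarz[of u d] mult_left_mono[OF ds norm_ge_zero[of u]] by linarith
      moreover have "- (a \<bullet> d) \<le> norm a * (2 * s)"
        using Cauchy_Schwarz_ineq2[of a d] mult_left_mono[OF ds norm_ge_zero[of a]] by linarith
      moreover have "K * (norm d)\<^sup>2 \<le> s * K"
      proof -
        have "(norm d)\<^sup>2 \<le> (2 * s)\<^sup>2" using ds by (intro power_mono) auto
        also have "\<dots> \<le> s" using ss(1) by (simp add: power_mult_distrib)
        finally show ?thesis using mult_left_mono[of "(norm d)\<^sup>2" s K] K(1) by (simp add: mult.commute)
      qed
      moreover have "0 \<le> (K + 1) * (norm d)\<^sup>2" using K(1) by simp
      ultimately have "2 * D v - \<kappa> \<le> 4 * s\<^sup>2 + 4 * (s * norm u)"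
        and "\<kappa> - 2 * D v \<le> 4 * (s * norm a) + s * K + 2 * s\<^sup>2"
        using up low Kd by (simp_all add: mult_ac)
      then show ?thesis using sN sK s ss by linarith
    qed
    ultimately show ?case using sub
      by (intro exI[of _ v] exI[of _ u']) (simp add: u_def[symmetric] D_def)
  qed
qed

section \<open>The equivalent conditions\<close>

text \<open>Given that 0 is a subgradient, this is the negation of each of the three equivalent conditions.\<close>

definition degenerate :: bool where
  "degenerate \<longleftrightarrow> (\<exists>\<kappa> l b w z. star_system F xbar \<kappa> l b w z \<and> norm w = 1 \<and> combined_grad F xbar l b w = 0)"

lemma ex_multiplier:
  assumes "0 \<in> subdiff f xbar"
  obtains l where "multiplier l"
  using subdiff_pmax[OF C2 assms] face_is_multiplier by metis

lemma combined_grad_inner: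
  assumes "star_system F xbar \<kappa> l b w z"
  shows "combined_grad F xbar l b w \<bullet> w = \<kappa>"
proof -
  have "(\<Sum>i\<in>I. b $ i * (g i \<bullet> w)) = 0"
    using assms unfolding star_system_iff by (intro sum.neutral) blast
  moreover have "combined_grad F xbar l b w \<bullet> w = curvature l w + (\<Sum>i\<in>I. b $ i * (g i \<bullet> w))"
    by (simp add: combined_grad_def curvature_def sum.distrib inner_add_left inner_sum_left)
  moreover have "\<kappa> = curvature l w" using assms unfolding star_system_iff by blast
  ultimately show ?thesis by linarith
qed

lemma recovery_point:
  assumes "star_system F xbar \<kappa> l b w z" "\<epsilon> > 0" "\<delta> > 0"
  obtains t w' u' where "0 < t" "t < \<delta>" "norm (w' - w) < \<epsilon>"
    "norm (u' - combined_grad F xbar l b w) < \<epsilon>" "t *\<^sub>R u' \<in> subdiff f (xbar + t *\<^sub>R w')"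
proof -
  have "\<forall>\<^sub>F t in at_right 0. t \<in> {0<..<\<delta>}" using assms(3) by (rule eventually_at_right_real)
  with recovery[OF assms(1,2)]
  have "\<forall>\<^sub>F t in at_right 0. 0 < t \<and> t < \<delta> \<and> (\<exists>w' u'. norm (w' - w) < \<epsilon> \<and>
      norm (u' - combined_grad F xbar l b w) < \<epsilon> \<and> t *\<^sub>R u' \<in> subdiff f (xbar + t *\<^sub>R w'))"
    by eventually_elim auto
  then have "\<exists>t. 0 < t \<and> t < \<delta> \<and> (\<exists>w' u'. norm (w' - w) < \<epsilon> \<and>
      norm (u' - combined_grad F xbar l b w) < \<epsilon> \<and> t *\<^sub>R u' \<in> subdiff f (xbar + t *\<^sub>R w'))"
    by (rule eventually_happens'[OF trivial_limit_at_right_real])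
  then show thesis using that by blast
qed

lemma degenerate_if_flat:
  assumes flat: "\<And>e. e > 0 \<Longrightarrow> \<exists>x v. x \<noteq> xbar \<and> norm (x - xbar) < e \<and> v \<in> subdiff f x \<and>
    norm v \<le> e * norm (x - xbar)"
  shows degenerate
proof -
  have "\<exists>x v. x \<noteq> xbar \<and> norm (x - xbar) < inverse (real (Suc n)) \<and> v \<in> subdiff f x \<and>
    norm v \<le> inverse (real (Suc n)) * norm (x - xbar)" for n by (rule flat) simp
  then obtain X V where X: "\<And>n. X n \<noteq> xbar" "\<And>n. norm (X n - xbar) < inverse (real (Suc n))"
    and V: "\<And>n. V n \<in> subdiff f (X n)" "\<And>n. norm (V n) \<le> inverse (real (Suc n)) * norm (X n - xbar)"
    by metis
  have "(\<lambda>n. X n - xbar) \<longlonglongrightarrow> 0"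
    by (rule Lim_null_comparison[OF _ LIMSEQ_inverse_real_of_nat]) (use X(2) in \<open>auto intro!: always_eventually less_imp_le\<close>)
  then have Xlim: "X \<longlonglongrightarrow> xbar" by (simp add: LIM_zero_iff)
  have B: "norm (V n) \<le> 1 * norm (X n - xbar)" for n
  proof -
    have "inverse (real (Suc n)) \<le> 1" by (simp add: field_simps)
    then have "inverse (real (Suc n)) * norm (X n - xbar) \<le> 1 * norm (X n - xbar)"
      by (rule mult_right_mono) simp
    then show ?thesis using V(2)[of n] by linarith
  qed
  obtain s \<kappa> l b w z where s: "strict_mono s" and star: "star_system F xbar \<kappa> l b w z" "norm w = 1"
    and lim: "(\<lambda>k. V (s k) /\<^sub>R norm (X (s k) - xbar)) \<longlonglongrightarrow> combined_grad F xbar l b w"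
    by (rule blow_up[OF Xlim X(1) V(1) B]) (rule that)
  have "(\<lambda>n. V n /\<^sub>R norm (X n - xbar)) \<longlonglongrightarrow> 0"
  proof (rule Lim_null_comparison[OF _ LIMSEQ_inverse_real_of_nat], rule always_eventually, rule allI)
    fix n show "norm (V n /\<^sub>R norm (X n - xbar)) \<le> inverse (real (Suc n))"
      using V(2)[of n] X(1)[of n] by (simp add: field_simps)
  qed
  from LIMSEQ_subseq_LIMSEQ[OF this s] have "combined_grad F xbar l b w = 0"
    unfolding o_def by (rule LIMSEQ_unique[OF lim])
  then show ?thesis using star unfolding degenerate_def by blast
qed

text \<open>An optimal value 0 has to be attained, although \<open>b\<close> and \<open>z\<close> may be unbounded along a minimizing sequence.
  Therefore one passes through points: approximate solutions are realized by points with small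
  subgradients relative to their distance from \<open>xbar\<close>, and the blow-up of these is an exact solution.\<close>

lemma degenerate_if_approximately:
  assumes "\<And>e. e > 0 \<Longrightarrow> \<exists>\<kappa> l b w z. star_system F xbar \<kappa> l b w z \<and> norm w = 1 \<and> norm (combined_grad F xbar l b w) < e"
  shows degenerate
proof (rule degenerate_if_flat)
  fix e :: real assume "e > 0"
  define e' where "e' = min (1/2) (e / 4)"
  have e': "e' > 0" "e' \<le> 1/2" "e' \<le> e / 4" using \<open>e > 0\<close> by (auto simp: e'_def)
  obtain \<kappa> l b w z where star: "star_system F xbar \<kappa> l b w z" and w: "norm w = 1"
    and small: "norm (combined_grad F xbar l b w) < e'" using assms[OF e'(1)] by blast
  obtain t w' u' where t: "0 < t" "t < e / 2" and w': "norm (w' - w) < e'"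
    and u': "norm (u' - combined_grad F xbar l b w) < e'" and sub: "t *\<^sub>R u' \<in> subdiff f (xbar + t *\<^sub>R w')"
    by (rule recovery_point[OF star e'(1), of "e / 2"]) (use \<open>e > 0\<close> in auto)
  have lo: "1 / 2 \<le> norm w'" and hi: "norm w' \<le> 2"
    using norm_triangle_ineq2[of w "w - w'"] norm_triangle_ineq[of w "w' - w"] w w' e' by (auto simp: norm_minus_commute)
  have "norm u' \<le> 2 * e'" using norm_triangle_ineq[of "u' - combined_grad F xbar l b w" "combined_grad F xbar l b w"] u' small by simp
  also have "\<dots> \<le> e / 2" using e' by simp
  also have "\<dots> \<le> e * norm w'" using lo \<open>e > 0\<close> by simp
  finally have "norm (t *\<^sub>R u') \<le> e * norm (t *\<^sub>R w')" using t by (simp add: mult.left_commute)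
  moreover have "norm (t *\<^sub>R w') < e"
  proof -
    have "t * norm w' \<le> t * 2" using hi t by (intro mult_left_mono) auto
    then have "t * norm w' < e" using t by linarith
    then show ?thesis using t by simp
  qed
  moreover have "t *\<^sub>R w' \<noteq> 0" using lo t by auto
  ultimately show "\<exists>x v. x \<noteq> xbar \<and> norm (x - xbar) < e \<and> v \<in> subdiff f x \<and> norm v \<le> e * norm (x - xbar)"
    using sub by (intro exI[of _ "xbar + t *\<^sub>R w'"] exI[of _ "t *\<^sub>R u'"]) simp
qed

lemma cond_c_iff: "cond_c F xbar \<longleftrightarrow> \<not> degenerate"
proof
  assume c: "cond_c F xbar"
  show "\<not> degenerate"
  proof
    assume degenerate
    then obtain \<kappa> l b w z where "star_system F xbar \<kappa> l b w z" "norm w = 1" "combined_grad F xbar l b w = 0"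
      unfolding degenerate_def by blast
    then have "optval_c F xbar \<le> ereal (1/2 * 0\<^sup>2)"
      unfolding optval_c_def by (intro INF_lower2[of "(\<kappa>, l, b, w, z)"]) auto
    then show False using c by (simp add: cond_c_def zero_ereal_def)
  qed
next
  assume "\<not> degenerate"
  then obtain e where e: "e > 0" and ge: "\<And>\<kappa> l b w z. star_system F xbar \<kappa> l b w z \<Longrightarrow> norm w = 1 \<Longrightarrow>
      e \<le> norm (combined_grad F xbar l b w)"
    using degenerate_if_approximately by (meson not_le)
  have "ereal (1/2 * e\<^sup>2) \<le> optval_c F xbar"
    unfolding optval_c_def
  proof (rule INF_greatest, clarify)
    fix \<kappa> l b and w z :: "real^'n"
    assume "star_system F xbar \<kappa> l b w z" "(norm w)\<^sup>2 = 1"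
    then have "e \<le> norm (combined_grad F xbar l b w)" using ge by (simp add: power2_eq_1_iff) (smt (verit) norm_ge_zero)
    then have "e\<^sup>2 \<le> (norm (combined_grad F xbar l b w))\<^sup>2" using e by (intro power_mono) auto
    then show "ereal (1/2 * e\<^sup>2) \<le> ereal (1/2 * (norm (combined_grad F xbar l b w))\<^sup>2)" by simp
  qed
  moreover have "0 < ereal (1/2 * e\<^sup>2)" using e by simp
  ultimately show "cond_c F xbar" unfolding cond_c_def by (rule less_le_trans[rotated])
qed

text \<open>A nonzero direction in the inverse graphical derivative provides subgradients of size \<open>o(t)\<close>, which can be
  blown up; conversely, the recovered points for a solution with vanishing combined gradient define
  such a direction.\<close>

lemma cond_a_iff:
  assumes zero: "0 \<in> subdiff f xbar"
  shows "cond_a F xbar \<longleftrightarrow> \<not> degenerate"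
proof -
  define Z where "Z = set_valued_inverse (graphical_deriv (subdiff f) xbar 0) 0"
  have Z: "w \<in> Z \<longleftrightarrow> (\<exists>t W U. (\<forall>k::nat. t k > (0::real)) \<and> t \<longlonglongrightarrow> 0 \<and> W \<longlonglongrightarrow> w \<and> U \<longlonglongrightarrow> 0 \<and>
      (\<forall>k. t k *\<^sub>R U k \<in> subdiff f (xbar + t k *\<^sub>R W k)))" (is "_ \<longleftrightarrow> ?R") for w
  proof -
    have "w \<in> Z \<longleftrightarrow> (\<exists>t P. (\<forall>k::nat. t k > (0::real)) \<and> t \<longlonglongrightarrow> 0 \<and> P \<longlonglongrightarrow> (w, 0) \<and>
      (\<forall>k. t k *\<^sub>R snd (P k) \<in> subdiff f (xbar + t k *\<^sub>R fst (P k))))"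
      by (simp add: Z_def set_valued_inverse_def graphical_deriv_def tangent_cone_def graph_of_def case_prod_unfold)
    also have "\<dots> \<longleftrightarrow> ?R"
    proof
      assume "\<exists>t P. (\<forall>k::nat. t k > (0::real)) \<and> t \<longlonglongrightarrow> 0 \<and> P \<longlonglongrightarrow> (w, 0) \<and>
        (\<forall>k. t k *\<^sub>R snd (P k) \<in> subdiff f (xbar + t k *\<^sub>R fst (P k)))"
      then obtain t P where *: "\<forall>k::nat. t k > (0::real)" "t \<longlonglongrightarrow> 0" "P \<longlonglongrightarrow> (w, 0)"
        "\<forall>k. t k *\<^sub>R snd (P k) \<in> subdiff f (xbar + t k *\<^sub>R fst (P k))" by blast
      then show ?R using tendsto_fst[OF *(3)] tendsto_snd[OF *(3)]
        by (intro exI[of _ t] exI[of _ "\<lambda>k. fst (P k)"] exI[of _ "\<lambda>k. snd (P k)"]) simp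
    next
      assume ?R
      then obtain t W U where *: "\<forall>k::nat. t k > (0::real)" "t \<longlonglongrightarrow> 0" "W \<longlonglongrightarrow> w" "U \<longlonglongrightarrow> 0"
        "\<forall>k. t k *\<^sub>R U k \<in> subdiff f (xbar + t k *\<^sub>R W k)" by blast
      then show "\<exists>t P. (\<forall>k::nat. t k > (0::real)) \<and> t \<longlonglongrightarrow> 0 \<and> P \<longlonglongrightarrow> (w, 0) \<and>
        (\<forall>k. t k *\<^sub>R snd (P k) \<in> subdiff f (xbar + t k *\<^sub>R fst (P k)))"
        by (intro exI[of _ t] exI[of _ "\<lambda>k. (W k, U k)"]) (simp add: tendsto_Pair)
    qed
    finally show ?thesis .
  qed
  have "0 \<in> Z"
    unfolding Z by (intro exI[of _ "\<lambda>k. inverse (real (Suc k))"] exI[of _ "\<lambda>k. 0"])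
      (use zero LIMSEQ_inverse_real_of_nat in simp)
  moreover have "(\<exists>w\<in>Z. w \<noteq> 0) \<longleftrightarrow> degenerate"
  proof
    assume "\<exists>w\<in>Z. w \<noteq> 0"
    then obtain w where w: "w \<in> Z" "w \<noteq> 0" by blast
    from w(1)[unfolded Z] obtain t W U where t: "\<And>k. t k > (0::real)" "t \<longlonglongrightarrow> 0"
      and W: "W \<longlonglongrightarrow> w" and U: "U \<longlonglongrightarrow> 0" and sub: "\<And>k::nat. t k *\<^sub>R U k \<in> subdiff f (xbar + t k *\<^sub>R W k)"
      by blast
    show degenerate
    proof (rule degenerate_if_flat)
      fix e :: real assume "e > 0"
      have "(\<lambda>k. norm (t k *\<^sub>R W k)) \<longlonglongrightarrow> norm (0 *\<^sub>R w)" by (intro tendsto_intros t W)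
      then have "\<forall>\<^sub>F k in sequentially. norm (t k *\<^sub>R W k) < e" by (rule order_tendstoD(2)) (use \<open>e > 0\<close> in simp)
      moreover have "(\<lambda>k. e * norm (W k) - norm (U k)) \<longlonglongrightarrow> e * norm w - norm (0::real^'n)" by (intro tendsto_intros U W)
      then have "\<forall>\<^sub>F k in sequentially. 0 < e * norm (W k) - norm (U k)"
        by (rule order_tendstoD(1)) (use \<open>e > 0\<close> w in simp)
      ultimately have "\<forall>\<^sub>F k in sequentially. norm (t k *\<^sub>R W k) < e \<and> 0 < e * norm (W k) - norm (U k)"
        by (rule eventually_conj)
      then obtain k where k: "norm (t k *\<^sub>R W k) < e" "norm (U k) < e * norm (W k)"
        by (auto dest: eventually_happens)
      have "W k \<noteq> 0" using k(2) norm_ge_zero[of "U k"] by auto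
      then show "\<exists>x v. x \<noteq> xbar \<and> norm (x - xbar) < e \<and> v \<in> subdiff f x \<and> norm v \<le> e * norm (x - xbar)"
        using sub[of k] k t(1)[of k]
        by (intro exI[of _ "xbar + t k *\<^sub>R W k"] exI[of _ "t k *\<^sub>R U k"]) (simp add: mult.left_commute)
    qed
  next
    assume degenerate
    then obtain \<kappa> l b w z where star: "star_system F xbar \<kappa> l b w z" "norm w = 1" "combined_grad F xbar l b w = 0"
      unfolding degenerate_def by blast
    have "\<exists>t w' u'. 0 < t \<and> t < inverse (real (Suc n)) \<and> norm (w' - w) < inverse (real (Suc n)) \<and>
      norm u' < inverse (real (Suc n)) \<and> t *\<^sub>R u' \<in> subdiff f (xbar + t *\<^sub>R w')" for n
      by (rule recovery_point[OF star(1), of "inverse (real (Suc n))" "inverse (real (Suc n))"])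
        (use star(3) in auto)
    then obtain t W U where t: "\<And>n. 0 < t n" "\<And>n. t n < inverse (real (Suc n))"
      and W: "\<And>n. norm (W n - w) < inverse (real (Suc n))" and U: "\<And>n. norm (U n) < inverse (real (Suc n))"
      and sub: "\<And>n. t n *\<^sub>R U n \<in> subdiff f (xbar + t n *\<^sub>R W n)" by metis
    have "t \<longlonglongrightarrow> 0"
      by (rule Lim_null_comparison[OF _ LIMSEQ_inverse_real_of_nat])
        (use t in \<open>auto intro!: always_eventually less_imp_le simp: abs_of_pos\<close>)
    moreover have "(\<lambda>n. W n - w) \<longlonglongrightarrow> 0"
      by (rule Lim_null_comparison[OF _ LIMSEQ_inverse_real_of_nat]) (use W in \<open>auto intro!: always_eventually less_imp_le\<close>)
    then have "W \<longlonglongrightarrow> w" by (simp add: LIM_zero_iff)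
    moreover have "U \<longlonglongrightarrow> 0"
      by (rule Lim_null_comparison[OF _ LIMSEQ_inverse_real_of_nat]) (use U in \<open>auto intro!: always_eventually less_imp_le\<close>)
    ultimately have "w \<in> Z" unfolding Z using t(1) sub by blast
    moreover have "w \<noteq> 0" using star(2) by auto
    ultimately show "\<exists>w\<in>Z. w \<noteq> 0" by blast
  qed
  ultimately show ?thesis unfolding cond_a_def Z_def[symmetric] by blast
qed

lemma star_system_scale:
  assumes "star_system F xbar \<kappa> l b w z" "c > 0"
  shows "star_system F xbar (c\<^sup>2 * \<kappa>) l (c *\<^sub>R b) (c *\<^sub>R w) (c\<^sup>2 *\<^sub>R z)"
    and "combined_grad F xbar l (c *\<^sub>R b) (c *\<^sub>R w) = c *\<^sub>R combined_grad F xbar l b w"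
proof -
  have "g i \<bullet> (c\<^sup>2 *\<^sub>R z) + (H i *v (c *\<^sub>R w)) \<bullet> (c *\<^sub>R w) \<le> c\<^sup>2 * \<kappa>" if "i \<in> I" for i
  proof -
    have "g i \<bullet> z + (H i *v w) \<bullet> w \<le> \<kappa>" using assms(1) that unfolding star_system_iff by blast
    from mult_left_mono[OF this, of "c\<^sup>2"] show ?thesis
      by (simp add: matrix_vector_mult_scaleR distrib_left power2_eq_square mult.assoc)
  qed
  moreover have "g i \<bullet> (c *\<^sub>R w) \<le> 0" if "i \<in> I" for i
    using assms that unfolding star_system_iff crit_cone_def by (simp add: mult_nonneg_nonpos)
  moreover have "0 \<le> (c *\<^sub>R b) $ i \<and> (c *\<^sub>R b) $ i * (g i \<bullet> (c *\<^sub>R w)) = 0" if "i \<in> I" for i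
    using assms that unfolding star_system_iff by auto
  ultimately show "star_system F xbar (c\<^sup>2 * \<kappa>) l (c *\<^sub>R b) (c *\<^sub>R w) (c\<^sup>2 *\<^sub>R z)"
    using assms(1) unfolding star_system_iff crit_cone_def by (simp add: curvature_scaleR)
  show "combined_grad F xbar l (c *\<^sub>R b) (c *\<^sub>R w) = c *\<^sub>R combined_grad F xbar l b w"
    by (simp add: combined_grad_def scaleR_sum_right scaleR_add_right matrix_vector_mult_scaleR mult.commute)
qed

text \<open>The inner product of the combined gradient with \<^term>\<open>w\<close> is the curvature plus a sum of nonpositive terms. If
  the combined gradient vanishes and the second subderivative, an upper bound of all curvatures, is 0,
  then every term vanishes: \<^term>\<open>l\<close> has maximal curvature and \<^term>\<open>b\<close> is complementary to \<^term>\<open>w\<close>.\<close>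

lemma cond_b_iff: "cond_b F xbar \<longleftrightarrow> \<not> degenerate"
proof
  assume b: "cond_b F xbar"
  show "\<not> degenerate"
  proof
    assume degenerate
    then obtain \<kappa> l b w z where star: "star_system F xbar \<kappa> l b w z" and w: "norm w = 1"
      and zero: "combined_grad F xbar l b w = 0"
      unfolding degenerate_def by blast
    have \<kappa>: "\<kappa> = 0" using combined_grad_inner[OF star] zero by simp
    have mult: "multiplier l" using star by (simp add: star_system_iff)
    have "second_subderiv0 f xbar w \<le> ereal \<kappa>"
      by (rule second_subderiv_le) (use star in \<open>auto simp: star_system_iff crit_cone_def\<close>)
    moreover have "ereal \<kappa> \<le> second_subderiv0 f xbar w"
      using second_subderiv_ge_curvature[OF mult] star by (simp add: star_system_iff)
    ultimately have d2: "second_subderiv0 f xbar w = 0" using \<kappa> by (simp add: zero_ereal_def)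
    have "(\<Sum>i\<in>I. l $ i *\<^sub>R (H i *v w, g i)) + (\<Sum>i\<in>I. b $ i *\<^sub>R (g i, 0)) = (0, 0)"
      using zero mult by (simp add: sum_prod combined_grad_def sum.distrib multiplier_def)
    moreover have "\<forall>i\<in>I. l $ i \<ge> 0 \<and> b $ i \<ge> 0"
      using star by (simp add: star_system_iff multiplier_def)
    moreover have "w \<noteq> 0" using w by auto
    ultimately have "\<forall>i\<in>I. l $ i = 0"
      using b d2 unfolding cond_b_def by blast
    then show False using mult by (simp add: multiplier_def)
  qed
next
  assume nd: "\<not> degenerate"
  show "cond_b F xbar"
    unfolding cond_b_def
  proof (intro allI impI, elim conjE, rule ccontr)
    fix w :: "real^'n" and l b :: "real^'m"
    assume w: "w \<noteq> 0" and d2: "second_subderiv0 f xbar w = 0"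
      and sum: "(\<Sum>i\<in>I. l $ i *\<^sub>R (H i *v w, g i)) + (\<Sum>i\<in>I. b $ i *\<^sub>R (g i, 0)) = (0, 0)"
      and nonneg: "\<forall>i\<in>I. l $ i \<ge> 0 \<and> b $ i \<ge> 0" and ne: "\<not> (\<forall>i\<in>I. l $ i = 0)"
    have sums: "(\<Sum>i\<in>I. l $ i *\<^sub>R (H i *v w)) + (\<Sum>i\<in>I. b $ i *\<^sub>R g i) = 0" "(\<Sum>i\<in>I. l $ i *\<^sub>R g i) = 0"
      using sum by (simp_all add: sum_prod)
    define S where "S = (\<Sum>i\<in>I. l $ i)"
    have "S \<noteq> 0" using ne nonneg unfolding S_def by (subst sum_nonneg_eq_0_iff) auto
    then have S: "S > 0" using nonneg sum_nonneg[of I "\<lambda>i. l $ i"] by (force simp: S_def)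
    define l' where "l' = (1 / S) *\<^sub>R l"
    define b' where "b' = (1 / S) *\<^sub>R b"
    have mult: "multiplier l'"
      unfolding multiplier_def
    proof (intro conjI)
      show "\<forall>i\<in>I. 0 \<le> l' $ i" using nonneg S by (simp add: l'_def)
      show "(\<Sum>i\<in>I. l' $ i) = 1" using S by (simp add: l'_def S_def flip: sum_divide_distrib)
      have "(\<Sum>i\<in>I. l' $ i *\<^sub>R g i) = (1 / S) *\<^sub>R (\<Sum>i\<in>I. l $ i *\<^sub>R g i)"
        by (simp add: l'_def scaleR_sum_right)
      then show "(\<Sum>i\<in>I. l' $ i *\<^sub>R g i) = 0" using sums(2) by simp
    qed
    have cg: "combined_grad F xbar l' b' w = 0"
    proof -
      have "combined_grad F xbar l' b' w
          = (1 / S) *\<^sub>R ((\<Sum>i\<in>I. l $ i *\<^sub>R (H i *v w)) + (\<Sum>i\<in>I. b $ i *\<^sub>R g i))"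
        by (simp add: combined_grad_def l'_def b'_def sum.distrib scaleR_sum_right scaleR_add_right)
      then show ?thesis using sums(1) by simp
    qed
    have crit: "w \<in> crit_cone F xbar" using second_subderiv_outside_crit_cone[of w] d2 by force
    have b': "0 \<le> b' $ i" if "i \<in> I" for i using nonneg S that by (simp add: b'_def)
    have le: "b' $ i * (g i \<bullet> w) \<le> 0" if "i \<in> I" for i
      using b'[OF that] crit that by (auto simp: crit_cone_def intro: mult_nonneg_nonpos)
    have "curvature l' w + (\<Sum>i\<in>I. b' $ i * (g i \<bullet> w)) = combined_grad F xbar l' b' w \<bullet> w"
      by (simp add: combined_grad_def curvature_def sum.distrib inner_add_left inner_sum_left)
    then have eq: "curvature l' w + (\<Sum>i\<in>I. b' $ i * (g i \<bullet> w)) = 0" using cg by simp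
    have cle: "curvature l'' w \<le> 0" if "multiplier l''" for l''
      using second_subderiv_ge_curvature[OF that, of w] d2 by (simp add: zero_ereal_def)
    have "(\<Sum>i\<in>I. b' $ i * (g i \<bullet> w)) \<le> 0" using le by (rule sum_nonpos)
    then have c0: "curvature l' w = 0" and b0: "(\<Sum>i\<in>I. b' $ i * (g i \<bullet> w)) = 0"
      using eq cle[OF mult] by linarith+
    have "(\<Sum>i\<in>I. - (b' $ i * (g i \<bullet> w))) = 0" using b0 by (simp add: sum_negf)
    then have b00: "\<forall>i\<in>I. b' $ i * (g i \<bullet> w) = 0"
      using le by (subst (asm) sum_nonneg_eq_0_iff) auto
    obtain z where z: "\<And>i. i \<in> I \<Longrightarrow> g i \<bullet> z + (H i *v w) \<bullet> w \<le> curvature l' w"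
      using ex_dual_solution[OF mult, of w] cle c0 by auto
    have star: "star_system F xbar (curvature l' w) l' b' w z"
      unfolding star_system_iff using mult crit b' b00 z by blast
    have pos: "1 / norm w > 0" using w by simp
    have degenerate
      unfolding degenerate_def
      using star_system_scale[OF star pos] cg w by (intro exI conjI) auto
    then show False using nd by simp
  qed
qed

section \<open>The Kurdyka-Lojasiewicz modulus\<close>

text \<open>Up to a quadratic error each active function satisfies the gradient inequality of a convex function
  with base point \<open>xbar + h\<close>, evaluated at \<^term>\<open>xbar\<close>.\<close>

lemma subgradient_inequality:
  obtains C where "C > 0" "\<forall>\<^sub>F h in nhds 0. \<forall>v \<in> subdiff f (xbar + h). f (xbar + h) - f xbar \<le> norm v * norm h + C * (norm h)\<^sup>2"
proof -
  obtain K where K: "K > 0" "\<And>i h k. \<bar>(H i *v h) \<bullet> k\<bar> \<le> K * norm h * norm k"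
    using hessian_bound by blast
  obtain C where C: "C > 0" "\<forall>\<^sub>F h in nhds 0. \<forall>i. \<bar>F i (xbar + h) - F i xbar - g i \<bullet> h\<bar> \<le> C * (norm h)\<^sup>2"
    using first_order_estimate by blast
  define C' where "C' = C + 1 + K"
  have "\<forall>\<^sub>F h in nhds 0. \<forall>v \<in> subdiff f (xbar + h). f (xbar + h) - f xbar \<le> norm v * norm h + C' * (norm h)\<^sup>2"
    using C(2) gradient_expansion_eventually[OF zero_less_one]
  proof eventually_elim
    case (elim h)
    show ?case
    proof
      fix v assume "v \<in> subdiff f (xbar + h)"
      then obtain l where l: "l \<in> face_of_simplex (active F (xbar + h))"
        and v: "v = (\<Sum>i\<in>UNIV. l $ i *\<^sub>R gradient (F i) (xbar + h))" using subdiff_pmax[of F v "xbar + h", OF C2] by blast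
      have "l $ i * (f (xbar + h) - f xbar) \<le> l $ i * (gradient (F i) (xbar + h) \<bullet> h + C' * (norm h)\<^sup>2)" for i
      proof (cases "i \<in> active F (xbar + h)")
        case True
        define G where "G = gradient (F i) (xbar + h) - g i - H i *v h"
        have "\<bar>G \<bullet> h\<bar> \<le> norm G * norm h" by (rule Cauchy_Schwarz_ineq2)
        also have "\<dots> \<le> (1 * norm h) * norm h"
          using elim(2) unfolding G_def by (intro mult_right_mono) auto
        finally have "\<bar>G \<bullet> h\<bar> \<le> (norm h)\<^sup>2" by (simp add: power2_eq_square)
        moreover have "\<bar>(H i *v h) \<bullet> h\<bar> \<le> K * (norm h)\<^sup>2"
          using K(2)[of i h h] by (simp add: power2_eq_square mult.assoc)
        moreover have "gradient (F i) (xbar + h) \<bullet> h = G \<bullet> h + g i \<bullet> h + (H i *v h) \<bullet> h"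
          by (simp add: G_def inner_diff_left)
        moreover have "f (xbar + h) - f xbar \<le> g i \<bullet> h + C * (norm h)\<^sup>2"
          using spec[OF elim(1), of i] True pmax_ge[of F i xbar] unfolding active_def mem_Collect_eq by linarith
        ultimately have "f (xbar + h) - f xbar \<le> gradient (F i) (xbar + h) \<bullet> h + C' * (norm h)\<^sup>2"
          by (simp add: C'_def algebra_simps)
        then show ?thesis using l by (intro mult_left_mono) (simp_all add: face_of_simplex_def)
      next
        case False
        then show ?thesis using l by (simp add: face_of_simplex_def)
      qed
      then have "(\<Sum>i\<in>UNIV. l $ i * (f (xbar + h) - f xbar))
          \<le> (\<Sum>i\<in>UNIV. l $ i * (gradient (F i) (xbar + h) \<bullet> h + C' * (norm h)\<^sup>2))" by (rule sum_mono)
      also have "\<dots> = v \<bullet> h + (\<Sum>i\<in>UNIV. l $ i) * (C' * (norm h)\<^sup>2)"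
        by (simp add: v inner_sum_left distrib_left sum.distrib sum_distrib_right)
      also have "(\<Sum>i\<in>UNIV. l $ i * (f (xbar + h) - f xbar)) = (\<Sum>i\<in>UNIV. l $ i) * (f (xbar + h) - f xbar)"
        by (simp add: sum_distrib_right)
      finally show "f (xbar + h) - f xbar \<le> norm v * norm h + C' * (norm h)\<^sup>2"
        using l norm_cauchy_schwarz[of v h] by (simp add: face_of_simplex_def)
    qed
  qed
  moreover have "C' > 0" using C(1) K(1) by (simp add: C'_def)
  ultimately show thesis using that by blast
qed

text \<open>If the inequality fails with modulus \<^term>\<open>\<mu>\<close>, it fails along a sequence converging to \<^term>\<open>xbar\<close>. The
  approximate convexity inequality turns \<open>norm v < 2 \<mu> sqrt (f x - f xbar)\<close> into a quadratic inequality for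
  \<open>sqrt (f x - f xbar) / norm (x - xbar)\<close>, which is therefore bounded; so the sequence can be blown up,
  and its limit contradicts either nondegeneracy or the assumed lower bound.\<close>

lemma KL_with_modulusI:
  assumes nd: "\<not> degenerate" and \<mu>: "\<mu> > 0"
    and less: "\<And>\<kappa> l b w z. star_system F xbar \<kappa> l b w z \<Longrightarrow> norm w = 1 \<Longrightarrow> \<kappa> > 0 \<Longrightarrow>
      2 * \<mu>\<^sup>2 * \<kappa> < (norm (combined_grad F xbar l b w))\<^sup>2"
  shows "KL_with_modulus f xbar (1/2) \<mu>"
proof (rule ccontr)
  assume neg: "\<not> KL_with_modulus f xbar (1/2) \<mu>"
  obtain C where C: "C > 0" "\<forall>\<^sub>F h in nhds 0. \<forall>v \<in> subdiff f (xbar + h). f (xbar + h) - f xbar \<le> norm v * norm h + C * (norm h)\<^sup>2"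
    using subgradient_inequality by blast
  then obtain \<delta> where \<delta>: "\<delta> > 0" "\<And>h v. norm h < \<delta> \<Longrightarrow> v \<in> subdiff f (xbar + h) \<Longrightarrow>
      f (xbar + h) - f xbar \<le> norm v * norm h + C * (norm h)\<^sup>2"
    unfolding eventually_nhds_metric by (auto simp: dist_norm)
  have "\<exists>x v. norm (x - xbar) \<le> e \<and> f xbar < f x \<and> v \<in> subdiff f x \<and> (norm v)\<^sup>2 < 4 * \<mu>\<^sup>2 * (f x - f xbar)"
    if "e > 0" for e
  proof -
    have "\<not> (\<forall>x. norm (x - xbar) \<le> e \<and> f xbar < f x \<and> ereal (f x) < ereal (f xbar) + 1 \<longrightarrow>
           dist_to_set 0 (subdiff f x) \<ge> ereal (\<mu> / (1 - 1/2) * (f x - f xbar) powr (1/2)))"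
    proof
      assume "\<forall>x. norm (x - xbar) \<le> e \<and> f xbar < f x \<and> ereal (f x) < ereal (f xbar) + 1 \<longrightarrow>
           dist_to_set 0 (subdiff f x) \<ge> ereal (\<mu> / (1 - 1/2) * (f x - f xbar) powr (1/2))"
      then have "KL_with_modulus f xbar (1/2) \<mu>"
        unfolding KL_with_modulus_def using \<mu> \<open>e > 0\<close>
        by (intro conjI exI[of _ e] exI[of _ "1::ereal"]) auto
      then show False using neg by simp
    qed
    then obtain x where x: "norm (x - xbar) \<le> e" "f xbar < f x"
      and "dist_to_set 0 (subdiff f x) < ereal (\<mu> / (1 - 1/2) * (f x - f xbar) powr (1/2))"
      by (auto simp: not_le)
    then obtain v where v: "v \<in> subdiff f x" "norm v < 2 * \<mu> * sqrt (f x - f xbar)"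
      unfolding dist_to_set_def INF_less_iff using x by (auto simp: powr_half_sqrt)
    have "(norm v)\<^sup>2 < (2 * \<mu> * sqrt (f x - f xbar))\<^sup>2" using v(2) by (intro power_strict_mono) auto
    also have "\<dots> = 4 * \<mu>\<^sup>2 * (f x - f xbar)" using x(2) by (simp add: power_mult_distrib)
    finally show ?thesis using x v(1) by blast
  qed
  note seq = this
  have "\<exists>x v. norm (x - xbar) \<le> min (\<delta> / 2) (inverse (real (Suc n))) \<and> f xbar < f x \<and> v \<in> subdiff f x \<and>
      (norm v)\<^sup>2 < 4 * \<mu>\<^sup>2 * (f x - f xbar)" for n
    by (rule seq) (use \<delta>(1) in simp)
  then obtain X V where X0: "\<And>n. norm (X n - xbar) \<le> min (\<delta> / 2) (inverse (real (Suc n)))"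
    and fX: "\<And>n. f xbar < f (X n)" and V: "\<And>n. V n \<in> subdiff f (X n)"
    and Vlt: "\<And>n. (norm (V n))\<^sup>2 < 4 * \<mu>\<^sup>2 * (f (X n) - f xbar)" by metis
  have X: "norm (X n - xbar) < \<delta>" "norm (X n - xbar) \<le> inverse (real (Suc n))" for n
    using X0[of n] \<delta>(1) by simp_all
  have "(\<lambda>n. X n - xbar) \<longlonglongrightarrow> 0"
    by (rule Lim_null_comparison[OF _ LIMSEQ_inverse_real_of_nat]) (use X(2) in \<open>auto intro!: always_eventually\<close>)
  then have Xlim: "X \<longlonglongrightarrow> xbar" by (simp add: LIM_zero_iff)
  have Xne: "X n \<noteq> xbar" for n using fX[of n] by auto
  define A where "A = 2 * \<mu> + C + 1"
  have A: "A \<ge> 1" using \<mu> C(1) by (simp add: A_def)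
  have bound: "norm (V n) \<le> (2 * \<mu> * A) * norm (X n - xbar)" for n
  proof -
    define \<tau> where "\<tau> = norm (X n - xbar)"
    define s where "s = sqrt (f (X n) - f xbar)"
    have s: "s > 0" "s\<^sup>2 = f (X n) - f xbar" using fX[of n] by (simp_all add: s_def)
    have \<tau>: "\<tau> > 0" using Xne[of n] by (simp add: \<tau>_def)
    have "(norm (V n))\<^sup>2 \<le> (2 * \<mu> * s)\<^sup>2" using Vlt[of n] by (simp add: power_mult_distrib s(2))
    then have Vs: "norm (V n) \<le> 2 * \<mu> * s" by (rule power2_le_imp_le) (use \<mu> s in simp)
    have "s\<^sup>2 \<le> norm (V n) * \<tau> + C * \<tau>\<^sup>2"
      using \<delta>(2)[of "X n - xbar" "V n"] X(1)[of n] V[of n] by (simp add: s(2) \<tau>_def)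
    also have "\<dots> \<le> 2 * \<mu> * s * \<tau> + C * \<tau>\<^sup>2" using Vs \<tau> by (simp add: mult_right_mono)
    finally have q: "s\<^sup>2 \<le> 2 * \<mu> * s * \<tau> + C * \<tau>\<^sup>2" .
    have "s \<le> A * \<tau>"
    proof (rule ccontr)
      assume "\<not> s \<le> A * \<tau>"
      then have lt: "A * \<tau> < s" by simp
      have "\<tau> \<le> A * \<tau>" using A \<tau> by simp
      then have "\<tau> < s" using lt by linarith
      then have "C * \<tau> * \<tau> \<le> C * \<tau> * s" using C(1) \<tau> by (intro mult_left_mono) auto
      then have "s * s \<le> (2 * \<mu> + C) * \<tau> * s" using q by (simp add: power2_eq_square algebra_simps)
      then have "s \<le> (2 * \<mu> + C) * \<tau>" using s(1) by simp
      moreover have "(2 * \<mu> + C) * \<tau> \<le> A * \<tau>" using \<tau> by (simp add: A_def)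
      ultimately show False using lt by linarith
    qed
    then have "2 * \<mu> * s \<le> 2 * \<mu> * (A * \<tau>)" using \<mu> by simp
    then show ?thesis using Vs by (simp add: \<tau>_def mult.assoc)
  qed
  obtain s \<kappa> l b w z where s: "strict_mono s" and star: "star_system F xbar \<kappa> l b w z" and w: "norm w = 1"
    and lim: "(\<lambda>k. V (s k) /\<^sub>R norm (X (s k) - xbar)) \<longlonglongrightarrow> combined_grad F xbar l b w"
    and limf: "(\<lambda>k. 2 * (f (X (s k)) - f xbar) / (norm (X (s k) - xbar))\<^sup>2) \<longlonglongrightarrow> \<kappa>"
    by (rule blow_up[OF Xlim Xne V bound])
  have "(norm (combined_grad F xbar l b w))\<^sup>2 \<le> 2 * \<mu>\<^sup>2 * \<kappa>"
  proof (rule LIMSEQ_le)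
    show "(\<lambda>k. (norm (V (s k) /\<^sub>R norm (X (s k) - xbar)))\<^sup>2) \<longlonglongrightarrow> (norm (combined_grad F xbar l b w))\<^sup>2"
      by (intro tendsto_power tendsto_norm lim)
    show "(\<lambda>k. 2 * \<mu>\<^sup>2 * (2 * (f (X (s k)) - f xbar) / (norm (X (s k) - xbar))\<^sup>2)) \<longlonglongrightarrow> 2 * \<mu>\<^sup>2 * \<kappa>"
      by (intro tendsto_mult tendsto_const limf)
    have "(norm (V n /\<^sub>R norm (X n - xbar)))\<^sup>2 \<le> 2 * \<mu>\<^sup>2 * (2 * (f (X n) - f xbar) / (norm (X n - xbar))\<^sup>2)" for n
    proof -
      have "(norm (V n /\<^sub>R norm (X n - xbar)))\<^sup>2 = (norm (V n))\<^sup>2 / (norm (X n - xbar))\<^sup>2"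
        by (simp add: power_mult_distrib divide_inverse power_inverse mult.commute)
      also have "\<dots> \<le> 4 * \<mu>\<^sup>2 * (f (X n) - f xbar) / (norm (X n - xbar))\<^sup>2"
        using Vlt[of n] by (intro divide_right_mono) auto
      also have "4 * a * d / q = 2 * a * (2 * d / q)" for a d q :: real by simp
      finally show ?thesis .
    qed
    then show "\<exists>N. \<forall>n\<ge>N. (norm (V (s n) /\<^sub>R norm (X (s n) - xbar)))\<^sup>2
        \<le> 2 * \<mu>\<^sup>2 * (2 * (f (X (s n)) - f xbar) / (norm (X (s n) - xbar))\<^sup>2)" by blast
  qed
  then have "\<not> \<kappa> > 0" using less[OF star w] by linarith
  then have "2 * \<mu>\<^sup>2 * \<kappa> \<le> 0" by (intro mult_nonneg_nonpos) auto
  then have "combined_grad F xbar l b w = 0"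
    using \<open>(norm (combined_grad F xbar l b w))\<^sup>2 \<le> 2 * \<mu>\<^sup>2 * \<kappa>\<close> by (smt (verit) zero_less_norm_iff zero_less_power)
  then show False using nd star w unfolding degenerate_def by blast
qed

text \<open>Evaluating the inequality at the recovered points, where the distance from the value at \<^term>\<open>xbar\<close> is
  \<^term>\<open>t\<^sup>2 * \<kappa>' / 2\<close> and \<^term>\<open>t *\<^sub>R u'\<close> is a subgradient.\<close>

lemma KL_along_recovery:
  assumes KL: "KL_with_modulus f xbar \<theta> \<mu>"
    and star: "star_system F xbar \<kappa> l b w z" and e: "0 < e" "e < \<kappa>"
  shows "\<forall>\<^sub>F t in at_right 0. \<exists>(u'::real^'n) \<kappa>'. norm u' < norm (combined_grad F xbar l b w) + e \<and>
    \<kappa> - e < \<kappa>' \<and> \<mu> / (1 - \<theta>) * (t\<^sup>2 * \<kappa>' / 2) powr \<theta> \<le> t * norm u'"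
proof -
  obtain \<epsilon> and \<nu>' :: ereal where \<epsilon>: "\<epsilon> > 0" and \<nu>': "\<nu>' > 0"
    and ge: "\<And>x. norm (x - xbar) \<le> \<epsilon> \<Longrightarrow> f xbar < f x \<Longrightarrow> ereal (f x) < ereal (f xbar) + \<nu>' \<Longrightarrow>
      dist_to_set 0 (subdiff f x) \<ge> ereal (\<mu> / (1 - \<theta>) * (f x - f xbar) powr \<theta>)"
    using KL unfolding KL_with_modulus_def by blast
  obtain \<nu> where \<nu>: "\<nu> > 0" "ereal \<nu> < \<nu>'" using ereal_dense2[OF \<nu>'] by auto
  have "((\<lambda>t. t * (norm w + e)) \<longlongrightarrow> 0 * (norm w + e)) (at_right 0)" by (intro tendsto_intros)
  then have E1: "\<forall>\<^sub>F t in at_right 0. t * (norm w + e) < \<epsilon>" by (rule order_tendstoD(2)) (use \<epsilon> in simp)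
  have "((\<lambda>t. t\<^sup>2 * (\<kappa> + e) / 2) \<longlongrightarrow> 0\<^sup>2 * (\<kappa> + e) / 2) (at_right 0)" by (intro tendsto_intros) simp
  then have E2: "\<forall>\<^sub>F t in at_right 0. t\<^sup>2 * (\<kappa> + e) / 2 < \<nu>" by (rule order_tendstoD(2)) (use \<nu> in simp)
  show ?thesis
    using recovery[OF star e(1)] E1 E2 eventually_at_right_less[of "0::real"]
  proof eventually_elim
    case (elim t)
    then obtain w' u' where w': "norm (w' - w) < e" and u': "norm (u' - combined_grad F xbar l b w) < e"
      and close: "\<bar>2 * (f (xbar + t *\<^sub>R w') - f xbar) / t\<^sup>2 - \<kappa>\<bar> < e"
      and sub: "t *\<^sub>R u' \<in> subdiff f (xbar + t *\<^sub>R w')" by blast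
    define \<kappa>' where "\<kappa>' = 2 * (f (xbar + t *\<^sub>R w') - f xbar) / t\<^sup>2"
    have fx: "f (xbar + t *\<^sub>R w') = f xbar + t\<^sup>2 * \<kappa>' / 2" using elim(4) by (simp add: \<kappa>'_def field_simps)
    have \<kappa>': "\<kappa> - e < \<kappa>'" "\<kappa>' < \<kappa> + e" using close by (auto simp: \<kappa>'_def abs_less_iff)
    have "dist_to_set 0 (subdiff f (xbar + t *\<^sub>R w')) \<ge>
      ereal (\<mu> / (1 - \<theta>) * (f (xbar + t *\<^sub>R w') - f xbar) powr \<theta>)"
    proof (rule ge)
      have "norm w' \<le> norm w + e" using norm_triangle_ineq[of w "w' - w"] w' by simp
      then have "t * norm w' \<le> t * (norm w + e)" using elim(4) by (intro mult_left_mono) auto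
      then have "t * norm w' \<le> \<epsilon>" using elim(2) by linarith
      then show "norm (xbar + t *\<^sub>R w' - xbar) \<le> \<epsilon>" using elim(4) by simp
      show "f xbar < f (xbar + t *\<^sub>R w')" using fx \<kappa>' e elim(4) by simp
      have "t\<^sup>2 * \<kappa>' \<le> t\<^sup>2 * (\<kappa> + e)" using \<kappa>' by (intro mult_left_mono) auto
      then have "ereal (f (xbar + t *\<^sub>R w')) < ereal (f xbar) + ereal \<nu>" using fx elim(3) by simp
      also have "\<dots> \<le> ereal (f xbar) + \<nu>'" using \<nu>(2) by (intro add_left_mono) simp
      finally show "ereal (f (xbar + t *\<^sub>R w')) < ereal (f xbar) + \<nu>'" .
    qed
    also have "dist_to_set 0 (subdiff f (xbar + t *\<^sub>R w')) \<le> ereal (norm (t *\<^sub>R u' - 0))"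
      unfolding dist_to_set_def by (rule INF_lower[OF sub])
    finally have "\<mu> / (1 - \<theta>) * (t\<^sup>2 * \<kappa>' / 2) powr \<theta> \<le> t * norm u'" using elim(4) by (simp add: fx)
    moreover have "norm u' < norm (combined_grad F xbar l b w) + e"
      using norm_triangle_ineq[of "combined_grad F xbar l b w" "u' - combined_grad F xbar l b w"] u' by simp
    ultimately show ?case using \<kappa>'(1) by blast
  qed
qed

lemma KL_modulus_upper_bound:
  assumes KL: "KL_with_modulus f xbar (1/2) \<mu>" and star: "star_system F xbar \<kappa> l b w z" and "\<kappa> > 0"
  shows "2 * \<mu>\<^sup>2 * \<kappa> \<le> (norm (combined_grad F xbar l b w))\<^sup>2"
proof -
  define c where "c = norm (combined_grad F xbar l b w)"
  have \<mu>: "\<mu> > 0" using KL by (simp add: KL_with_modulus_def)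
  have "2 * \<mu>\<^sup>2 * (\<kappa> - e) \<le> (c + e)\<^sup>2" if e: "0 < e" "e < \<kappa>" for e
  proof -
    have "\<exists>t. 0 < t \<and> (\<exists>(u'::real^'n) \<kappa>'. norm u' < c + e \<and> \<kappa> - e < \<kappa>' \<and>
      \<mu> / (1 - 1/2) * (t\<^sup>2 * \<kappa>' / 2) powr (1/2) \<le> t * norm u')"
      by (rule eventually_happens'[OF trivial_limit_at_right_real])
        (use eventually_conj[OF eventually_at_right_less[of "0::real"] KL_along_recovery[OF KL star e]]
          in \<open>simp add: c_def\<close>)
    then obtain t \<kappa>' and u' :: "real^'n" where t: "0 < t" and u': "norm u' < c + e" and \<kappa>': "\<kappa> - e < \<kappa>'"
      and le: "\<mu> / (1 - 1/2) * (t\<^sup>2 * \<kappa>' / 2) powr (1/2) \<le> t * norm u'" by blast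
    have \<kappa>'0: "0 < \<kappa>'" using \<kappa>' e by linarith
    have "(t\<^sup>2 * \<kappa>' / 2) powr (1/2) = t * sqrt (\<kappa>' / 2)"
      using t \<kappa>'0 by (simp add: powr_half_sqrt real_sqrt_mult real_sqrt_divide)
    then have "t * (2 * \<mu> * sqrt (\<kappa>' / 2)) \<le> t * norm u'" using le by (simp add: mult.left_commute mult.commute)
    then have "2 * \<mu> * sqrt (\<kappa>' / 2) \<le> norm u'" using t by (simp only: mult_le_cancel_left_pos)
    then have "2 * \<mu> * sqrt (\<kappa>' / 2) \<le> c + e" using u' by linarith
    then have "(2 * \<mu> * sqrt (\<kappa>' / 2))\<^sup>2 \<le> (c + e)\<^sup>2" using \<mu> \<kappa>'0 by (intro power_mono) auto
    then have "2 * \<mu>\<^sup>2 * \<kappa>' \<le> (c + e)\<^sup>2" using \<kappa>'0 by (simp add: power_mult_distrib mult_ac)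
    moreover have "2 * \<mu>\<^sup>2 * (\<kappa> - e) \<le> 2 * \<mu>\<^sup>2 * \<kappa>'" using \<kappa>' by (intro mult_left_mono) auto
    ultimately show ?thesis by linarith
  qed
  then have ev: "\<forall>\<^sub>F e in at_right 0. 2 * \<mu>\<^sup>2 * (\<kappa> - e) \<le> (c + e)\<^sup>2"
    using eventually_at_right_real[OF \<open>\<kappa> > 0\<close>] by (auto elim: eventually_mono)
  have "2 * \<mu>\<^sup>2 * (\<kappa> - 0) \<le> (c + 0)\<^sup>2"
  proof (rule tendsto_le[OF trivial_limit_at_right_real _ _ ev])
    show "((\<lambda>e. (c + e)\<^sup>2) \<longlongrightarrow> (c + 0)\<^sup>2) (at_right 0)" by (intro tendsto_intros)
    show "((\<lambda>e. 2 * \<mu>\<^sup>2 * (\<kappa> - e)) \<longlongrightarrow> 2 * \<mu>\<^sup>2 * (\<kappa> - 0)) (at_right 0)" by (intro tendsto_intros)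
  qed
  then show ?thesis by (simp add: c_def)
qed

text \<open>At the recovered points the two sides of the inequality have orders \<open>t powr (2 * \<theta>)\<close> and \<^term>\<open>t\<close>.\<close>

lemma no_smaller_KL_exponent:
  assumes star: "star_system F xbar \<kappa> l b w z" "\<kappa> > 0" and \<theta>: "0 \<le> \<theta>" "\<theta> < 1/2"
  shows "\<not> KL_with_modulus f xbar \<theta> \<mu>"
proof
  assume KL: "KL_with_modulus f xbar \<theta> \<mu>"
  define c where "c = norm (combined_grad F xbar l b w) + \<kappa> / 2"
  define m where "m = \<mu> / (1 - \<theta>) * (\<kappa> / 4) powr \<theta>"
  have \<mu>: "\<mu> > 0" using KL by (simp add: KL_with_modulus_def)
  have m: "m > 0" using \<mu> \<theta> star(2) by (simp add: m_def)
  have "((\<lambda>t. t powr (1 - 2 * \<theta>) * c) \<longlongrightarrow> 0 * c) (at_right 0)"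
    by (intro tendsto_mult tendsto_const tendsto_zero_powrI[OF tendsto_ident_at tendsto_const])
      (use \<theta> in \<open>auto simp: eventually_at_right_less intro: eventually_mono[OF eventually_at_right_less[of "0::real"]]\<close>)
  then have lt: "\<forall>\<^sub>F t in at_right 0. t powr (1 - 2 * \<theta>) * c < m" by (rule order_tendstoD(2)) (use m in simp)
  have "\<forall>\<^sub>F t in at_right 0. \<exists>(u'::real^'n) \<kappa>'. norm u' < norm (combined_grad F xbar l b w) + \<kappa> / 2 \<and>
    \<kappa> - \<kappa> / 2 < \<kappa>' \<and> \<mu> / (1 - \<theta>) * (t\<^sup>2 * \<kappa>' / 2) powr \<theta> \<le> t * norm u'"
    by (rule KL_along_recovery[OF KL star(1)]) (use star(2) in auto)
  with lt eventually_at_right_less[of "0::real"] have "\<forall>\<^sub>F t in at_right (0::real). False"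
  proof eventually_elim
    case (elim t)
    then obtain u' :: "real^'n" and \<kappa>' where u': "norm u' < c" and \<kappa>': "\<kappa> / 2 < \<kappa>'"
      and le: "\<mu> / (1 - \<theta>) * (t\<^sup>2 * \<kappa>' / 2) powr \<theta> \<le> t * norm u'" by (auto simp: c_def)
    have t: "t > 0" by (rule elim(2))
    have "t\<^sup>2 = t powr 2" using t by simp
    then have "(t\<^sup>2) powr \<theta> = t powr (2 * \<theta>)" by (simp only: powr_powr)
    then have "(t\<^sup>2 * (\<kappa> / 4)) powr \<theta> = t powr (2 * \<theta>) * (\<kappa> / 4) powr \<theta>"
      using t star(2) by (subst powr_mult) simp_all
    then have "t powr (2 * \<theta>) * m = \<mu> / (1 - \<theta>) * (t\<^sup>2 * (\<kappa> / 4)) powr \<theta>"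
      by (simp add: m_def)
    also have "\<dots> \<le> \<mu> / (1 - \<theta>) * (t\<^sup>2 * \<kappa>' / 2) powr \<theta>"
    proof (rule mult_left_mono)
      have "t\<^sup>2 * (\<kappa> / 4) \<le> t\<^sup>2 * (\<kappa>' / 2)" using \<kappa>' by (intro mult_left_mono) auto
      then show "(t\<^sup>2 * (\<kappa> / 4)) powr \<theta> \<le> (t\<^sup>2 * \<kappa>' / 2) powr \<theta>"
        using \<theta>(1) star(2) by (intro powr_mono2) auto
      show "0 \<le> \<mu> / (1 - \<theta>)" using \<mu> \<theta> by simp
    qed
    also have "\<dots> \<le> t * norm u'" by (rule le)
    also have "\<dots> \<le> t * c" using u' t by simp
    also have "t * c = t powr (2 * \<theta>) * (t powr (1 - 2 * \<theta>) * c)"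
      using t by (simp flip: mult.assoc powr_add)
    finally have "m \<le> t powr (1 - 2 * \<theta>) * c" using t by simp
    then show False using elim(1) by linarith
  qed
  then show False by simp
qed

lemma optval_KL_nonneg: "0 \<le> optval_KL F xbar"
  unfolding optval_KL_def by (rule INF_greatest) (auto simp: zero_ereal_def)

lemma KL_modulus_eq:
  assumes nd: "\<not> degenerate"
  shows "KL_modulus f xbar (1/2) = ereal_sqrt (optval_KL F xbar)"
proof (rule antisym)
  have ge0: "ereal 0 \<le> ereal_sqrt (optval_KL F xbar)"
    using le_ereal_sqrt_iff[of 0 "optval_KL F xbar"] optval_KL_nonneg by (simp add: zero_ereal_def)
  show "KL_modulus f xbar (1/2) \<le> ereal_sqrt (optval_KL F xbar)"
    unfolding KL_modulus_def
  proof (rule Sup_least)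
    fix y assume "y \<in> insert 0 {ereal \<mu> |\<mu>. KL_with_modulus f xbar (1/2) \<mu>}"
    then consider "y = 0" | \<mu> where "y = ereal \<mu>" "KL_with_modulus f xbar (1/2) \<mu>" by auto
    then show "y \<le> ereal_sqrt (optval_KL F xbar)"
    proof cases
      case 1
      then show ?thesis using ge0 by (simp add: zero_ereal_def)
    next
      case 2
      have "ereal (\<mu>\<^sup>2) \<le> optval_KL F xbar"
        unfolding optval_KL_def
      proof (rule INF_greatest, clarify)
        fix \<kappa> l b and w z :: "real^'n"
        assume "star_system F xbar \<kappa> l b w z" "\<kappa> > 0"
        then show "ereal (\<mu>\<^sup>2) \<le> ereal (1/2 * ((norm (combined_grad F xbar l b w))\<^sup>2 / \<kappa>))"
          using KL_modulus_upper_bound[OF 2(2)] by (simp add: field_simps)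
      qed
      moreover have "0 \<le> \<mu>" using 2(2) by (simp add: KL_with_modulus_def)
      ultimately show ?thesis using 2(1) le_ereal_sqrt_iff optval_KL_nonneg by simp
    qed
  qed
  show "ereal_sqrt (optval_KL F xbar) \<le> KL_modulus f xbar (1/2)"
  proof (rule ccontr)
    assume "\<not> ereal_sqrt (optval_KL F xbar) \<le> KL_modulus f xbar (1/2)"
    then have "KL_modulus f xbar (1/2) < ereal_sqrt (optval_KL F xbar)" by simp
    then obtain m where m: "KL_modulus f xbar (1/2) < ereal m" "ereal m < ereal_sqrt (optval_KL F xbar)"
      using ereal_dense2 by blast
    obtain \<mu> where \<mu>: "ereal m < ereal \<mu>" "ereal \<mu> < ereal_sqrt (optval_KL F xbar)"
      using ereal_dense2[OF m(2)] by blast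
    have "0 \<le> KL_modulus f xbar (1/2)" unfolding KL_modulus_def by (rule Sup_upper) simp
    then have "0 < ereal m" using m(1) by (rule le_less_trans)
    then have m0: "0 < m" "m < \<mu>" using \<mu>(1) by simp_all
    have "ereal (\<mu>\<^sup>2) \<le> optval_KL F xbar"
      using less_imp_le[OF \<mu>(2)] m0 le_ereal_sqrt_iff[of \<mu>] optval_KL_nonneg by simp
    have "KL_with_modulus f xbar (1/2) m"
    proof (rule KL_with_modulusI[OF nd m0(1)])
      fix \<kappa> l b and w z :: "real^'n"
      assume star: "star_system F xbar \<kappa> l b w z" "norm w = 1" "\<kappa> > 0"
      have "ereal (\<mu>\<^sup>2) \<le> ereal (1/2 * ((norm (combined_grad F xbar l b w))\<^sup>2 / \<kappa>))"
        using \<open>ereal (\<mu>\<^sup>2) \<le> optval_KL F xbar\<close> unfolding optval_KL_def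
        by (rule order_trans) (rule INF_lower2[of "(\<kappa>, l, b, w, z)"], use star in auto)
      then have "2 * \<mu>\<^sup>2 * \<kappa> \<le> (norm (combined_grad F xbar l b w))\<^sup>2" using star(3) by (simp add: field_simps)
      moreover have "m\<^sup>2 < \<mu>\<^sup>2" using m0 by (intro power_strict_mono) auto
      then have "2 * m\<^sup>2 * \<kappa> < 2 * \<mu>\<^sup>2 * \<kappa>" using star(3) by simp
      ultimately show "2 * m\<^sup>2 * \<kappa> < (norm (combined_grad F xbar l b w))\<^sup>2" by linarith
    qed
    then have "ereal m \<le> KL_modulus f xbar (1/2)" unfolding KL_modulus_def by (intro Sup_upper) auto
    then show False using m(1) by simp
  qed
qed

text \<open>By nondegeneracy the combined gradients are bounded away from 0, and \<^term>\<open>\<kappa>\<close> is bounded above by the norms of the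
  Hessians.\<close>

lemma KL_property_half:
  assumes "\<not> degenerate"
  shows "KL_property f xbar (1/2)"
proof -
  obtain e where e: "e > 0" and ge: "\<And>\<kappa> l b w z. star_system F xbar \<kappa> l b w z \<Longrightarrow> norm w = 1 \<Longrightarrow>
      e \<le> norm (combined_grad F xbar l b w)"
    using assms degenerate_if_approximately by (meson not_le)
  obtain K where K: "K > 0" "\<And>l w. multiplier l \<Longrightarrow> \<bar>curvature l w\<bar> \<le> K * (norm w)\<^sup>2"
    using curvature_bound by blast
  define \<mu> where "\<mu> = e / (2 * sqrt K)"
  have \<mu>: "\<mu> > 0" "\<mu>\<^sup>2 * K = e\<^sup>2 / 4" using e K(1) by (simp_all add: \<mu>_def power_divide power_mult_distrib)
  have "KL_with_modulus f xbar (1/2) \<mu>"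
  proof (rule KL_with_modulusI[OF assms \<mu>(1)])
    fix \<kappa> l b and w z :: "real^'n"
    assume star: "star_system F xbar \<kappa> l b w z" and w: "norm w = 1" and "\<kappa> > 0"
    have "\<kappa> \<le> K" using K(2)[of l w] star w by (auto simp: star_system_iff)
    then have "2 * \<mu>\<^sup>2 * \<kappa> \<le> 2 * (\<mu>\<^sup>2 * K)" by (simp add: mult_left_mono)
    also have "\<dots> = e\<^sup>2 / 2" using \<mu>(2) by simp
    also have "\<dots> < e\<^sup>2" using e by simp
    also have "\<dots> \<le> (norm (combined_grad F xbar l b w))\<^sup>2" using ge[OF star w] e by (intro power_mono) auto
    finally show "2 * \<mu>\<^sup>2 * \<kappa> < (norm (combined_grad F xbar l b w))\<^sup>2" .
  qed
  then show ?thesis by (auto simp: KL_property_def)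
qed

text \<open>On the critical cone the second subderivative equals the maximal curvature of a multiplier, and by
  duality this is the value of \<open>\<kappa>\<close> in every solution with direction \<open>w\<close>.\<close>

lemma positive_curvature_iff:
  assumes "0 \<in> subdiff f xbar"
  shows "(\<exists>w\<in>crit_cone F xbar. second_subderiv0 f xbar w > 0)
    \<longleftrightarrow> (\<exists>\<kappa> l b w z. star_system F xbar \<kappa> l b w z \<and> \<kappa> > 0)"
proof
  assume "\<exists>w\<in>crit_cone F xbar. second_subderiv0 f xbar w > 0"
  then obtain w where w: "w \<in> crit_cone F xbar" "second_subderiv0 f xbar w > 0" by blast
  obtain l0 where "multiplier l0" using ex_multiplier[OF assms] by blast
  then obtain l where l: "multiplier l" and max: "\<And>l'. multiplier l' \<Longrightarrow> curvature l' w \<le> curvature l w"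
    using ex_maximal_multiplier by blast
  obtain z where z: "\<And>i. i \<in> I \<Longrightarrow> g i \<bullet> z + (H i *v w) \<bullet> w \<le> curvature l w"
    using ex_dual_solution[OF l max] by blast
  have "second_subderiv0 f xbar w \<le> ereal (curvature l w)"
    by (rule second_subderiv_le[OF _ z]) (use w(1) in \<open>auto simp: crit_cone_def\<close>)
  with w(2) have "0 < ereal (curvature l w)" by (rule less_le_trans)
  then have "curvature l w > 0" by simp
  moreover have "star_system F xbar (curvature l w) l 0 w z"
    unfolding star_system_iff using l w(1) z by simp
  ultimately show "\<exists>\<kappa> l b w z. star_system F xbar \<kappa> l b w z \<and> \<kappa> > 0" by blast
next
  assume "\<exists>\<kappa> l b w z. star_system F xbar \<kappa> l b w z \<and> \<kappa> > 0"
  then obtain \<kappa> l b w z where star: "star_system F xbar \<kappa> l b w z" "\<kappa> > 0" by blast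
  have "ereal \<kappa> \<le> second_subderiv0 f xbar w"
    using star(1) second_subderiv_ge_curvature by (simp add: star_system_iff)
  moreover have "0 < ereal \<kappa>" using star(2) by simp
  ultimately have "0 < second_subderiv0 f xbar w" by (rule less_le_trans[rotated])
  then show "\<exists>w\<in>crit_cone F xbar. second_subderiv0 f xbar w > 0"
    using star(1) by (auto simp: star_system_iff)
qed

end

theorem proposition5p2:
  fixes F :: "'m::finite \<Rightarrow> real^'n \<Rightarrow> real" and xbar :: "real^'n"
  assumes "\<And>i. C2 (F i)"
    and "0 \<in> subdiff (pmax F) xbar"
  shows "(cond_a F xbar \<longleftrightarrow> cond_b F xbar) \<and> (cond_b F xbar \<longleftrightarrow> cond_c F xbar) \<and>
    (cond_a F xbar \<or> cond_b F xbar \<or> cond_c F xbar \<longrightarrow>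
       KL_property (pmax F) xbar (1/2) \<and>
       ((\<exists>w\<in>crit_cone F xbar. second_subderiv0 (pmax F) xbar w > 0)
          \<longleftrightarrow> (\<exists>\<kappa> l b w z. star_system F xbar \<kappa> l b w z \<and> \<kappa> > 0)) \<and>
       ((\<exists>w\<in>crit_cone F xbar. second_subderiv0 (pmax F) xbar w > 0)
          \<longrightarrow> sharp_KL_exponent (pmax F) xbar (1/2)) \<and>
       KL_modulus (pmax F) xbar (1/2) = ereal_sqrt (optval_KL F xbar))"
proof -
  interpret C2_max F xbar by unfold_locales (rule assms(1))
  have "sharp_KL_exponent (pmax F) xbar (1/2)"
    if nd: "\<not> degenerate" and pos: "\<exists>w\<in>crit_cone F xbar. second_subderiv0 (pmax F) xbar w > 0"
  proof -
    obtain \<kappa> l b w z where star: "star_system F xbar \<kappa> l b w z" "\<kappa> > 0"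
      using pos positive_curvature_iff[OF assms(2)] by blast
    then have "\<not> KL_property (pmax F) xbar \<theta>" if "\<theta> \<in> {0..<1/2}" for \<theta>
      using no_smaller_KL_exponent[OF star] that unfolding KL_property_def by simp
    then show ?thesis
      using KL_property_half[OF nd] by (simp add: sharp_KL_exponent_def)
  qed
  then show ?thesis
    using cond_a_iff[OF assms(2)] cond_b_iff cond_c_iff KL_property_half KL_modulus_eq
      positive_curvature_iff[OF assms(2)] by blast
qed

end
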